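(* Let $X$ be a smooth projective variety over $\mathbb{C}$, $A$ a semi-ample line bundle on $X$, and $L$ a pseudo-effective line bundle on $X$. Then the restriction of a minimal singular metric of $\mathcal{O}_{\mathbb{P}(A\oplus L)}(1)$ on $\mathbb{P}(A\oplus L)$ to the divisor $\mathbb{P}(L)\subset\mathbb{P}(A\oplus L)$ corresponding to the projection $A\oplus L\to L$ gives a minimal singular metric of $L$ on $X$, via the natural identification $(\mathbb{P}(L),\mathcal{O}_{\mathbb{P}(L)}(1))\cong(X,L)$.
   Context: $\mathbb{P}(E)$ denotes the projective bundle of rank-one quotients of $E$, equivalently of lines in the fibers of the dual bundle $E^{*}$, with relative hyperplane bundle $\mathcal{O}_{\mathbb{P}(E)}(1)$ (dual to the tautological line subbundle of the pull-back of $E^*$). The quotient $A\oplus L\to L$ gives the section $\mathbb{P}(L)\subset\mathbb{P}(A\oplus L)$, and $\mathcal{O}_{\mathbb{P}(A\oplus L)}(1)|_{\mathbb{P}(L)}\cong L$ under $\mathbb{P}(L)\cong X$. A singular Hermitian metric on a line bundle is written $h=e^{-\varphi}$ with local weights $\varphi$ ($L^1_{\rm loc}$ functions relative to local holomorphic trivializations). A line bundle is pseudo-effective if it admits a singular Hermitian metric with plurisubharmonic (psh) local weights. A minimal singular metric of a pseudo-effective line bundle $M$ on a compact complex manifold is a singular Hermitian metric $e^{-\varphi_{\min}}$ with psh local weights such that for every singular Hermitian metric $e^{-\varphi}$ of $M$ with psh local weights there is a constant $C$ with $\varphi\le\varphi_{\min}+C$ globally. *)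

theory Defs
  imports "HOL-Analysis.Analysis"
begin

section \<open>Several complex variables\<close>

text \<open>The space of n-tuples of complex numbers is rendered as the set of sequences that vanish
  from index n on, with the topology induced by the product topology of the function type
  (on this set, the Euclidean topology).  The dimension is a natural number, and 0 is allowed.\<close>

definition cspace :: "nat \<Rightarrow> (nat \<Rightarrow> complex) set" where
  "cspace n = {z. \<forall>i\<ge>n. z i = 0}"

definition copen :: "nat \<Rightarrow> (nat \<Rightarrow> complex) set \<Rightarrow> bool" where
  "copen n W \<longleftrightarrow> openin (top_of_set (cspace n)) W"

definition cnorm :: "nat \<Rightarrow> (nat \<Rightarrow> complex) \<Rightarrow> real" where
  "cnorm n v = L2_set (\<lambda>i. cmod (v i)) {..<n}"

text \<open>Holomorphic means complex (Frechet) differentiable at every point.\<close>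

definition holo_on :: "nat \<Rightarrow> (nat \<Rightarrow> complex) set \<Rightarrow> ((nat \<Rightarrow> complex) \<Rightarrow> complex) \<Rightarrow> bool" where
  "holo_on n W f \<longleftrightarrow> (\<forall>z\<in>W. \<exists>a :: nat \<Rightarrow> complex. \<forall>\<epsilon>>0. \<exists>\<delta>>0. \<forall>v\<in>cspace n. cnorm n v < \<delta> \<longrightarrow>
     cmod (f (\<lambda>i. z i + v i) - f z - (\<Sum>i<n. a i * v i)) \<le> \<epsilon> * cnorm n v)"

definition partial_deriv :: "((nat \<Rightarrow> complex) \<Rightarrow> complex) \<Rightarrow> nat \<Rightarrow> (nat \<Rightarrow> complex) \<Rightarrow> complex" where
  "partial_deriv f j z = deriv (\<lambda>t. f (z(j := t))) (z j)"

text \<open>Lebesgue measure, transported from the product measure on extensional functions.\<close>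

definition lebesgue_cspace :: "nat \<Rightarrow> (nat \<Rightarrow> complex) measure" where
  "lebesgue_cspace n = completion (distr (Pi\<^sub>M {..<n} (\<lambda>_. lborel :: complex measure)) borel
     (\<lambda>x i. if i < n then x i else 0))"

definition L1_loc :: "nat \<Rightarrow> (nat \<Rightarrow> complex) set \<Rightarrow> ((nat \<Rightarrow> complex) \<Rightarrow> ereal) \<Rightarrow> bool" where
  "L1_loc n W u \<longleftrightarrow> u \<in> borel_measurable (restrict_space (lebesgue_cspace n) W) \<and>
     (\<forall>K. compact K \<and> K \<subseteq> W \<longrightarrow>
        (\<integral>\<^sup>+z. e2ennreal \<bar>u z\<bar> * indicator K z \<partial>lebesgue_cspace n) < \<infinity>)"

text \<open>The mean of u over the circle of radius r around z in the complex line z + C v, as the mean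
  of the positive part minus the mean of the negative part (\<open>e2ennreal\<close> truncates at 0).  For u
  upper semicontinuous with values below \<open>\<infinity>\<close> and small r the first term is finite.\<close>

definition circle_mean ::
  "((nat \<Rightarrow> complex) \<Rightarrow> ereal) \<Rightarrow> (nat \<Rightarrow> complex) \<Rightarrow> (nat \<Rightarrow> complex) \<Rightarrow> real \<Rightarrow> ereal" where
  "circle_mean u z v r =
     (let f = (\<lambda>s. u (\<lambda>i. z i + of_real r * cis s * v i)); M = uniform_measure lborel {0..2*pi}
      in enn2ereal (\<integral>\<^sup>+s. e2ennreal (f s) \<partial>M) - enn2ereal (\<integral>\<^sup>+s. e2ennreal (- f s) \<partial>M))"

text \<open>Plurisubharmonic: upper semicontinuous with values in \<open>[-\<infinity>,\<infinity>)\<close>, and satisfying the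
  local submean inequality on every complex line.  The function \<open>-\<infinity>\<close> is not excluded here;
  for weights of metrics it is excluded by local integrability.\<close>

definition psh_on :: "nat \<Rightarrow> (nat \<Rightarrow> complex) set \<Rightarrow> ((nat \<Rightarrow> complex) \<Rightarrow> ereal) \<Rightarrow> bool" where
  "psh_on n W u \<longleftrightarrow>
     (\<forall>a. openin (top_of_set W) {z \<in> W. u z < a}) \<and> (\<forall>z\<in>W. u z < \<infinity>) \<and>
     (\<forall>z\<in>W. \<forall>v\<in>cspace n. \<exists>\<rho>>0. \<forall>r. 0 < r \<and> r < \<rho> \<longrightarrow> u z \<le> circle_mean u z v r)"


section \<open>Complex manifolds\<close>

record 'p cmanifold =
  points :: "'p set"
  cdim :: nat
  charts :: "('p set \<times> ('p \<Rightarrow> nat \<Rightarrow> complex)) set"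

definition mtop :: "'p cmanifold \<Rightarrow> 'p topology" where
  "mtop X = topology_generated_by {U. \<exists>(D, c) \<in> charts X. U \<subseteq> D \<and> copen (cdim X) (c ` U)}"

definition complex_manifold :: "'p cmanifold \<Rightarrow> bool" where
  "complex_manifold X \<longleftrightarrow>
     (\<Union>(D, c)\<in>charts X. D) = points X \<and>
     (\<forall>(D, c)\<in>charts X. inj_on c D \<and> copen (cdim X) (c ` D)) \<and>
     (\<forall>(D, c)\<in>charts X. \<forall>(D', c')\<in>charts X. copen (cdim X) (c ` (D \<inter> D')) \<and>
        (\<forall>i<cdim X. holo_on (cdim X) (c ` (D \<inter> D')) (\<lambda>z. c' (inv_into D c z) i))) \<and>
     Hausdorff_space (mtop X) \<and> second_countable (mtop X)"

definition holo_fun :: "'p cmanifold \<Rightarrow> 'p set \<Rightarrow> ('p \<Rightarrow> complex) \<Rightarrow> bool" where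
  "holo_fun X U f \<longleftrightarrow>
     (\<forall>(D, c)\<in>charts X. holo_on (cdim X) (c ` (U \<inter> D)) (\<lambda>z. f (inv_into D c z)))"

definition psh_fun :: "'p cmanifold \<Rightarrow> 'p set \<Rightarrow> ('p \<Rightarrow> ereal) \<Rightarrow> bool" where
  "psh_fun X U u \<longleftrightarrow>
     (\<forall>(D, c)\<in>charts X. psh_on (cdim X) (c ` (U \<inter> D)) (\<lambda>z. u (inv_into D c z)))"

definition L1_loc_fun :: "'p cmanifold \<Rightarrow> 'p set \<Rightarrow> ('p \<Rightarrow> ereal) \<Rightarrow> bool" where
  "L1_loc_fun X U u \<longleftrightarrow>
     (\<forall>(D, c)\<in>charts X. L1_loc (cdim X) (c ` (U \<inter> D)) (\<lambda>z. u (inv_into D c z)))"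

definition holo_map :: "'p cmanifold \<Rightarrow> 'q cmanifold \<Rightarrow> ('p \<Rightarrow> 'q) \<Rightarrow> bool" where
  "holo_map X Y F \<longleftrightarrow> continuous_map (mtop X) (mtop Y) F \<and>
     (\<forall>(D, c)\<in>charts X. \<forall>(D', c')\<in>charts Y. \<forall>i<cdim Y.
        holo_on (cdim X) (c ` {x \<in> D. F x \<in> D'}) (\<lambda>z. c' (F (inv_into D c z)) i))"

definition immersion :: "'p cmanifold \<Rightarrow> 'q cmanifold \<Rightarrow> ('p \<Rightarrow> 'q) \<Rightarrow> bool" where
  "immersion X Y F \<longleftrightarrow> holo_map X Y F \<and>
     (\<forall>(D, c)\<in>charts X. \<forall>(D', c')\<in>charts Y. \<forall>x\<in>D. F x \<in> D' \<longrightarrow>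
        (\<forall>v\<in>cspace (cdim X).
           (\<forall>i<cdim Y. (\<Sum>j<cdim X. v j * partial_deriv (\<lambda>z. c' (F (inv_into D c z)) i) j (c x)) = 0)
           \<longrightarrow> v = (\<lambda>_. 0)))"


section \<open>Smooth projective varieties\<close>

text \<open>The complex line spanned by v, where vectors are complex-valued functions.\<close>

definition cline :: "('i \<Rightarrow> complex) \<Rightarrow> ('i \<Rightarrow> complex) set" where
  "cline v = range (\<lambda>c i. c * v i)"

text \<open>The element of the line l that takes the value 1 at p.\<close>

definition normalized :: "('i \<Rightarrow> complex) set \<Rightarrow> 'i \<Rightarrow> 'i \<Rightarrow> complex" where
  "normalized l p = (THE v. v \<in> l \<and> v p = 1)"

definition proj_space :: "nat \<Rightarrow> (nat \<Rightarrow> complex) set cmanifold" where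
  "proj_space N =
     (let P = {cline v | v. v \<in> cspace (Suc N) \<and> v \<noteq> (\<lambda>_. 0)} in
      \<lparr> points = P, cdim = N,
        charts = {({l \<in> P. \<exists>v\<in>l. v k \<noteq> 0}, \<lambda>l i. normalized l k (if i < k then i else Suc i)) |
                  k. k \<le> N} \<rparr>)"

definition homogeneous_poly :: "nat \<Rightarrow> ((nat \<Rightarrow> complex) \<Rightarrow> complex) \<Rightarrow> bool" where
  "homogeneous_poly N f \<longleftrightarrow> (\<exists>d M (a :: (nat \<Rightarrow> nat) \<Rightarrow> complex).
     finite M \<and> (\<forall>m\<in>M. (\<Sum>i\<le>N. m i) = d) \<and> f = (\<lambda>v. \<Sum>m\<in>M. a m * (\<Prod>i\<le>N. v i ^ m i)))"

definition zariski_closed :: "nat \<Rightarrow> (nat \<Rightarrow> complex) set set \<Rightarrow> bool" where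
  "zariski_closed N V \<longleftrightarrow> (\<exists>F. (\<forall>f\<in>F. homogeneous_poly N f) \<and>
     V = {l \<in> points (proj_space N). \<forall>f\<in>F. \<forall>v\<in>l. v \<noteq> (\<lambda>_. 0) \<longrightarrow> f v = 0})"

definition projective_variety :: "nat \<Rightarrow> (nat \<Rightarrow> complex) set set \<Rightarrow> bool" where
  "projective_variety N V \<longleftrightarrow> zariski_closed N V \<and> V \<noteq> {} \<and>
     (\<forall>V1 V2. zariski_closed N V1 \<and> zariski_closed N V2 \<and> V = V1 \<union> V2 \<longrightarrow> V = V1 \<or> V = V2)"

text \<open>A smooth projective variety, as a complex manifold: a complex manifold embedded
  holomorphically in some projective space, onto an irreducible Zariski closed subset.  In
  particular it is compact and connected.\<close>

definition smooth_projective_variety :: "'p cmanifold \<Rightarrow> bool" where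
  "smooth_projective_variety X \<longleftrightarrow> complex_manifold X \<and>
     (\<exists>N \<iota>. immersion X (proj_space N) \<iota> \<and> embedding_map (mtop X) (mtop (proj_space N)) \<iota> \<and>
            projective_variety N (\<iota> ` points X))"


section \<open>Holomorphic line bundles\<close>

text \<open>A local trivialization is a pair of its domain in the base and its fibre coordinate, a
  function on the total space.\<close>

record ('p, 'e) line_bundle =
  lb_total :: "'e set"
  lb_proj :: "'e \<Rightarrow> 'p"
  lb_zero :: "'p \<Rightarrow> 'e"
  lb_add :: "'e \<Rightarrow> 'e \<Rightarrow> 'e"
  lb_scale :: "complex \<Rightarrow> 'e \<Rightarrow> 'e"
  lb_trivs :: "('p set \<times> ('e \<Rightarrow> complex)) set"

definition fibre :: "('p, 'e) line_bundle \<Rightarrow> 'p \<Rightarrow> 'e set" where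
  "fibre L x = {e \<in> lb_total L. lb_proj L e = x}"

definition holomorphic_line_bundle :: "'p cmanifold \<Rightarrow> ('p, 'e) line_bundle \<Rightarrow> bool" where
  "holomorphic_line_bundle X L \<longleftrightarrow>
     lb_proj L ` lb_total L \<subseteq> points X \<and>
     (\<forall>x\<in>points X. lb_zero L x \<in> fibre L x \<and>
        (\<forall>e\<in>fibre L x. (\<forall>e'\<in>fibre L x. lb_add L e e' \<in> fibre L x) \<and>
                        (\<forall>a. lb_scale L a e \<in> fibre L x))) \<and>
     (\<Union>(U, \<theta>)\<in>lb_trivs L. U) = points X \<and>
     (\<forall>(U, \<theta>)\<in>lb_trivs L. openin (mtop X) U \<and>
        (\<forall>x\<in>U. bij_betw \<theta> (fibre L x) UNIV \<and> \<theta> (lb_zero L x) = 0 \<and>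
           (\<forall>e\<in>fibre L x. (\<forall>e'\<in>fibre L x. \<theta> (lb_add L e e') = \<theta> e + \<theta> e') \<and>
                           (\<forall>a. \<theta> (lb_scale L a e) = a * \<theta> e)))) \<and>
     (\<forall>(U, \<theta>)\<in>lb_trivs L. \<forall>(U', \<theta>')\<in>lb_trivs L. \<exists>g. holo_fun X (U \<inter> U') g \<and>
        (\<forall>x\<in>U \<inter> U'. g x \<noteq> 0 \<and> (\<forall>e\<in>fibre L x. \<theta>' e = g x * \<theta> e)))"

text \<open>The local frame of a trivialization: the section with fibre coordinate 1.\<close>

definition frame :: "('p, 'e) line_bundle \<Rightarrow> ('e \<Rightarrow> complex) \<Rightarrow> 'p \<Rightarrow> 'e" where
  "frame L \<theta> x = inv_into (fibre L x) \<theta> 1"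

definition holo_section :: "'p cmanifold \<Rightarrow> ('p, 'e) line_bundle \<Rightarrow> ('p \<Rightarrow> 'e) \<Rightarrow> bool" where
  "holo_section X L s \<longleftrightarrow> (\<forall>x\<in>points X. s x \<in> fibre L x) \<and>
     (\<forall>(U, \<theta>)\<in>lb_trivs L. holo_fun X U (\<lambda>x. \<theta> (s x)))"

definition globally_generated :: "'p cmanifold \<Rightarrow> ('p, 'e) line_bundle \<Rightarrow> bool" where
  "globally_generated X L \<longleftrightarrow> (\<forall>x\<in>points X. \<exists>s. holo_section X L s \<and> s x \<noteq> lb_zero L x)"

text \<open>Linear functionals on a fibre, extended by 0 outside the fibre.\<close>

definition dual_fibre :: "('p, 'e) line_bundle \<Rightarrow> 'p \<Rightarrow> ('e \<Rightarrow> complex) set" where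
  "dual_fibre L x = {\<xi>. (\<forall>e. e \<notin> fibre L x \<longrightarrow> \<xi> e = 0) \<and>
     (\<forall>e\<in>fibre L x. (\<forall>e'\<in>fibre L x. \<xi> (lb_add L e e') = \<xi> e + \<xi> e') \<and>
                     (\<forall>a. \<xi> (lb_scale L a e) = a * \<xi> e))}"

text \<open>For a one-dimensional vector space V and \<open>m \<ge> 1\<close>, the m-th tensor power of V is the space of
  functions on the dual of V that are homogeneous of degree m; the m-th power of a vector e is
  the function sending \<open>\<xi>\<close> to the m-th power of \<open>\<xi> e\<close>.  The fibre coordinate of T in the
  trivialization induced by \<open>\<theta>\<close> is therefore the value of T at \<open>\<theta>\<close>.\<close>

definition tensor_power ::
  "('p, 'e) line_bundle \<Rightarrow> nat \<Rightarrow> ('p, 'p \<times> (('e \<Rightarrow> complex) \<Rightarrow> complex)) line_bundle" where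
  "tensor_power L m = \<lparr>
     lb_total = {(x, T). x \<in> lb_proj L ` lb_total L \<and> (\<forall>\<xi>. \<xi> \<notin> dual_fibre L x \<longrightarrow> T \<xi> = 0) \<and>
                   (\<forall>\<xi>\<in>dual_fibre L x. \<forall>a. T (\<lambda>e. a * \<xi> e) = a ^ m * T \<xi>)},
     lb_proj = fst,
     lb_zero = (\<lambda>x. (x, \<lambda>_. 0)),
     lb_add = (\<lambda>(x, T) (_, T'). (x, \<lambda>\<xi>. T \<xi> + T' \<xi>)),
     lb_scale = (\<lambda>a (x, T). (x, \<lambda>\<xi>. a * T \<xi>)),
     lb_trivs = {(U, \<lambda>(x, T). T (\<lambda>e. if e \<in> fibre L x then \<theta> e else 0)) | U \<theta>.
                   (U, \<theta>) \<in> lb_trivs L} \<rparr>"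

definition semi_ample :: "'p cmanifold \<Rightarrow> ('p, 'e) line_bundle \<Rightarrow> bool" where
  "semi_ample X L \<longleftrightarrow> (\<exists>m\<ge>1. globally_generated X (tensor_power L m))"


section \<open>Singular Hermitian metrics\<close>

text \<open>A metric is given by its squared length function on the total space, with values in
  \<open>[0,\<infinity>]\<close>.  Its weight \<open>\<phi>\<close> in a local trivialization is minus the logarithm of the squared length
  of the frame, so that the squared length of e is \<open>|\<theta> e|\<^sup>2 exp (- \<phi>)\<close>.\<close>

definition elog :: "ennreal \<Rightarrow> ereal" where
  "elog t = (if t = 0 then -\<infinity> else if t = \<infinity> then \<infinity> else ereal (ln (enn2real t)))"

definition weight :: "('p, 'e) line_bundle \<Rightarrow> ('e \<Rightarrow> ennreal) \<Rightarrow> ('e \<Rightarrow> complex) \<Rightarrow> 'p \<Rightarrow> ereal" where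
  "weight L h \<theta> x = - elog (h (frame L \<theta> x))"

definition singular_metric :: "'p cmanifold \<Rightarrow> ('p, 'e) line_bundle \<Rightarrow> ('e \<Rightarrow> ennreal) \<Rightarrow> bool" where
  "singular_metric X L h \<longleftrightarrow>
     (\<forall>e\<in>lb_total L. \<forall>a. h (lb_scale L a e) = ennreal ((cmod a)\<^sup>2) * h e) \<and>
     (\<forall>(U, \<theta>)\<in>lb_trivs L. L1_loc_fun X U (weight L h \<theta>))"

definition psh_metric :: "'p cmanifold \<Rightarrow> ('p, 'e) line_bundle \<Rightarrow> ('e \<Rightarrow> ennreal) \<Rightarrow> bool" where
  "psh_metric X L h \<longleftrightarrow> singular_metric X L h \<and>
     (\<forall>(U, \<theta>)\<in>lb_trivs L. psh_fun X U (weight L h \<theta>))"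

definition pseudo_effective :: "'p cmanifold \<Rightarrow> ('p, 'e) line_bundle \<Rightarrow> bool" where
  "pseudo_effective X L \<longleftrightarrow> (\<exists>h. psh_metric X L h)"

definition minimal_singular_metric ::
  "'p cmanifold \<Rightarrow> ('p, 'e) line_bundle \<Rightarrow> ('e \<Rightarrow> ennreal) \<Rightarrow> bool" where
  "minimal_singular_metric X L h \<longleftrightarrow> psh_metric X L h \<and>
     (\<forall>h'. psh_metric X L h' \<longrightarrow>
        (\<exists>C::real. \<forall>(U, \<theta>)\<in>lb_trivs L. \<forall>x\<in>U. weight L h' \<theta> x \<le> weight L h \<theta> x + ereal C))"

definition metric_restrict ::
  "('p, 'e) line_bundle \<Rightarrow> 'p set \<Rightarrow> ('e \<Rightarrow> ennreal) \<Rightarrow> 'e \<Rightarrow> ennreal" where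
  "metric_restrict L S h = (\<lambda>e. if lb_proj L e \<in> S then h e else undefined)"


section \<open>The projective bundle of a direct sum of two line bundles\<close>

text \<open>Linear functionals on the fibre of \<open>A \<oplus> L\<close> over x, extended by 0 outside the fibre.\<close>

definition dual_sum ::
  "('p, 'a) line_bundle \<Rightarrow> ('p, 'b) line_bundle \<Rightarrow> 'p \<Rightarrow> ('a \<times> 'b \<Rightarrow> complex) set" where
  "dual_sum A L x = {\<xi>. (\<forall>p. p \<notin> fibre A x \<times> fibre L x \<longrightarrow> \<xi> p = 0) \<and>
     (\<forall>a\<in>fibre A x. \<forall>b\<in>fibre L x.
        (\<forall>a'\<in>fibre A x. \<forall>b'\<in>fibre L x. \<xi> (lb_add A a a', lb_add L b b') = \<xi> (a, b) + \<xi> (a', b')) \<and>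
        (\<forall>k. \<xi> (lb_scale A k a, lb_scale L k b) = k * \<xi> (a, b)))}"

type_synonym ('p, 'a, 'b) pb_point = "'p \<times> ('a \<times> 'b \<Rightarrow> complex) set"

text \<open>Points are pairs of a point x and a line in the dual of the fibre of \<open>A \<oplus> L\<close> over x.\<close>

definition pb_points ::
  "'p cmanifold \<Rightarrow> ('p, 'a) line_bundle \<Rightarrow> ('p, 'b) line_bundle \<Rightarrow> ('p, 'a, 'b) pb_point set" where
  "pb_points X A L =
     {(x, cline \<xi>) | x \<xi>. x \<in> points X \<and> \<xi> \<in> dual_sum A L x \<and> \<xi> \<noteq> (\<lambda>_. 0)}"

text \<open>The frames of A and L as elements of \<open>A \<oplus> L\<close>; a functional takes on them its two coordinates
  with respect to the dual frame.\<close>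

definition frame_A ::
  "('p, 'a) line_bundle \<Rightarrow> ('p, 'b) line_bundle \<Rightarrow> ('a \<Rightarrow> complex) \<Rightarrow> 'p \<Rightarrow> 'a \<times> 'b" where
  "frame_A A L \<theta> x = (frame A \<theta> x, lb_zero L x)"

definition frame_L ::
  "('p, 'a) line_bundle \<Rightarrow> ('p, 'b) line_bundle \<Rightarrow> ('b \<Rightarrow> complex) \<Rightarrow> 'p \<Rightarrow> 'a \<times> 'b" where
  "frame_L A L \<tau> x = (lb_zero A x, frame L \<tau> x)"

text \<open>The points over S at which the tautological line does not vanish on the section p of
  \<open>A \<oplus> L\<close>.\<close>

definition pb_affine ::
  "'p cmanifold \<Rightarrow> ('p, 'a) line_bundle \<Rightarrow> ('p, 'b) line_bundle \<Rightarrow> 'p set \<Rightarrow> ('p \<Rightarrow> 'a \<times> 'b) \<Rightarrow>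
    ('p, 'a, 'b) pb_point set" where
  "pb_affine X A L S p = {(x, l) \<in> pb_points X A L. x \<in> S \<and> (\<exists>\<xi>\<in>l. \<xi> (p x) \<noteq> 0)}"

text \<open>Charts: a chart of X with two local trivializations, and one of the two standard affine
  coordinates on the projective line.\<close>

definition proj_bundle ::
  "'p cmanifold \<Rightarrow> ('p, 'a) line_bundle \<Rightarrow> ('p, 'b) line_bundle \<Rightarrow> ('p, 'a, 'b) pb_point cmanifold"
  where
  "proj_bundle X A L = \<lparr>
     points = pb_points X A L,
     cdim = Suc (cdim X),
     charts =
       (\<Union>(D, c)\<in>charts X. \<Union>(U, \<theta>)\<in>lb_trivs A. \<Union>(V, \<tau>)\<in>lb_trivs L.
         {(pb_affine X A L (D \<inter> U \<inter> V) (frame_L A L \<tau>),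
           \<lambda>(x, l). (c x)(cdim X := normalized l (frame_L A L \<tau> x) (frame_A A L \<theta> x))),
          (pb_affine X A L (D \<inter> U \<inter> V) (frame_A A L \<theta>),
           \<lambda>(x, l). (c x)(cdim X := normalized l (frame_A A L \<theta> x) (frame_L A L \<tau> x)))}) \<rparr>"

text \<open>The relative hyperplane bundle: its fibre at \<open>(x, l)\<close> is the dual of the tautological line l
  (functionals on l, extended by 0).  Over the two affine pieces it is trivialized by evaluation at
  the normalized frame of l.\<close>

definition O1 ::
  "'p cmanifold \<Rightarrow> ('p, 'a) line_bundle \<Rightarrow> ('p, 'b) line_bundle \<Rightarrow>
    (('p, 'a, 'b) pb_point, ('p, 'a, 'b) pb_point \<times> (('a \<times> 'b \<Rightarrow> complex) \<Rightarrow> complex)) line_bundle"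
  where
  "O1 X A L = \<lparr>
     lb_total = {((x, l), u). (x, l) \<in> pb_points X A L \<and> (\<forall>\<xi>. \<xi> \<notin> l \<longrightarrow> u \<xi> = 0) \<and>
                   (\<forall>\<xi>\<in>l. (\<forall>\<xi>'\<in>l. u (\<lambda>p. \<xi> p + \<xi>' p) = u \<xi> + u \<xi>') \<and>
                           (\<forall>a. u (\<lambda>p. a * \<xi> p) = a * u \<xi>))},
     lb_proj = fst,
     lb_zero = (\<lambda>q. (q, \<lambda>_. 0)),
     lb_add = (\<lambda>(q, u) (_, u'). (q, \<lambda>\<xi>. u \<xi> + u' \<xi>)),
     lb_scale = (\<lambda>a (q, u). (q, \<lambda>\<xi>. a * u \<xi>)),
     lb_trivs =
       (\<Union>(U, \<theta>)\<in>lb_trivs A. \<Union>(V, \<tau>)\<in>lb_trivs L.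
         {(pb_affine X A L (U \<inter> V) (frame_L A L \<tau>),
           \<lambda>((x, l), u). u (normalized l (frame_L A L \<tau> x))),
          (pb_affine X A L (U \<inter> V) (frame_A A L \<theta>),
           \<lambda>((x, l), u). u (normalized l (frame_A A L \<theta> x)))}) \<rparr>"

text \<open>The divisor P(L): the lines of functionals that factor through the projection
  \<open>A \<oplus> L \<rightarrow> L\<close>, that is, vanish on A.\<close>

definition P_L ::
  "'p cmanifold \<Rightarrow> ('p, 'a) line_bundle \<Rightarrow> ('p, 'b) line_bundle \<Rightarrow> ('p, 'a, 'b) pb_point set" where
  "P_L X A L = {(x, l) \<in> pb_points X A L. \<forall>\<xi>\<in>l. \<forall>a\<in>fibre A x. \<xi> (a, lb_zero L x) = 0}"

text \<open>The natural identification of X with P(L), and of L with the restriction of O(1) to P(L): a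
  vector e of L acts on a functional \<open>\<xi>\<close> of the tautological line by \<open>\<xi> (0, e)\<close>.\<close>

definition to_P_L ::
  "('p, 'a) line_bundle \<Rightarrow> ('p, 'b) line_bundle \<Rightarrow> 'p \<Rightarrow> ('p, 'a, 'b) pb_point" where
  "to_P_L A L x = (x, {\<xi> \<in> dual_sum A L x. \<forall>a\<in>fibre A x. \<xi> (a, lb_zero L x) = 0})"

definition to_O1 ::
  "('p, 'a) line_bundle \<Rightarrow> ('p, 'b) line_bundle \<Rightarrow> 'b \<Rightarrow>
    ('p, 'a, 'b) pb_point \<times> (('a \<times> 'b \<Rightarrow> complex) \<Rightarrow> complex)" where
  "to_O1 A L e =
     (let x = lb_proj L e; q = to_P_L A L x
      in (q, \<lambda>\<xi>. if \<xi> \<in> snd q then \<xi> (lb_zero A x, e) else 0))"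


section \<open>The natural identification is an isomorphism\<close>

text \<open>\<open>to_P_L\<close> is a bijection of X onto P(L), and \<open>to_O1\<close> is fibrewise a bijection of L onto the
  restriction of O(1) to P(L), under which each trivialization \<open>\<tau>\<close> of L corresponds to the
  trivialization of O(1) induced by \<open>\<tau>\<close>.\<close>

lemma dual_sum_coords:
  assumes A: "holomorphic_line_bundle X A" and L: "holomorphic_line_bundle X L"
    and x: "x \<in> points X"
    and t: "(U, \<theta>) \<in> lb_trivs A" "x \<in> U" "(V, \<tau>) \<in> lb_trivs L" "x \<in> V"
  shows "\<xi> \<in> dual_sum A L x \<longleftrightarrow> (\<exists>\<alpha> \<beta>. \<xi> = (\<lambda>(a, b).
           if a \<in> fibre A x \<and> b \<in> fibre L x then \<alpha> * \<theta> a + \<beta> * \<tau> b else 0))"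
proof -
  have zA: "lb_zero A x \<in> fibre A x" and zL: "lb_zero L x \<in> fibre L x"
    and addA: "\<And>e e'. e \<in> fibre A x \<Longrightarrow> e' \<in> fibre A x \<Longrightarrow> lb_add A e e' \<in> fibre A x"
    and addL: "\<And>e e'. e \<in> fibre L x \<Longrightarrow> e' \<in> fibre L x \<Longrightarrow> lb_add L e e' \<in> fibre L x"
    and scA: "\<And>e k. e \<in> fibre A x \<Longrightarrow> lb_scale A k e \<in> fibre A x"
    and scL: "\<And>e k. e \<in> fibre L x \<Longrightarrow> lb_scale L k e \<in> fibre L x"
    using A L x unfolding holomorphic_line_bundle_def by auto
  have tA: "bij_betw \<theta> (fibre A x) UNIV \<and> \<theta> (lb_zero A x) = 0 \<and>
           (\<forall>e\<in>fibre A x. (\<forall>e'\<in>fibre A x. \<theta> (lb_add A e e') = \<theta> e + \<theta> e') \<and>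
                           (\<forall>a. \<theta> (lb_scale A a e) = a * \<theta> e))"
    using A t unfolding holomorphic_line_bundle_def by blast
  have tL: "bij_betw \<tau> (fibre L x) UNIV \<and> \<tau> (lb_zero L x) = 0 \<and>
           (\<forall>e\<in>fibre L x. (\<forall>e'\<in>fibre L x. \<tau> (lb_add L e e') = \<tau> e + \<tau> e') \<and>
                           (\<forall>a. \<tau> (lb_scale L a e) = a * \<tau> e))"
    using L t unfolding holomorphic_line_bundle_def by blast
  have injA: "\<And>e e'. e \<in> fibre A x \<Longrightarrow> e' \<in> fibre A x \<Longrightarrow> \<theta> e = \<theta> e' \<Longrightarrow> e = e'"
    using tA by (meson bij_betw_def inj_onD)
  have injL: "\<And>e e'. e \<in> fibre L x \<Longrightarrow> e' \<in> fibre L x \<Longrightarrow> \<tau> e = \<tau> e' \<Longrightarrow> e = e'"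
    using tL by (meson bij_betw_def inj_onD)
  obtain f where f: "f \<in> fibre A x" "\<theta> f = 1" using tA by (metis UNIV_I bij_betw_iff_bijections)
  obtain g where g: "g \<in> fibre L x" "\<tau> g = 1" using tL by (metis UNIV_I bij_betw_iff_bijections)
  show ?thesis
  proof
    assume xi: "\<xi> \<in> dual_sum A L x"
    have "\<xi> (a, b) = \<xi> (f, lb_zero L x) * \<theta> a + \<xi> (lb_zero A x, g) * \<tau> b"
      if ab: "a \<in> fibre A x" "b \<in> fibre L x" for a b
    proof -
      have "a = lb_add A (lb_scale A (\<theta> a) f) (lb_scale A (\<tau> b) (lb_zero A x))"
        using tA f zA ab by (intro injA) (auto simp: addA scA)
      moreover have "b = lb_add L (lb_scale L (\<theta> a) (lb_zero L x)) (lb_scale L (\<tau> b) g)"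
        using tL g zL ab by (intro injL) (auto simp: addL scL)
      ultimately have "\<xi> (a, b) = \<xi> (lb_add A (lb_scale A (\<theta> a) f) (lb_scale A (\<tau> b) (lb_zero A x)),
          lb_add L (lb_scale L (\<theta> a) (lb_zero L x)) (lb_scale L (\<tau> b) g))" by simp
      also have "\<dots> = \<xi> (lb_scale A (\<theta> a) f, lb_scale L (\<theta> a) (lb_zero L x)) + 
           \<xi> (lb_scale A (\<tau> b) (lb_zero A x), lb_scale L (\<tau> b) g)"
        using xi f g zA zL scA scL unfolding dual_sum_def by auto
      also have "\<dots> = \<theta> a * \<xi> (f, lb_zero L x) + \<tau> b * \<xi> (lb_zero A x, g)"
        using xi f g zA zL unfolding dual_sum_def by auto
      finally show ?thesis by simp
    qed
    then show "\<exists>\<alpha> \<beta>. \<xi> = (\<lambda>(a, b).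
           if a \<in> fibre A x \<and> b \<in> fibre L x then \<alpha> * \<theta> a + \<beta> * \<tau> b else 0)"
      using xi unfolding dual_sum_def
      by (intro exI[of _ "\<xi> (f, lb_zero L x)"] exI[of _ "\<xi> (lb_zero A x, g)"]) (auto simp: fun_eq_iff)
  next
    assume "\<exists>\<alpha> \<beta>. \<xi> = (\<lambda>(a, b).
           if a \<in> fibre A x \<and> b \<in> fibre L x then \<alpha> * \<theta> a + \<beta> * \<tau> b else 0)"
    then show "\<xi> \<in> dual_sum A L x"
      using tA tL addA addL scA scL unfolding dual_sum_def by (auto simp: algebra_simps)
  qed
qed

lemma to_P_L_eq:
  assumes A: "holomorphic_line_bundle X A" and L: "holomorphic_line_bundle X L"
    and x: "x \<in> points X"
    and t: "(U, \<theta>) \<in> lb_trivs A" "x \<in> U" "(V, \<tau>) \<in> lb_trivs L" "x \<in> V"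
  defines "\<eta> \<equiv> (\<lambda>(a, b). if a \<in> fibre A x \<and> b \<in> fibre L x then \<tau> b else 0)"
  shows "to_P_L A L x = (x, cline \<eta>)" "\<eta> \<in> dual_sum A L x" "\<And>b. b \<in> fibre L x \<Longrightarrow> \<eta> (lb_zero A x, b) = \<tau> b"
    "\<And>a. \<eta> (a, lb_zero L x) = 0" "\<eta> \<noteq> (\<lambda>_. 0)"
   "\<And>\<xi>. \<xi> \<in> dual_sum A L x \<Longrightarrow> \<forall>a\<in>fibre A x. \<xi> (a, lb_zero L x) = 0 \<Longrightarrow> \<xi> \<in> cline \<eta>"
proof -
  have zA: "lb_zero A x \<in> fibre A x" and zL: "lb_zero L x \<in> fibre L x"
    using A L x unfolding holomorphic_line_bundle_def by auto
  have tA: "bij_betw \<theta> (fibre A x) UNIV \<and> \<theta> (lb_zero A x) = 0"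
    using A t unfolding holomorphic_line_bundle_def by blast
  have tL: "bij_betw \<tau> (fibre L x) UNIV \<and> \<tau> (lb_zero L x) = 0"
    using L t unfolding holomorphic_line_bundle_def by blast
  obtain f where f: "f \<in> fibre A x" "\<theta> f = 1" using tA by (metis UNIV_I bij_betw_iff_bijections)
  obtain g where g: "g \<in> fibre L x" "\<tau> g = 1" using tL by (metis UNIV_I bij_betw_iff_bijections)
  note D = dual_sum_coords[OF A L x t]
  show 1: "\<eta> \<in> dual_sum A L x" unfolding D \<eta>_def
    by (intro exI[of _ 0] exI[of _ 1]) (auto simp: fun_eq_iff)
  show 2: "\<And>b. b \<in> fibre L x \<Longrightarrow> \<eta> (lb_zero A x, b) = \<tau> b" using zA by (auto simp: \<eta>_def)
  show 3: "\<And>a. \<eta> (a, lb_zero L x) = 0" using tL by (auto simp: \<eta>_def)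
  show "\<eta> \<noteq> (\<lambda>_. 0)" using 2[OF g(1)] g by auto
  show 4: "\<xi> \<in> cline \<eta>" if xi: "\<xi> \<in> dual_sum A L x" and v: "\<forall>a\<in>fibre A x. \<xi> (a, lb_zero L x) = 0" for \<xi>
  proof -
    obtain \<alpha> \<beta> where e: "\<xi> = (\<lambda>(a, b).
           if a \<in> fibre A x \<and> b \<in> fibre L x then \<alpha> * \<theta> a + \<beta> * \<tau> b else 0)" using xi D by blast
    have "\<xi> (f, lb_zero L x) = 0" using v f by auto
    then have "\<alpha> = 0" using f zL tL by (simp add: e)
    then show ?thesis unfolding cline_def e \<eta>_def by (intro image_eqI[of _ _ \<beta>]) (auto simp: fun_eq_iff)
  qed
  have 5: "\<xi> \<in> dual_sum A L x \<and> (\<forall>a\<in>fibre A x. \<xi> (a, lb_zero L x) = 0)" if m: "\<xi> \<in> cline \<eta>" for \<xi>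
  proof -
    obtain c where c: "\<xi> = (\<lambda>i. c * \<eta> i)" using m unfolding cline_def by blast
    have "\<xi> \<in> dual_sum A L x" unfolding D c \<eta>_def
      by (intro exI[of _ 0] exI[of _ c]) (auto simp: fun_eq_iff)
    then show ?thesis using c 3 by auto
  qed
  show "to_P_L A L x = (x, cline \<eta>)" unfolding to_P_L_def using 4 5 by auto
qed

lemma triv_at:
  assumes "holomorphic_line_bundle X L" "x \<in> points X"
  obtains U \<theta> where "(U, \<theta>) \<in> lb_trivs L" "x \<in> U"
proof -
  have "x \<in> (\<Union>(U, \<theta>)\<in>lb_trivs L. U)"
    using assms unfolding holomorphic_line_bundle_def by simp
  then show thesis using that by auto
qed

lemma to_P_L_bij:
  assumes A: "holomorphic_line_bundle X A" and L: "holomorphic_line_bundle X L"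
  shows "bij_betw (to_P_L A L) (points X) (P_L X A L)"
proof (rule bij_betw_imageI)
  show "inj_on (to_P_L A L) (points X)" by (auto simp: inj_on_def to_P_L_def)
  show "to_P_L A L ` points X = P_L X A L"
  proof (intro set_eqI iffI)
    fix q assume "q \<in> to_P_L A L ` points X"
    then obtain x where x: "x \<in> points X" "q = to_P_L A L x" by auto
    obtain U \<theta> where t: "(U, \<theta>) \<in> lb_trivs A" "x \<in> U" using triv_at[OF A x(1)] .
    obtain V \<tau> where s: "(V, \<tau>) \<in> lb_trivs L" "x \<in> V" using triv_at[OF L x(1)] .
    note E = to_P_L_eq[OF A L x(1) t s]
    show "q \<in> P_L X A L" unfolding x(2) P_L_def pb_points_def
      using E x(1) by (auto simp: to_P_L_def)
  next
    fix q assume q: "q \<in> P_L X A L"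
    then obtain x \<xi> where x: "q = (x, cline \<xi>)" "x \<in> points X" "\<xi> \<in> dual_sum A L x" "\<xi> \<noteq> (\<lambda>_. 0)"
      "\<forall>\<zeta>\<in>cline \<xi>. \<forall>a\<in>fibre A x. \<zeta> (a, lb_zero L x) = 0"
      unfolding P_L_def pb_points_def by auto
    obtain U \<theta> where t: "(U, \<theta>) \<in> lb_trivs A" "x \<in> U" using triv_at[OF A x(2)] .
    obtain V \<tau> where s: "(V, \<tau>) \<in> lb_trivs L" "x \<in> V" using triv_at[OF L x(2)] .
    note E = to_P_L_eq[OF A L x(2) t s]
    have "\<xi> \<in> cline \<xi>" unfolding cline_def by (rule image_eqI[of _ _ 1]) auto
    then have "\<xi> \<in> cline (\<lambda>(a, b). if a \<in> fibre A x \<and> b \<in> fibre L x then \<tau> b else 0)" (is "_ \<in> cline ?\<eta>")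
      using E(6)[OF x(3)] x(5) by auto
    then obtain c where c: "\<xi> = (\<lambda>i. c * ?\<eta> i)" unfolding cline_def by blast
    with x(4) have c0: "c \<noteq> 0" by auto
    have "cline \<xi> = cline ?\<eta>"
    proof (intro set_eqI iffI)
      fix z assume "z \<in> cline \<xi>" then obtain k where "z = (\<lambda>i. k * \<xi> i)" unfolding cline_def by blast
      then have "z = (\<lambda>i. (k * c) * ?\<eta> i)" unfolding c by (simp add: mult.assoc)
      then show "z \<in> cline ?\<eta>" unfolding cline_def by blast
    next
      fix z assume "z \<in> cline ?\<eta>" then obtain k where "z = (\<lambda>i. k * ?\<eta> i)" unfolding cline_def by blast
      then have "z = (\<lambda>i. (k / c) * \<xi> i)" unfolding c using c0 by simp
      then show "z \<in> cline \<xi>" unfolding cline_def by blast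
    qed
    then have "q = to_P_L A L x" using E(1) x(1) by simp
    then show "q \<in> to_P_L A L ` points X" using x(2) by blast
  qed
qed

lemma to_O1_bij:
  assumes A: "holomorphic_line_bundle X A" and L: "holomorphic_line_bundle X L"
    and x: "x \<in> points X"
  shows "bij_betw (to_O1 A L) (fibre L x) (fibre (O1 X A L) (to_P_L A L x))"
proof -
  obtain U \<theta> where t: "(U, \<theta>) \<in> lb_trivs A" "x \<in> U" using triv_at[OF A x] .
  obtain V \<tau> where s: "(V, \<tau>) \<in> lb_trivs L" "x \<in> V" using triv_at[OF L x] .
  define \<eta> where "\<eta> = (\<lambda>(a, b). if a \<in> fibre A x \<and> b \<in> fibre L x then \<tau> b else 0)"
  note E = to_P_L_eq[OF A L x t s, folded \<eta>_def]
  have PL: "to_P_L A L x \<in> P_L X A L" using to_P_L_bij[OF A L] x by (meson bij_betwE)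
  then have pt: "(x, cline \<eta>) \<in> pb_points X A L" unfolding P_L_def E(1) by auto
  have tL: "bij_betw \<tau> (fibre L x) UNIV"
    using L s unfolding holomorphic_line_bundle_def by blast
  have eta: "\<eta> \<in> cline \<eta>" unfolding cline_def by (rule image_eqI[of _ _ 1]) auto
  have val: "to_O1 A L e = ((x, cline \<eta>), \<lambda>\<xi>. if \<xi> \<in> cline \<eta> then \<xi> (lb_zero A x, e) else 0)" 
    if "e \<in> fibre L x" for e
    using that E(1) unfolding to_O1_def fibre_def by (simp add: Let_def)
  show ?thesis
  proof (rule bij_betw_imageI)
    show "inj_on (to_O1 A L) (fibre L x)"
    proof (rule inj_onI)
      fix e e' assume e: "e \<in> fibre L x" "e' \<in> fibre L x" "to_O1 A L e = to_O1 A L e'"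
      then have "snd (to_O1 A L e) \<eta> = snd (to_O1 A L e') \<eta>" by (simp only:)
      then have "\<eta> (lb_zero A x, e) = \<eta> (lb_zero A x, e')"
        unfolding val[OF e(1)] val[OF e(2)] by (simp only: snd_conv eta if_True)
      then have "\<tau> e = \<tau> e'" using E(3) e by auto
      then show "e = e'" using tL e by (meson bij_betw_def inj_onD)
    qed
    show "to_O1 A L ` fibre L x = fibre (O1 X A L) (to_P_L A L x)"
    proof (intro set_eqI iffI)
      fix w assume "w \<in> to_O1 A L ` fibre L x"
      then obtain e where e: "e \<in> fibre L x" "w = to_O1 A L e" by auto
      have add: "(\<lambda>p. \<xi> p + \<xi>' p) \<in> cline \<eta>" if m: "\<xi> \<in> cline \<eta>" "\<xi>' \<in> cline \<eta>" for \<xi> \<xi>'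
      proof -
        obtain c c' where "\<xi> = (\<lambda>i. c * \<eta> i)" "\<xi>' = (\<lambda>i. c' * \<eta> i)"
          using m unfolding cline_def by blast
        then have "(\<lambda>p. \<xi> p + \<xi>' p) = (\<lambda>i. (c + c') * \<eta> i)" by (simp add: distrib_right)
        then show ?thesis unfolding cline_def by blast
      qed
      have sc: "(\<lambda>p. a * \<xi> p) \<in> cline \<eta>" if m: "\<xi> \<in> cline \<eta>" for \<xi> a
      proof -
        obtain c where "\<xi> = (\<lambda>i. c * \<eta> i)" using m unfolding cline_def by blast
        then have "(\<lambda>p. a * \<xi> p) = (\<lambda>i. (a * c) * \<eta> i)" by (simp add: mult.assoc)
        then show ?thesis unfolding cline_def by blast
      qed
      show "w \<in> fibre (O1 X A L) (to_P_L A L x)"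
        unfolding e(2) val[OF e(1)] fibre_def E(1) O1_def using pt add sc by simp
    next
      fix w assume "w \<in> fibre (O1 X A L) (to_P_L A L x)"
      then obtain u where u: "w = ((x, cline \<eta>), u)" "\<And>\<xi>. \<xi> \<notin> cline \<eta> \<Longrightarrow> u \<xi> = 0" 
        "\<And>\<xi> a. \<xi> \<in> cline \<eta> \<Longrightarrow> u (\<lambda>p. a * \<xi> p) = a * u \<xi>"
        unfolding fibre_def O1_def E(1) by auto
      obtain e where e: "e \<in> fibre L x" "\<tau> e = u \<eta>" using tL by (metis UNIV_I bij_betw_iff_bijections)
      have "u = (\<lambda>\<xi>. if \<xi> \<in> cline \<eta> then \<xi> (lb_zero A x, e) else 0)"
      proof
        fix \<xi> show "u \<xi> = (if \<xi> \<in> cline \<eta> then \<xi> (lb_zero A x, e) else 0)"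
        proof (cases "\<xi> \<in> cline \<eta>")
          case True
          then obtain c where "\<xi> = (\<lambda>i. c * \<eta> i)" unfolding cline_def by blast
          then show ?thesis using True u(3)[OF eta, of c] E(3)[OF e(1)] e by simp
        qed (use u(2) in auto)
      qed
      then have "w = to_O1 A L e" using u(1) val[OF e(1)] by simp
      then show "w \<in> to_O1 A L ` fibre L x" using e by blast
    qed
  qed
qed

lemma to_O1_triv:
  assumes A: "holomorphic_line_bundle X A" and L: "holomorphic_line_bundle X L"
    and x: "x \<in> points X"
    and t: "(U, \<theta>) \<in> lb_trivs A" "x \<in> U" and s: "(V, \<tau>) \<in> lb_trivs L" "x \<in> V"
    and e: "e \<in> fibre L x"
  shows "to_P_L A L x \<in> pb_affine X A L (U \<inter> V) (frame_L A L \<tau>)"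
    and "snd (to_O1 A L e) (normalized (snd (to_P_L A L x)) (frame_L A L \<tau> x)) = \<tau> e"
proof -
  define \<eta> where "\<eta> = (\<lambda>(a, b). if a \<in> fibre A x \<and> b \<in> fibre L x then \<tau> b else 0)"
  note E = to_P_L_eq[OF A L x t s, folded \<eta>_def]
  have PL: "to_P_L A L x \<in> P_L X A L" using to_P_L_bij[OF A L] x by (meson bij_betwE)
  then have pt: "(x, cline \<eta>) \<in> pb_points X A L" unfolding P_L_def E(1) by auto
  have tL: "bij_betw \<tau> (fibre L x) UNIV"
    using L s unfolding holomorphic_line_bundle_def by blast
  have eta: "\<eta> \<in> cline \<eta>" unfolding cline_def by (rule image_eqI[of _ _ 1]) auto
  have fr: "frame L \<tau> x \<in> fibre L x" "\<tau> (frame L \<tau> x) = 1"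
    using tL inv_into_into[of 1 \<tau> "fibre L x"] f_inv_into_f[of 1 \<tau> "fibre L x"]
    unfolding frame_def bij_betw_def by auto
  have one: "\<eta> (frame_L A L \<tau> x) = 1" unfolding frame_L_def using E(3)[OF fr(1)] fr(2) by simp
  have "\<exists>\<xi>\<in>cline \<eta>. \<xi> (frame_L A L \<tau> x) \<noteq> 0"
    by (rule bexI[OF _ eta]) (simp only: one one_neq_zero not_False_eq_True)
  then show "to_P_L A L x \<in> pb_affine X A L (U \<inter> V) (frame_L A L \<tau>)"
    unfolding E(1) pb_affine_def using pt t(2) s(2) by simp
  have "normalized (cline \<eta>) (frame_L A L \<tau> x) = \<eta>"
    unfolding normalized_def
  proof (rule the_equality)
    show "\<eta> \<in> cline \<eta> \<and> \<eta> (frame_L A L \<tau> x) = 1" using eta one by simp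
    fix v assume v: "v \<in> cline \<eta> \<and> v (frame_L A L \<tau> x) = 1"
    then obtain c where "v = (\<lambda>i. c * \<eta> i)" unfolding cline_def by blast
    with v one show "v = \<eta>" by simp
  qed
  then show "snd (to_O1 A L e) (normalized (snd (to_P_L A L x)) (frame_L A L \<tau> x)) = \<tau> e"
    using e E(1,3) eta unfolding to_O1_def fibre_def by (simp add: Let_def)
qed

end

theory Submission
  imports Defs "HOL-Complex_Analysis.Cauchy_Integral_Formula"
begin

text \<open>As \<open>O(1)\<close> is the pull-back of L twisted by the divisor \<open>P(A)\<close>, which is disjoint from \<open>P(L)\<close>, every
  metric of L with weight \<open>\<psi>\<close> gives a metric of \<open>O(1)\<close>: on the functional with coordinates
  \<open>(\<alpha>, \<beta>)\<close> its weight is \<open>\<psi> + log |\<beta>|\<^sup>2\<close>.  It is again plurisubharmonic and locally integrable,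
  and on \<open>P(L)\<close>, where \<open>\<beta> = 1\<close>, it restricts to \<open>\<psi>\<close>.  Comparing it with the minimal metric of \<open>O(1)\<close>
  bounds \<open>\<psi>\<close> by the restricted weight up to a constant.  For one \<open>\<psi>\<close> this shows that the restricted
  weight is locally integrable, and for all \<open>\<psi>\<close> that it is minimal.\<close>

section \<open>Holomorphic functions along complex lines\<close>

text \<open>The twist by P(A) is the homomorphism from the pull-back of L to O(1) that sends a
  vector e to evaluation at (0, e). Over P(L) it is \<open>to_O1\<close>, so transporting a metric
  upstairs and restricting it again loses nothing, and the constant given by minimality upstairs
  serves unchanged on X. Two features of the definitions shape the work. Plurisubharmonicity is
  tested by semicontinuity and by circles in complex lines and tolerates -\<infinity>, so it passes
  to the slice P(L) at once; what restriction could destroy is local integrability, since the weight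
  might be identically -\<infinity> there. And upstairs a weight must be examined for every pairing
  of a chart with a trivialization, each built from its own data on X. In every pairing it has the
  same product shape, a pulled-back weight plus log |g m|^2 with g holomorphic and zero-free on the
  base and m holomorphic in the fibre coordinate. Plurisubharmonicity then rests on the harmonicity
  of log |f|^2 for zero-free f, and local integrability on Tonelli and the integrability of log
  |t|^2 in one variable.\<close>

lemma cspace_add: "z \<in> cspace n \<Longrightarrow> v \<in> cspace n \<Longrightarrow> (\<lambda>i. z i + v i) \<in> cspace n"
  by (simp add: cspace_def)

lemma cspace_scale: "v \<in> cspace n \<Longrightarrow> (\<lambda>i. c * v i) \<in> cspace n"
  by (simp add: cspace_def)

lemma closed_cspace: "closed (cspace n)"
proof -
  have "cspace n = (\<Inter>i\<in>{n..}. {z. z i = 0})"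
    by (auto simp: cspace_def)
  then show ?thesis
    by (auto intro!: closed_INT closed_Collect_eq)
qed

lemma copen_subset: "copen n W \<Longrightarrow> W \<subseteq> cspace n"
  using openin_imp_subset unfolding copen_def by blast

lemma copen_borel: "copen n W \<Longrightarrow> W \<in> sets borel"
  unfolding copen_def openin_open using closed_cspace by auto

lemma copen_iff: "copen n W \<longleftrightarrow> (\<exists>T. open T \<and> W = cspace n \<inter> T)"
  by (simp add: copen_def openin_open)

lemma cnorm_scale: "cnorm n (\<lambda>i. c * v i) = cmod c * cnorm n v"
  by (simp add: cnorm_def norm_mult L2_set_right_distrib)

lemma cnorm_nonneg: "0 \<le> cnorm n v"
  by (simp add: cnorm_def)

text \<open>Links the two notions of closeness in use: open sets come from the product topology on
  sequences, differentiability from \<open>cnorm\<close>. As \<open>cnorm n\<close> involves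
  finitely many coordinates, it is continuous for the product topology.\<close>

lemma tendsto_cnorm:
  "((\<lambda>w. cnorm n (\<lambda>i. w i - z i)) \<longlongrightarrow> 0) (at z within S)"
proof -
  have "continuous_on UNIV (\<lambda>w. cnorm n (\<lambda>i. w i - z i))"
    unfolding cnorm_def L2_set_def by (auto intro!: continuous_intros)
  then have "((\<lambda>w. cnorm n (\<lambda>i. w i - z i)) \<longlongrightarrow> cnorm n (\<lambda>i. z i - z i)) (at z within S)"
    using tendsto_within_subset unfolding continuous_on_def by blast
  then show ?thesis by (simp add: cnorm_def L2_set_def)
qed

lemma holo_on_continuous:
  assumes W: "W \<subseteq> cspace n" and f: "holo_on n W f"
  shows "continuous_on W f"
  unfolding continuous_on_def
proof
  fix z assume z: "z \<in> W"
  then obtain a :: "nat \<Rightarrow> complex" where a: "\<forall>\<epsilon>>0. \<exists>\<delta>>0. \<forall>v\<in>cspace n. cnorm n v < \<delta> \<longrightarrow>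
     cmod (f (\<lambda>i. z i + v i) - f z - (\<Sum>i<n. a i * v i)) \<le> \<epsilon> * cnorm n v"
    using f unfolding holo_on_def by blast
  obtain \<delta> where \<delta>: "\<delta> > 0" "\<And>v. v\<in>cspace n \<Longrightarrow> cnorm n v < \<delta> \<Longrightarrow>
     cmod (f (\<lambda>i. z i + v i) - f z - (\<Sum>i<n. a i * v i)) \<le> 1 * cnorm n v"
    using a[rule_format, of 1] by auto
  have coord: "((\<lambda>w. w i) \<longlongrightarrow> z i) (at z within W)" for i
    using continuous_on_subset[OF continuous_on_product_coordinates[of i] subset_UNIV[of W]] z
    unfolding continuous_on_def by blast
  have "((\<lambda>w. f w - f z) \<longlongrightarrow> 0) (at z within W)"
  proof (rule Lim_null_comparison)
    have "\<forall>\<^sub>F w in at z within W. cnorm n (\<lambda>i. w i - z i) < \<delta>"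
      using tendsto_cnorm \<delta>(1) by (rule order_tendstoD)
    moreover have "\<forall>\<^sub>F w in at z within W. w \<in> W"
      unfolding eventually_at_topological by blast
    ultimately show "\<forall>\<^sub>F w in at z within W. cmod (f w - f z) \<le>
        cmod (\<Sum>i<n. a i * (w i - z i)) + cnorm n (\<lambda>i. w i - z i)"
    proof eventually_elim
      case (elim w)
      have "(\<lambda>i. w i - z i) \<in> cspace n"
        using subsetD[OF W z] subsetD[OF W elim(2)] by (simp add: cspace_def)
      from \<delta>(2)[OF this elim(1)]
      have "cmod (f w - f z - (\<Sum>i<n. a i * (w i - z i))) \<le> cnorm n (\<lambda>i. w i - z i)" by simp
      then show ?case
        using norm_triangle_sub[of "f w - f z" "\<Sum>i<n. a i * (w i - z i)"] by linarith
    qed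
    have "((\<lambda>w. cmod (\<Sum>i<n. a i * (w i - z i))) \<longlongrightarrow> cmod (\<Sum>i<n. a i * (z i - z i))) (at z within W)"
      by (intro tendsto_intros coord)
    then show "((\<lambda>w. cmod (\<Sum>i<n. a i * (w i - z i)) + cnorm n (\<lambda>i. w i - z i)) \<longlongrightarrow> 0) (at z within W)"
      using tendsto_add[OF _ tendsto_cnorm[of n z W], of _ 0] by simp
  qed
  then show "(f \<longlongrightarrow> f z) (at z within W)"
    by (simp add: LIM_zero_iff)
qed

lemma continuous_line: "continuous_on S (\<lambda>s::complex. (\<lambda>i. z i + s * v i :: complex))"
  by (intro continuous_intros)

lemma copen_line:
  assumes "copen n W" "z \<in> cspace n" "v \<in> cspace n"
  shows "open {s. (\<lambda>i. z i + s * v i) \<in> W}"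
proof -
  obtain T where T: "open T" "W = cspace n \<inter> T" using assms(1) copen_iff by auto
  have "{s. (\<lambda>i. z i + s * v i) \<in> W} = (\<lambda>s. (\<lambda>i. z i + s * v i)) -` T"
    using T(2) cspace_add[OF assms(2) cspace_scale[OF assms(3)]] by auto
  then show ?thesis using T(1) continuous_line[of UNIV z v]
    by (simp add: continuous_on_open_vimage)
qed

lemma copen_line_ball:
  assumes "copen n W" "z \<in> W" "v \<in> cspace n"
  obtains \<rho> where "\<rho> > 0" "\<And>s. cmod s < \<rho> \<Longrightarrow> (\<lambda>i. z i + s * v i) \<in> W"
proof -
  have "z \<in> cspace n" using assms copen_subset by blast
  then have "open {s. (\<lambda>i. z i + s * v i) \<in> W}" by (rule copen_line[OF assms(1) _ assms(3)])
  moreover have "0 \<in> {s. (\<lambda>i. z i + s * v i) \<in> W}" using assms(2) by simp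
  ultimately obtain \<rho> where \<rho>: "\<rho> > 0" "ball 0 \<rho> \<subseteq> {s. (\<lambda>i. z i + s * v i) \<in> W}"
    unfolding open_contains_ball by blast
  show thesis
  proof (rule that[OF \<rho>(1)])
    fix s assume "cmod s < \<rho>"
    then have "s \<in> ball 0 \<rho>" by simp
    with \<rho>(2) show "(\<lambda>i. z i + s * v i) \<in> W" by blast
  qed
qed

text \<open>The estimate in \<open>holo_on\<close> ranges over all small increments, with no
  membership condition, so the derivative along a line is a full one at 0, not one within a
  set.\<close>

lemma holo_on_line_deriv:
  assumes f: "holo_on n W f" and z: "z \<in> W" and v: "v \<in> cspace n"
  shows "\<exists>d. ((\<lambda>s. f (\<lambda>i. z i + s * v i)) has_field_derivative d) (at 0)"
proof -
  obtain a :: "nat \<Rightarrow> complex" where a: "\<And>\<epsilon>. \<epsilon>>0 \<Longrightarrow> \<exists>\<delta>>0. \<forall>v\<in>cspace n. cnorm n v < \<delta> \<longrightarrow>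
     cmod (f (\<lambda>i. z i + v i) - f z - (\<Sum>i<n. a i * v i)) \<le> \<epsilon> * cnorm n v"
    using f z unfolding holo_on_def by blast
  define d where "d = (\<Sum>i<n. a i * v i)"
  \<comment> \<open>The direction \<open>v\<close> may be zero; adding 1 makes \<open>N\<close>
    positive, so that \<epsilon> and \<delta> can be rescaled by it.\<close>
  define N where "N = cnorm n v + 1"
  have N: "N > 0" "cnorm n v \<le> N" using cnorm_nonneg[of n v] by (auto simp: N_def)
  have "((\<lambda>s. f (\<lambda>i. z i + s * v i)) has_derivative (\<lambda>s. d * s)) (at 0)"
    unfolding has_derivative_at_alt
  proof (intro conjI allI impI)
    fix e :: real assume "e > 0"
    then have "e / N > 0" using N by simp
    from a[OF this] obtain \<delta> where \<delta>: "\<delta> > 0" "\<And>v. v\<in>cspace n \<Longrightarrow> cnorm n v < \<delta> \<Longrightarrow>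
      cmod (f (\<lambda>i. z i + v i) - f z - (\<Sum>i<n. a i * v i)) \<le> e / N * cnorm n v" by blast
    show "\<exists>\<delta>>0. \<forall>y. cmod (y - 0) < \<delta> \<longrightarrow>
       cmod (f (\<lambda>i. z i + y * v i) - f (\<lambda>i. z i + 0 * v i) - d * (y - 0)) \<le> e * cmod (y - 0)"
    proof (intro exI[of _ "\<delta> / N"] conjI allI impI)
      show "\<delta> / N > 0" using \<delta> N by simp
      fix y :: complex assume y: "cmod (y - 0) < \<delta> / N"
      have le: "cnorm n (\<lambda>i. y * v i) \<le> cmod y * N"
        unfolding cnorm_scale using N by (intro mult_left_mono) auto
      also have "\<dots> < \<delta>" using y N by (simp add: field_simps)
      finally have "cmod (f (\<lambda>i. z i + y * v i) - f z - (\<Sum>i<n. a i * (y * v i)))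
          \<le> e / N * cnorm n (\<lambda>i. y * v i)"
        using \<delta>(2)[OF cspace_scale[OF v]] by blast
      also have "\<dots> \<le> e / N * (cmod y * N)"
        using le \<open>e / N > 0\<close> by (intro mult_left_mono) auto
      also have "\<dots> = e * cmod y" using N by simp
      finally show "cmod (f (\<lambda>i. z i + y * v i) - f (\<lambda>i. z i + 0 * v i) - d * (y - 0)) \<le> e * cmod (y - 0)"
        by (simp add: d_def sum_distrib_left sum_distrib_right mult_ac)
    qed
  qed (rule bounded_linear_mult_right)
  then show ?thesis unfolding has_field_derivative_def by blast
qed

text \<open>Recentring the line at the point with parameter \<open>s\<close> reduces
  differentiability there to the case of parameter 0.\<close>

lemma holo_on_line:
  assumes f: "holo_on n W f" and v: "v \<in> cspace n"
    and B: "\<And>s. s \<in> B \<Longrightarrow> (\<lambda>i. z i + s * v i) \<in> W"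
  shows "(\<lambda>s. f (\<lambda>i. z i + s * v i)) holomorphic_on B"
  unfolding holomorphic_on_def
proof
  fix s assume s: "s \<in> B"
  obtain d where "((\<lambda>t. f (\<lambda>i. (z i + s * v i) + t * v i)) has_field_derivative d) (at 0)"
    using holo_on_line_deriv[OF f B[OF s] v] by blast
  then have "((\<lambda>t. f (\<lambda>i. (z i + s * v i) + t * v i)) has_field_derivative d) (at (s + - s))" by simp
  from DERIV_at_within_shift[of _ _ "-s" s UNIV, THEN iffD1, of "(\<lambda>t. f (\<lambda>i. (z i + s * v i) + t * v i))"] this
  have "((\<lambda>t. f (\<lambda>i. (z i + s * v i) + (- s + t) * v i)) has_field_derivative d) (at s)"
    by (simp add: add.commute)
  then have "((\<lambda>t. f (\<lambda>i. z i + t * v i)) has_field_derivative d) (at s)"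
    by (simp add: algebra_simps)
  then show "(\<lambda>s. f (\<lambda>i. z i + s * v i)) field_differentiable (at s within B)"
    using field_differentiable_at_within field_differentiable_def by blast
qed

section \<open>The function log |w|^2 and means of extended real functions\<close>

definition log_sq :: "complex \<Rightarrow> ereal" where
  "log_sq w = elog (ennreal ((cmod w)\<^sup>2))"

lemma log_sq_0: "log_sq 0 = -\<infinity>"
  by (simp add: log_sq_def elog_def)

lemma log_sq_nz: "w \<noteq> 0 \<Longrightarrow> log_sq w = ereal (2 * ln (cmod w))"
  by (simp add: log_sq_def elog_def ln_realpow)

lemma log_sq_less_top: "log_sq w < \<infinity>"
  by (cases "w = 0") (auto simp: log_sq_0 log_sq_nz)

lemma open_log_sq_less: "open {w. log_sq w < a}"
proof (cases a)
  case (real r)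
  have "{w. log_sq w < a} = {w. (cmod w)\<^sup>2 < exp r}"
  proof (intro set_eqI)
    fix w show "w \<in> {w. log_sq w < a} \<longleftrightarrow> w \<in> {w. (cmod w)\<^sup>2 < exp r}"
    proof (cases "w = 0")
      case False
      then have "2 * ln (cmod w) = ln ((cmod w)\<^sup>2)" by (simp add: ln_realpow)
      then show ?thesis using False real ln_less_cancel_iff[of "(cmod w)\<^sup>2" "exp r"]
        by (simp add: log_sq_nz)
    qed (simp add: log_sq_0 real)
  qed
  then show ?thesis by (auto intro!: open_Collect_less continuous_intros)
next
  case PInf
  then show ?thesis using log_sq_less_top by (simp add: less_top)
qed auto

text \<open>The expression inside \<open>circle_mean\<close>, for an arbitrary measure. In
  \<open>ereal\<close> the difference \<infinity> - \<infinity> is \<infinity>, hence the mean is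
  \<infinity> as soon as the positive part has infinite integral.\<close>

definition ereal_mean :: "'a measure \<Rightarrow> ('a \<Rightarrow> ereal) \<Rightarrow> ereal" where
  "ereal_mean M f = enn2ereal (\<integral>\<^sup>+s. e2ennreal (f s) \<partial>M) - enn2ereal (\<integral>\<^sup>+s. e2ennreal (- f s) \<partial>M)"

lemma e2ennreal_add_ereal_le: "e2ennreal (x + ereal y) \<le> e2ennreal x + ennreal \<bar>y\<bar>"
proof (cases x)
  case (real r)
  have "ennreal (r + y) \<le> ennreal (max 0 r + \<bar>y\<bar>)" by (intro ennreal_leI) auto
  also have "\<dots> = ennreal (max 0 r) + ennreal \<bar>y\<bar>" by (subst ennreal_plus) auto
  also have "ennreal (max 0 r) = ennreal r" by (simp add: max_def ennreal_neg)
  finally show ?thesis using real by (simp add: e2ennreal_ereal)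
qed (auto simp: e2ennreal_infty)

text \<open>This direction is the one a submean inequality calls for. If the positive part has
  finite integral, either the mean of \<open>f\<close> is -\<infinity> and nothing is to be shown,
  or \<open>f\<close> is almost everywhere real and integrable and ordinary linearity
  applies.\<close>

lemma ereal_mean_add:
  assumes f [measurable]: "f \<in> borel_measurable M" and g: "integrable M (g :: _ \<Rightarrow> real)"
  shows "ereal_mean M f + ereal (\<integral>s. g s \<partial>M) \<le> ereal_mean M (\<lambda>s. f s + ereal (g s))"
proof -
  have [measurable]: "g \<in> borel_measurable M" using g by auto
  let ?G = "\<integral>\<^sup>+s. ennreal \<bar>g s\<bar> \<partial>M"
  have G: "?G < \<infinity>" using g by (simp add: integrable_iff_bounded)
  let ?p = "\<lambda>f. \<integral>\<^sup>+s. e2ennreal (f s) \<partial>M"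
  let ?n = "\<lambda>f. \<integral>\<^sup>+s. e2ennreal (- f s) \<partial>M"
  let ?h = "\<lambda>s. f s + ereal (g s)"
  have p1: "?p f \<le> ?p ?h + ?G"
  proof -
    have "e2ennreal (f s) \<le> e2ennreal (f s + ereal (g s)) + ennreal \<bar>g s\<bar>" for s
      using e2ennreal_add_ereal_le[of "f s + ereal (g s)" "- g s"]
      by (cases "f s") simp_all
    then have "?p f \<le> (\<integral>\<^sup>+s. e2ennreal (?h s) + ennreal \<bar>g s\<bar> \<partial>M)" by (intro nn_integral_mono) auto
    also have "\<dots> = ?p ?h + ?G" by (rule nn_integral_add) auto
    finally show ?thesis .
  qed
  have p2: "?p ?h \<le> ?p f + ?G"
  proof -
    have "?p ?h \<le> (\<integral>\<^sup>+s. e2ennreal (f s) + ennreal \<bar>g s\<bar> \<partial>M)"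
      using e2ennreal_add_ereal_le by (intro nn_integral_mono) auto
    also have "\<dots> = ?p f + ?G" by (rule nn_integral_add) auto
    finally show ?thesis .
  qed
  have n2: "?n ?h \<le> ?n f + ?G"
  proof -
    have "e2ennreal (- (f s + ereal (g s))) \<le> e2ennreal (- f s) + ennreal \<bar>g s\<bar>" for s
      using e2ennreal_add_ereal_le[of "- f s" "- g s"]
      by (cases "f s") simp_all
    then have "?n ?h \<le> (\<integral>\<^sup>+s. e2ennreal (- f s) + ennreal \<bar>g s\<bar> \<partial>M)"
      by (intro nn_integral_mono) auto
    also have "\<dots> = ?n f + ?G" by (rule nn_integral_add) auto
    finally show ?thesis .
  qed
  show ?thesis
  proof (cases "?p f = \<infinity>")
    case True
    \<comment> \<open>An integrable \<open>g\<close> cannot bring an infinite positive part down, so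
      the right-hand mean is \<infinity> as well.\<close>
    then have "?p ?h = \<infinity>" using p1 G
      by (auto simp: top_unique ennreal_add_eq_top)
    then show ?thesis unfolding ereal_mean_def by simp
  next
    case pf: False
    show ?thesis
    proof (cases "?n f = \<infinity>")
      case True
      then show ?thesis using pf unfolding ereal_mean_def
        by (cases "?p f") (auto simp: ennreal_less_top)
    next
      case nf: False
      have "AE s in M. e2ennreal (f s) \<noteq> \<infinity>" using pf by (intro nn_integral_noteq_infinite) auto
      moreover have "AE s in M. e2ennreal (- f s) \<noteq> \<infinity>" using nf by (intro nn_integral_noteq_infinite) auto
      ultimately have fin: "AE s in M. f s \<noteq> \<infinity> \<and> f s \<noteq> -\<infinity>"
        by eventually_elim (auto simp: e2ennreal_infty)
      define f0 where "f0 s = real_of_ereal (f s)" for s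
      have [measurable]: "f0 \<in> borel_measurable M" unfolding f0_def by measurable
      have eq: "AE s in M. f s = ereal (f0 s)"
        using fin by eventually_elim (auto simp: f0_def ereal_real)
      have P: "?p f = (\<integral>\<^sup>+s. ennreal (f0 s) \<partial>M)"
        by (intro nn_integral_cong_AE, use eq in eventually_elim) (simp add: e2ennreal_ereal)
      have N: "?n f = (\<integral>\<^sup>+s. ennreal (- f0 s) \<partial>M)"
        by (intro nn_integral_cong_AE, use eq in eventually_elim) (simp add: e2ennreal_ereal)
      have hP: "?p ?h = (\<integral>\<^sup>+s. ennreal (f0 s + g s) \<partial>M)"
        by (intro nn_integral_cong_AE, use eq in eventually_elim) (simp add: e2ennreal_ereal)
      have hN: "?n ?h = (\<integral>\<^sup>+s. ennreal (- (f0 s + g s)) \<partial>M)"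
        by (intro nn_integral_cong_AE, use eq in eventually_elim) (simp add: e2ennreal_ereal)
      have int: "integrable M f0" using pf nf unfolding P N by (simp add: real_integrable_def)
      have key: "enn2ereal (\<integral>\<^sup>+s. ennreal (k s) \<partial>M) - enn2ereal (\<integral>\<^sup>+s. ennreal (- k s) \<partial>M)
          = ereal (\<integral>s. k s \<partial>M)" if "integrable M k" for k :: "_ \<Rightarrow> real"
      proof -
        have "(\<integral>\<^sup>+s. ennreal (k s) \<partial>M) \<noteq> \<infinity>" "(\<integral>\<^sup>+s. ennreal (- k s) \<partial>M) \<noteq> \<infinity>"
          using that by (auto simp: real_integrable_def)
        then show ?thesis unfolding real_lebesgue_integral_def[OF that]
          by (cases "\<integral>\<^sup>+s. ennreal (k s) \<partial>M"; cases "\<integral>\<^sup>+s. ennreal (- k s) \<partial>M")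
             (auto simp: enn2ereal_ennreal)
      qed
      have "ereal_mean M f = ereal (\<integral>s. f0 s \<partial>M)"
        unfolding ereal_mean_def P N by (rule key[OF int])
      moreover have "ereal_mean M ?h = ereal (\<integral>s. f0 s + g s \<partial>M)"
        unfolding ereal_mean_def hP hN by (rule key) (intro Bochner_Integration.integrable_add int g)
      ultimately show ?thesis using int g by simp
    qed
  qed
qed

section \<open>Plurisubharmonic functions\<close>

lemma circle_mean_eq:
  "circle_mean u z v r = ereal_mean (uniform_measure lborel {0..2*pi}) (\<lambda>s. u (\<lambda>i. z i + of_real r * cis s * v i))"
  by (simp add: circle_mean_def ereal_mean_def Let_def)

lemma integral_uniform_measure_Icc:
  fixes k :: "real \<Rightarrow> real"
  assumes ab: "a < b" and k: "continuous_on {a..b} k" and [measurable]: "k \<in> borel_measurable borel"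
  shows "integrable (uniform_measure lborel {a..b}) k"
    and "(\<integral>s. k s \<partial>uniform_measure lborel {a..b}) = integral {a..b} k / (b - a)"
proof -
  have eq: "uniform_measure lborel {a..b} = density lborel (\<lambda>s. ennreal (indicator {a..b} s / (b - a)))"
    unfolding uniform_measure_def using ab
    by (intro density_cong) (auto simp: indicator_def divide_ennreal ennreal_1[symmetric] simp del: ennreal_1)
  have int: "set_integrable lborel {a..b} k" by (rule borel_integrable_atLeastAtMost'[OF k])
  then have i2: "integrable lborel (\<lambda>s. (indicator {a..b} s / (b - a)) * k s)"
    using integrable_mult_right[of "1 / (b - a)" lborel "\<lambda>s. indicator {a..b} s * k s"]
    by (simp add: set_integrable_def)
  show "integrable (uniform_measure lborel {a..b}) k"
    unfolding eq using ab i2 by (subst integrable_real_density) auto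
  have "(\<integral>s. k s \<partial>uniform_measure lborel {a..b}) = (\<integral>s. (indicator {a..b} s / (b - a)) * k s \<partial>lborel)"
    unfolding eq using ab by (subst integral_real_density) auto
  also have "\<dots> = (LINT s:{a..b}|lborel. k s) / (b - a)"
    unfolding set_lebesgue_integral_def by simp
  also have "(LINT s:{a..b}|lborel. k s) = integral {a..b} k"
    using int by (rule set_borel_integral_eq_integral)
  finally show "(\<integral>s. k s \<partial>uniform_measure lborel {a..b}) = integral {a..b} k / (b - a)" .
qed

text \<open>The mean value property of the harmonic function log |f|^2. A zero-free \<open>f\<close>
  on a disc is exp g, so log |f|^2 = 2 Re g, and by Cauchy's formula the mean of g over a circle is
  its value at the centre.\<close>

lemma mean_log_cmod_holomorphic:
  assumes f: "f holomorphic_on ball 0 \<rho>" and nz: "\<And>s. cmod s < \<rho> \<Longrightarrow> f s \<noteq> 0"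
    and r: "0 < r" "r < \<rho>"
  shows "integrable (uniform_measure lborel {0..2*pi}) (\<lambda>s. 2 * ln (cmod (f (of_real r * cis s))))"
    and "(\<integral>s. 2 * ln (cmod (f (of_real r * cis s))) \<partial>uniform_measure lborel {0..2*pi}) = 2 * ln (cmod (f 0))"
proof -
  have "contractible (ball (0::complex) \<rho>)" using convex_imp_contractible by blast
  then obtain g where g: "g holomorphic_on ball 0 \<rho>" "\<And>s. s \<in> ball 0 \<rho> \<Longrightarrow> f s = exp (g s)"
    using contractible_imp_holomorphic_log[OF f] nz by (metis mem_ball_0)
  have ln: "ln (cmod (f s)) = Re (g s)" if "cmod s < \<rho>" for s
    using g(2)[of s] that by simp
  have in_ball: "cmod (of_real r * cis s) < \<rho>" for s :: real using r by (simp add: norm_mult)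
  have cont: "continuous_on S (\<lambda>s. g (of_real r * cis s))" for S :: "real set"
    by (rule continuous_on_compose2[OF holomorphic_on_imp_continuous_on[OF g(1)]])
       (use in_ball in \<open>auto intro!: continuous_intros\<close>)
  have k: "(\<lambda>s. 2 * ln (cmod (f (of_real r * cis s)))) = (\<lambda>s. 2 * Re (g (of_real r * cis s)))"
    using ln in_ball by simp
  have ck: "continuous_on S (\<lambda>s. 2 * Re (g (of_real r * cis s)))" for S :: "real set"
    by (intro continuous_intros cont)
  have "((\<lambda>u. g u/(u-0)) has_contour_integral (2 * of_real pi * \<i> * g 0)) (circlepath 0 r)"
  proof (rule Cauchy_integral_circlepath)
    show "g holomorphic_on ball 0 r" using g(1) r by (auto intro: holomorphic_on_subset)
    show "continuous_on (cball 0 r) g"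
      using holomorphic_on_imp_continuous_on[OF g(1)] by (rule continuous_on_subset) (use r in auto)
  qed (use r in auto)
  then have "((\<lambda>t. g (of_real r * cis t) / (of_real r * cis t) * of_real r * \<i> * cis t)
       has_integral (2 * of_real pi * \<i> * g 0)) {0..2*pi}"
    unfolding circlepath_def by (subst (asm) has_contour_integral_part_circlepath_iff) auto
  moreover have "g (of_real r * cis t) / (of_real r * cis t) * of_real r * \<i> * cis t = \<i> * g (of_real r * cis t)"
    for t :: real
  proof -
    have "x / (a * b) * a * \<i> * b = \<i> * x" if "a \<noteq> 0" "b \<noteq> 0" for x a b :: complex
      using that by simp
    then show ?thesis using r by simp
  qed
  ultimately have "((\<lambda>t. \<i> * g (of_real r * cis t)) has_integral (2 * of_real pi * \<i> * g 0)) {0..2*pi}" by (simp only:)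
  \<comment> \<open>Multiplying by -2i cancels the factor i that the derivative of the circle
    contributes and supplies the 2 of 2 Re g.\<close>
  then have "((\<lambda>t. (- 2 * \<i>) * (\<i> * g (of_real r * cis t))) has_integral ((- 2 * \<i>) * (2 * of_real pi * \<i> * g 0))) {0..2*pi}"
    by (rule has_integral_mult_right)
  moreover have "(- 2 * \<i>) * (\<i> * x) = 2 * x" for x by (simp add: algebra_simps)
  moreover have "(- 2 * \<i>) * (2 * of_real pi * \<i> * g 0) = 4 * of_real pi * g 0" by (simp add: algebra_simps)
  ultimately have "((\<lambda>t. 2 * g (of_real r * cis t)) has_integral (4 * of_real pi * g 0)) {0..2*pi}" by (simp only:)
  then have "((\<lambda>t. Re (2 * g (of_real r * cis t))) has_integral Re (4 * of_real pi * g 0)) {0..2*pi}"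
    by (rule has_integral_Re)
  then have "integral {0..2*pi} (\<lambda>t. 2 * Re (g (of_real r * cis t))) = 4 * pi * Re (g 0)"
    by (intro integral_unique) simp
  then have I: "integral {0..2*pi} (\<lambda>t. 2 * Re (g (of_real r * cis t))) / (2 * pi - 0) = 2 * ln (cmod (f 0))"
    using r ln[of 0] by simp
  have meas: "(\<lambda>t. 2 * Re (g (of_real r * cis t))) \<in> borel_measurable borel"
    by (rule borel_measurable_continuous_onI[OF ck])
  show "integrable (uniform_measure lborel {0..2*pi}) (\<lambda>s. 2 * ln (cmod (f (of_real r * cis s))))"
    unfolding k by (rule integral_uniform_measure_Icc(1)[OF _ ck meas]) simp
  show "(\<integral>s. 2 * ln (cmod (f (of_real r * cis s))) \<partial>uniform_measure lborel {0..2*pi}) = 2 * ln (cmod (f 0))"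
    unfolding k I[symmetric] by (rule integral_uniform_measure_Icc(2)[OF _ ck meas]) simp
qed

lemma psh_on_upper: "psh_on n W u \<Longrightarrow> openin (top_of_set W) {z \<in> W. u z < a}"
  and psh_on_less_top: "psh_on n W u \<Longrightarrow> z \<in> W \<Longrightarrow> u z < \<infinity>"
  by (auto simp: psh_on_def)

lemma psh_on_submean:
  assumes "psh_on n W u" "z \<in> W" "v \<in> cspace n"
  obtains \<rho> where "\<rho> > 0" "\<And>r. 0 < r \<Longrightarrow> r < \<rho> \<Longrightarrow> u z \<le> circle_mean u z v r"
  using assms unfolding psh_on_def by blast

text \<open>Supplies the measurability along circles that \<open>ereal_mean_add\<close> demands:
  sublevel sets pull back to open sets of parameters.\<close>

lemma usc_compose_measurable:
  fixes u :: "'a::topological_space \<Rightarrow> ereal" and \<gamma> :: "real \<Rightarrow> 'a"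
  assumes usc: "\<And>a. openin (top_of_set W) {z \<in> W. u z < a}"
    and \<gamma>: "continuous_on UNIV \<gamma>" "\<And>s. \<gamma> s \<in> W"
  shows "(\<lambda>s. u (\<gamma> s)) \<in> borel_measurable borel"
proof (rule borel_measurableI_less)
  fix a
  obtain T where T: "open T" "{z \<in> W. u z < a} = W \<inter> T" using usc[of a] unfolding openin_open by blast
  have "{s \<in> space borel. u (\<gamma> s) < a} = \<gamma> -` T" using T(2) \<gamma>(2) by auto
  then show "{s \<in> space borel. u (\<gamma> s) < a} \<in> sets borel"
    using T(1) \<gamma>(1) by (simp add: continuous_on_open_vimage)
qed

text \<open>Exhibits a sublevel set of a sum as a union, over real thresholds, of intersections of
  sublevel sets, whence sums of upper semicontinuous functions are upper semicontinuous. The slack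
  is halved if both summands are finite; otherwise the summand -\<infinity> absorbs what is
  left.\<close>

lemma ereal_add_less_iff:
  fixes x y a :: ereal
  assumes "x < \<infinity>" "y < \<infinity>"
  shows "x + y < a \<longleftrightarrow> (\<exists>b c::real. ereal (b + c) \<le> a \<and> x < ereal b \<and> y < ereal c)"
proof
  assume L: "x + y < a"
  show "\<exists>b c::real. ereal (b + c) \<le> a \<and> x < ereal b \<and> y < ereal c"
  proof (cases "a = \<infinity>")
    case True
    obtain b where "x < ereal b" using assms(1) ereal_dense2 less_PInf_Ex_of_nat by blast
    moreover obtain c where "y < ereal c" using assms(2) less_PInf_Ex_of_nat by blast
    ultimately show ?thesis using True by auto
  next
    case False
    then obtain a' where a: "a = ereal a'" using L by (cases a) auto
    consider (1) x' y' where "x = ereal x'" "y = ereal y'" | (2) x' where "x = ereal x'" "y = -\<infinity>"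
      | (3) y' where "x = -\<infinity>" "y = ereal y'" | (4) "x = -\<infinity>" "y = -\<infinity>"
      using assms by (cases x; cases y) auto
    then show ?thesis
    proof cases
      case 1
      then show ?thesis using L a
        by (intro exI[of _ "x' + (a' - x' - y') / 2"] exI[of _ "y' + (a' - x' - y') / 2"]) (auto simp: field_simps)
    next
      case 2
      then show ?thesis using a by (intro exI[of _ "x' + 1"] exI[of _ "a' - x' - 1"]) auto
    next
      case 3
      then show ?thesis using a by (intro exI[of _ "a' - y' - 1"] exI[of _ "y' + 1"]) auto
    next
      case 4
      then show ?thesis using a by (intro exI[of _ a'] exI[of _ 0]) auto
    qed
  qed
next
  assume "\<exists>b c::real. ereal (b + c) \<le> a \<and> x < ereal b \<and> y < ereal c"
  then obtain b c :: real where bc: "ereal (b + c) \<le> a" "x < ereal b" "y < ereal c" by blast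
  have "x + y < ereal b + ereal c" using bc(2,3) by (cases x; cases y) auto
  then show "x + y < a" using bc(1) by (simp add: order_less_le_trans)
qed

text \<open>At a zero of F the submean inequality is trivial; elsewhere \<open>log |F|\<^sup>2\<close> is harmonic on a small
  disc of every complex line.\<close>

lemma psh_on_add_log_sq:
  assumes W: "copen n W" and u: "psh_on n W u" and F: "continuous_on W F"
    and hol: "\<And>z v B. z \<in> W \<Longrightarrow> v \<in> cspace n \<Longrightarrow> (\<And>s. s \<in> B \<Longrightarrow> (\<lambda>i. z i + s * v i) \<in> W) \<Longrightarrow>
       (\<lambda>s. F (\<lambda>i. z i + s * v i)) holomorphic_on B"
  shows "psh_on n W (\<lambda>z. u z + log_sq (F z))"
  unfolding psh_on_def
proof (intro conjI allI ballI)
  fix a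
  have iff: "u z + log_sq (F z) < a \<longleftrightarrow> (\<exists>b c. ereal (b + c) \<le> a \<and> u z < ereal b \<and> log_sq (F z) < ereal c)"
    if "z \<in> W" for z
    using psh_on_less_top[OF u that] log_sq_less_top by (rule ereal_add_less_iff)
  have eq: "{z \<in> W. u z + log_sq (F z) < a} =
      (\<Union>(b, c)\<in>{(b, c). ereal (b + c) \<le> a}. {z \<in> W. u z < ereal b} \<inter> {z \<in> W. log_sq (F z) < ereal c})"
    unfolding set_eq_iff using iff by blast
  have "openin (top_of_set W) {z \<in> W. log_sq (F z) < c}" for c
  proof -
    have "{z \<in> W. log_sq (F z) < c} = W \<inter> F -` {w. log_sq w < c}" by auto
    then show ?thesis using continuous_openin_preimage_gen[OF F open_log_sq_less[of c]] by simp
  qed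
  then show "openin (top_of_set W) {z \<in> W. u z + log_sq (F z) < a}"
    unfolding eq using psh_on_upper[OF u] by (intro openin_Union) auto
next
  fix z assume "z \<in> W"
  then show "u z + log_sq (F z) < \<infinity>"
    using psh_on_less_top[OF u] log_sq_less_top by (metis ereal_plus_eq_PInfty ereal_infty_less(1))
next
  fix z v assume z: "z \<in> W" and v: "v \<in> cspace n"
  define \<gamma> where "\<gamma> s = (\<lambda>i. z i + s * v i)" for s
  show "\<exists>\<rho>>0. \<forall>r. 0 < r \<and> r < \<rho> \<longrightarrow>
      u z + log_sq (F z) \<le> circle_mean (\<lambda>z. u z + log_sq (F z)) z v r"
  proof (cases "F z = 0")
    case True
    then have "u z + log_sq (F z) = -\<infinity>" using psh_on_less_top[OF u z] by (cases "u z") (auto simp: log_sq_0)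
    then have "u z + log_sq (F z) \<le> x" for x by (metis ereal_less_eq(2))
    then show ?thesis using zero_less_one by blast
  next
    case False
    obtain \<rho>1 where \<rho>1: "\<rho>1 > 0" "\<And>r. 0 < r \<Longrightarrow> r < \<rho>1 \<Longrightarrow> u z \<le> circle_mean u z v r"
      using psh_on_submean[OF u z v] by blast
    obtain \<rho>2 where \<rho>2: "\<rho>2 > 0" "\<And>s. cmod s < \<rho>2 \<Longrightarrow> \<gamma> s \<in> W"
      using copen_line_ball[OF W z v] unfolding \<gamma>_def by blast
    have h2: "(\<lambda>s. F (\<gamma> s)) holomorphic_on ball 0 \<rho>2"
      unfolding \<gamma>_def by (rule hol[OF z v]) (use \<rho>2(2) in \<open>auto simp: \<gamma>_def\<close>)
    have "continuous (at 0) (\<lambda>s. F (\<gamma> s))"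
      using holomorphic_on_imp_continuous_on[OF h2] \<rho>2(1) by (simp add: continuous_on_eq_continuous_at)
    moreover have "F (\<gamma> 0) \<noteq> 0" using False by (simp add: \<gamma>_def)
    ultimately obtain \<rho>3 where \<rho>3: "\<rho>3 > 0" "\<And>s. dist 0 s < \<rho>3 \<Longrightarrow> F (\<gamma> s) \<noteq> 0"
      using continuous_at_avoid by blast
    \<comment> \<open>Below this radius the submean inequality for \<open>u\<close> holds, circles
      stay in \<open>W\<close>, and \<open>F\<close> has no zero on the disc.\<close>
    define \<rho> where "\<rho> = min \<rho>1 (min \<rho>2 \<rho>3)"
    have h: "(\<lambda>s. F (\<gamma> s)) holomorphic_on ball 0 \<rho>"
      by (rule holomorphic_on_subset[OF h2]) (auto simp: \<rho>_def)
    have nz: "F (\<gamma> s) \<noteq> 0" if "cmod s < \<rho>" for s using \<rho>3(2)[of s] that by (simp add: \<rho>_def)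
    show ?thesis
    proof (intro exI[of _ \<rho>] conjI allI impI)
      show "\<rho> > 0" using \<rho>1 \<rho>2 \<rho>3 by (simp add: \<rho>_def)
      fix r assume r: "0 < r \<and> r < \<rho>"
      let ?M = "uniform_measure lborel {0..2*pi}"
      let ?c = "\<lambda>s. \<gamma> (of_real r * cis s)"
      have cm: "cmod (of_real r * cis s) = r" for s using r by (simp add: norm_mult)
      have inW: "?c s \<in> W" for s using \<rho>2(2)[of "of_real r * cis s"] cm r by (simp add: \<rho>_def)
      have "continuous_on UNIV ?c" unfolding \<gamma>_def by (intro continuous_intros)
      then have meas: "(\<lambda>s. u (?c s)) \<in> borel_measurable ?M"
        using usc_compose_measurable[OF psh_on_upper[OF u]] inW by simp
      note mlog = mean_log_cmod_holomorphic[OF h nz conjunct1[OF r] conjunct2[OF r]]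
      have "u z \<le> ereal_mean ?M (\<lambda>s. u (?c s))"
        using \<rho>1(2)[of r] r unfolding circle_mean_eq \<gamma>_def by (simp add: \<rho>_def)
      moreover have "log_sq (F z) = ereal (\<integral>s. 2 * ln (cmod (F (?c s))) \<partial>?M)"
        proof -
        have "(\<integral>s. 2 * ln (cmod (F (?c s))) \<partial>?M) = 2 * ln (cmod (F (\<gamma> 0)))" by (rule mlog(2))
        also have "\<gamma> 0 = z" by (simp add: \<gamma>_def)
        finally show ?thesis using False by (simp only: log_sq_nz not_False_eq_True)
      qed
      ultimately have "u z + log_sq (F z) \<le> ereal_mean ?M (\<lambda>s. u (?c s)) + ereal (\<integral>s. 2 * ln (cmod (F (?c s))) \<partial>?M)"
        by (simp add: add_right_mono)
      also have "\<dots> \<le> ereal_mean ?M (\<lambda>s. u (?c s) + ereal (2 * ln (cmod (F (?c s)))))"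
        by (rule ereal_mean_add[OF meas mlog(1)])
      also have "\<dots> = circle_mean (\<lambda>z. u z + log_sq (F z)) z v r"
        unfolding circle_mean_eq using nz cm r by (simp add: log_sq_nz \<gamma>_def)
      finally show "u z + log_sq (F z) \<le> circle_mean (\<lambda>z. u z + log_sq (F z)) z v r" .
    qed
  qed
qed

text \<open>Circle means see values away from the centre, and outside \<open>W\<close> nothing
  relates the two functions; openness of \<open>W\<close> lets the radius shrink until the circles
  stay inside.\<close>

lemma psh_on_cong:
  assumes W: "copen n W" and u: "psh_on n W u" and eq: "\<And>z. z \<in> W \<Longrightarrow> u z = u' z"
  shows "psh_on n W u'"
  unfolding psh_on_def
proof (intro conjI allI ballI)
  fix a
  have "{z \<in> W. u' z < a} = {z \<in> W. u z < a}" using eq by auto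
  then show "openin (top_of_set W) {z \<in> W. u' z < a}" using psh_on_upper[OF u] by simp
next
  fix z assume "z \<in> W" then show "u' z < \<infinity>" using psh_on_less_top[OF u] eq by fastforce
next
  fix z v assume z: "z \<in> W" and v: "v \<in> cspace n"
  obtain \<rho>1 where \<rho>1: "\<rho>1 > 0" "\<And>r. 0 < r \<Longrightarrow> r < \<rho>1 \<Longrightarrow> u z \<le> circle_mean u z v r"
    using psh_on_submean[OF u z v] by blast
  obtain \<rho>2 where \<rho>2: "\<rho>2 > 0" "\<And>s. cmod s < \<rho>2 \<Longrightarrow> (\<lambda>i. z i + s * v i) \<in> W"
    using copen_line_ball[OF W z v] by blast
  show "\<exists>\<rho>>0. \<forall>r. 0 < r \<and> r < \<rho> \<longrightarrow> u' z \<le> circle_mean u' z v r"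
  proof (intro exI[of _ "min \<rho>1 \<rho>2"] conjI allI impI)
    fix r assume r: "0 < r \<and> r < min \<rho>1 \<rho>2"
    have "u (\<lambda>i. z i + of_real r * cis s * v i) = u' (\<lambda>i. z i + of_real r * cis s * v i)" for s
      using \<rho>2(2)[of "of_real r * cis s"] r by (intro eq) (simp add: norm_mult)
    then have "circle_mean u z v r = circle_mean u' z v r" unfolding circle_mean_eq by simp
    then show "u' z \<le> circle_mean u' z v r" using \<rho>1(2)[of r] r eq[OF z] by simp
  qed (use \<rho>1 \<rho>2 in simp)
qed

text \<open>Needed because a chart of the projective bundle lives over a set that trivializes A as
  well as L, whereas a weight of L is to be examined on a set that merely trivializes L.\<close>

lemma psh_on_local:
  assumes "\<And>z. z \<in> W \<Longrightarrow> \<exists>W'. z \<in> W' \<and> W' \<subseteq> W \<and> openin (top_of_set W) W' \<and> psh_on n W' u"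
  shows "psh_on n W u"
  unfolding psh_on_def
proof (intro conjI allI ballI)
  fix a
  show "openin (top_of_set W) {z \<in> W. u z < a}"
  proof (subst openin_subopen, intro ballI)
    fix z assume z: "z \<in> {z \<in> W. u z < a}"
    then obtain W' where W': "z \<in> W'" "W' \<subseteq> W" "openin (top_of_set W) W'" "psh_on n W' u" using assms by blast
    have "openin (top_of_set W) {z \<in> W'. u z < a}"
      using psh_on_upper[OF W'(4)] W'(3) by (rule openin_trans)
    then show "\<exists>T. openin (top_of_set W) T \<and> z \<in> T \<and> T \<subseteq> {z \<in> W. u z < a}"
      using z W' by (intro exI[of _ "{z \<in> W'. u z < a}"]) auto
  qed
next
  fix z assume "z \<in> W" then show "u z < \<infinity>" using assms psh_on_less_top by blast
next
  fix z v assume "z \<in> W" "v \<in> cspace n"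
  then show "\<exists>\<rho>>0. \<forall>r. 0 < r \<and> r < \<rho> \<longrightarrow> u z \<le> circle_mean u z v r"
    using assms[of z] unfolding psh_on_def by blast
qed

text \<open>A base domain times a domain of the fibre coordinate, which sits at index
  \<open>n\<close>. As \<open>cspace n\<close> is the part of \<open>cspace (Suc n)\<close> where
  that coordinate vanishes, \<open>z(n := 0)\<close> is the projection to the base and the zero
  slice is \<open>E\<close> itself, without reindexing.\<close>

definition cprod :: "nat \<Rightarrow> (nat \<Rightarrow> complex) set \<Rightarrow> complex set \<Rightarrow> (nat \<Rightarrow> complex) set" where
  "cprod n E T = {z \<in> cspace (Suc n). z(n := 0) \<in> E \<and> z n \<in> T}"

lemma continuous_on_upd0: "continuous_on S (\<lambda>z :: nat \<Rightarrow> complex. z(n := 0))"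
proof (rule continuous_on_coordinatewise_then_product)
  show "continuous_on S (\<lambda>z :: nat \<Rightarrow> complex. (z(n := 0)) i)" for i
    using continuous_on_subset[OF continuous_on_product_coordinates subset_UNIV]
    by (cases "i = n") auto
qed

lemma cspace_upd0: "z \<in> cspace (Suc n) \<Longrightarrow> z(n := 0) \<in> cspace n"
  by (auto simp: cspace_def)

lemma cspace_Suc_mono: "cspace n \<subseteq> cspace (Suc n)"
  by (auto simp: cspace_def)

lemma copen_cprod:
  assumes "copen n E" "open T"
  shows "copen (Suc n) (cprod n E T)"
proof -
  obtain S where S: "open S" "E = cspace n \<inter> S" using assms(1) copen_iff by auto
  have "open ((\<lambda>z :: nat \<Rightarrow> complex. z(n := 0)) -` S)" "open ((\<lambda>z :: nat \<Rightarrow> complex. z n) -` T)"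
    using S(1) assms(2) continuous_on_upd0[of UNIV n] continuous_on_product_coordinates[of n]
    by (auto simp only: continuous_on_open_vimage[OF open_UNIV] Int_UNIV_right)
  moreover have "cprod n E T = cspace (Suc n) \<inter> (((\<lambda>z. z(n := 0)) -` S) \<inter> ((\<lambda>z. z n) -` T))"
    using S(2) cspace_upd0 by (auto simp: cprod_def)
  ultimately show ?thesis unfolding copen_iff by blast
qed

text \<open>The projection is linear: it carries a circle in direction \<open>v\<close> to the
  circle in the projected direction with the same parameter, so the means agree. The projected
  direction may be 0, which \<open>psh_on\<close> admits.\<close>

lemma psh_on_cprod_pullback:
  assumes u: "psh_on n E u"
  shows "psh_on (Suc n) (cprod n E T) (\<lambda>z. u (z(n := 0)))"
  unfolding psh_on_def
proof (intro conjI allI ballI)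
  fix a
  obtain S where S: "open S" "{z \<in> E. u z < a} = E \<inter> S" using psh_on_upper[OF u] unfolding openin_open by blast
  have "{z \<in> cprod n E T. u (z(n := 0)) < a} = cprod n E T \<inter> (\<lambda>z. z(n := 0)) -` S"
    using S(2) by (auto simp: cprod_def)
  then show "openin (top_of_set (cprod n E T)) {z \<in> cprod n E T. u (z(n := 0)) < a}"
    using continuous_openin_preimage_gen[OF continuous_on_upd0 S(1)] by metis
next
  fix z assume "z \<in> cprod n E T" then show "u (z(n := 0)) < \<infinity>" using psh_on_less_top[OF u] by (auto simp: cprod_def)
next
  fix z v assume z: "z \<in> cprod n E T" and v: "v \<in> cspace (Suc n)"
  have "(\<lambda>i. z i + of_real r * cis s * v i)(n := 0) = (\<lambda>i. (z(n := 0)) i + of_real r * cis s * (v(n := 0)) i)" for r s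
    by auto
  then have "circle_mean (\<lambda>z. u (z(n := 0))) z v r = circle_mean u (z(n := 0)) (v(n := 0)) r" for r
    unfolding circle_mean_eq by presburger
  then show "\<exists>\<rho>>0. \<forall>r. 0 < r \<and> r < \<rho> \<longrightarrow> u (z(n := 0)) \<le> circle_mean (\<lambda>z. u (z(n := 0))) z v r"
    using u z cspace_upd0[OF v] unfolding psh_on_def cprod_def by auto
qed

text \<open>Circles in base directions stay in the zero slice, so the submean inequality is
  inherited. Since \<open>psh_on\<close> admits the function -\<infinity>, nothing can go wrong
  here; local integrability is a separate matter.\<close>

lemma psh_on_cprod_slice:
  assumes u: "psh_on (Suc n) (cprod n E T) u" and E: "E \<subseteq> cspace n" and T: "0 \<in> T"
  shows "psh_on n E u"
proof -
  have sub: "E \<subseteq> cprod n E T"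
  proof
    fix z assume z: "z \<in> E"
    then have "z n = 0" using E by (auto simp: cspace_def)
    then have "z(n := 0) = z" by (metis fun_upd_triv)
    then show "z \<in> cprod n E T" using z T E cspace_Suc_mono \<open>z n = 0\<close> by (auto simp: cprod_def)
  qed
  show ?thesis
    unfolding psh_on_def
  proof (intro conjI allI ballI)
    fix a
    have "{z \<in> E. u z < a} = E \<inter> {z \<in> cprod n E T. u z < a}" using sub by auto
    then show "openin (top_of_set E) {z \<in> E. u z < a}"
      using psh_on_upper[OF u, of a] sub unfolding openin_open by auto
  next
    fix z assume "z \<in> E" then show "u z < \<infinity>" using psh_on_less_top[OF u] sub by auto
  next
    fix z v assume "z \<in> E" "v \<in> cspace n"
    then show "\<exists>\<rho>>0. \<forall>r. 0 < r \<and> r < \<rho> \<longrightarrow> u z \<le> circle_mean u z v r"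
      using u sub cspace_Suc_mono[of n] unfolding psh_on_def by blast
  qed
qed

section \<open>Local integrability\<close>

lemma measurable_extend_zero:
  "(\<lambda>x i. if i < n then x i else 0) \<in> borel_measurable (Pi\<^sub>M {..<n::nat} (\<lambda>_. lborel :: complex measure))"
proof (rule measurable_coordinatewise_then_product)
  fix i
  show "(\<lambda>x. if i < n then x i else 0) \<in> borel_measurable (Pi\<^sub>M {..<n} (\<lambda>_. lborel :: complex measure))"
  proof (cases "i < n")
    case True
    have "(\<lambda>x. x i) \<in> measurable (Pi\<^sub>M {..<n} (\<lambda>_. lborel :: complex measure)) lborel"
      using True by (intro measurable_component_singleton) simp
    then show ?thesis using True by simp
  qed simp
qed

lemma nn_integral_lebesgue_cspace:
  assumes [measurable]: "f \<in> borel_measurable borel"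
  shows "(\<integral>\<^sup>+z. f z \<partial>lebesgue_cspace n) =
    (\<integral>\<^sup>+x. f (\<lambda>i. if i < n then x i else 0) \<partial>Pi\<^sub>M {..<n} (\<lambda>_. lborel :: complex measure))"
  unfolding lebesgue_cspace_def nn_integral_completion
  by (rule nn_integral_distr[OF measurable_extend_zero]) simp

text \<open>Tonelli with the last coordinate split off. It is stated for a base factor times a fibre
  factor because the integrands upstairs are bounded by sums of such products.\<close>

lemma nn_integral_lebesgue_cspace_product:
  assumes a[measurable]: "a \<in> borel_measurable borel" and b[measurable]: "b \<in> borel_measurable borel"
  shows "(\<integral>\<^sup>+z. a (z(n := 0)) * b (z n) \<partial>lebesgue_cspace (Suc n)) =
     (\<integral>\<^sup>+z. a z \<partial>lebesgue_cspace n) * (\<integral>\<^sup>+t. b t \<partial>lborel)"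
proof -
  interpret product_sigma_finite "\<lambda>_::nat. lborel :: complex measure" by standard
  let ?P = "\<lambda>n. Pi\<^sub>M {..<n} (\<lambda>_. lborel :: complex measure)"
  let ?e = "\<lambda>n (x :: nat \<Rightarrow> complex) i. if i < n then x i else 0"
  have m: "(\<lambda>z. a (z(n := 0)) * b (z n)) \<in> borel_measurable borel"
    using measurable_compose[OF borel_measurable_continuous_onI[OF continuous_on_upd0[of UNIV n]] a]
      measurable_compose[OF borel_measurable_continuous_onI[OF continuous_on_product_coordinates[of n]] b]
    by simp
  have "(\<integral>\<^sup>+z. a (z(n := 0)) * b (z n) \<partial>lebesgue_cspace (Suc n)) =
      (\<integral>\<^sup>+x. a ((?e (Suc n) x)(n := 0)) * b (?e (Suc n) x n) \<partial>?P (Suc n))"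
    by (rule nn_integral_lebesgue_cspace[OF m])
  also have "\<dots> = (\<integral>\<^sup>+x. \<integral>\<^sup>+t. a ((?e (Suc n) (x(n := t)))(n := 0)) * b (?e (Suc n) (x(n := t)) n) \<partial>lborel \<partial>?P n)"
    unfolding lessThan_Suc
    by (rule product_nn_integral_insert)
       (use measurable_compose[OF measurable_extend_zero[of "Suc n"] m] in \<open>auto simp: lessThan_Suc\<close>)
  also have "\<dots> = (\<integral>\<^sup>+x. \<integral>\<^sup>+t. a (?e n x) * b t \<partial>lborel \<partial>?P n)"
  proof -
    have "(?e (Suc n) (x(n := t)))(n := 0) = ?e n x" for x t by (auto simp: fun_eq_iff)
    then show ?thesis by simp
  qed
  also have "\<dots> = (\<integral>\<^sup>+x. a (?e n x) * (\<integral>\<^sup>+t. b t \<partial>lborel) \<partial>?P n)"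
    by (simp add: nn_integral_cmult)
  also have "\<dots> = (\<integral>\<^sup>+x. a (?e n x) \<partial>?P n) * (\<integral>\<^sup>+t. b t \<partial>lborel)"
    using measurable_compose[OF measurable_extend_zero[of n] a] by (simp add: nn_integral_multc)
  finally show ?thesis by (simp add: nn_integral_lebesgue_cspace)
qed

lemma compact_coord_bound:
  fixes K :: "(nat \<Rightarrow> complex) set"
  assumes "compact K"
  obtains R where "\<And>z. z \<in> K \<Longrightarrow> cmod (z i) \<le> R"
proof -
  have "compact ((\<lambda>z. z i) ` K)"
    by (rule compact_continuous_image[OF continuous_on_subset[OF continuous_on_product_coordinates] assms]) simp
  then show thesis using that compact_imp_bounded bounded_iff by (metis imageI)
qed

text \<open>Each coordinate is bounded on a compact set, so the first \<open>n\<close> coordinates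
  range in a polydisc, whose volume is finite.\<close>

lemma compact_measure_finite:
  assumes K: "compact K"
  shows "(\<integral>\<^sup>+z. indicator K z \<partial>lebesgue_cspace n) < \<infinity>"
proof -
  interpret product_sigma_finite "\<lambda>_::nat. lborel :: complex measure" by standard
  have "\<exists>R. \<forall>z\<in>K. cmod (z i) \<le> R" for i using compact_coord_bound[OF K, of i] by metis
  then obtain R where R: "\<And>i z. z \<in> K \<Longrightarrow> cmod (z i) \<le> R i" by metis
  let ?B = "\<lambda>i. cball 0 (R i) :: complex set"
  have [measurable]: "K \<in> sets borel" using K by (simp add: borel_closed compact_imp_closed)
  have B: "Pi\<^sub>E {..<n} ?B \<in> sets (Pi\<^sub>M {..<n} (\<lambda>_. lborel :: complex measure))"
    by (rule sets_PiM_I_finite) auto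
  have "(\<integral>\<^sup>+z. indicator K z \<partial>lebesgue_cspace n) =
      (\<integral>\<^sup>+x. indicator K (\<lambda>i. if i < n then x i else 0) \<partial>Pi\<^sub>M {..<n} (\<lambda>_. lborel :: complex measure))"
    by (rule nn_integral_lebesgue_cspace) simp
  also have "\<dots> \<le> (\<integral>\<^sup>+x. indicator (Pi\<^sub>E {..<n} ?B) x \<partial>Pi\<^sub>M {..<n} (\<lambda>_. lborel :: complex measure))"
  proof (rule nn_integral_mono)
    fix x :: "nat \<Rightarrow> complex"
    assume x: "x \<in> space (Pi\<^sub>M {..<n} (\<lambda>_. lborel :: complex measure))"
    show "indicator K (\<lambda>i. if i < n then x i else 0) \<le> (indicator (Pi\<^sub>E {..<n} ?B) x :: ennreal)"
    proof (cases "(\<lambda>i. if i < n then x i else 0) \<in> K")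
      case True
      have "cmod (x i) \<le> R i" if "i < n" for i using R[OF True, of i] that by simp
      then have "x \<in> Pi\<^sub>E {..<n} ?B" using x by (auto simp: space_PiM PiE_iff)
      then show ?thesis by (simp add: indicator_def)
    qed simp
  qed
  also have "\<dots> = (\<Prod>i<n. emeasure lborel (?B i))"
    using B by (simp add: emeasure_PiM)
  also have "\<dots> < \<infinity>"
  proof -
    have "emeasure lborel (?B i) \<noteq> top" for i
      using emeasure_bounded_finite[OF bounded_cball[of "0::complex" "R i"]] by simp
    then show ?thesis by (simp add: ennreal_prod_eq_top less_top[symmetric])
  qed
  finally show ?thesis .
qed

text \<open>The layer-cake bound \<open>- ln s \<le> #{k. s \<le> exp (- k)}\<close> avoids polar coordinates.\<close>

lemma log_locally_integrable:
  "(\<integral>\<^sup>+t. e2ennreal \<bar>log_sq t\<bar> * indicator (cball 0 R) t \<partial>lborel) < \<infinity>"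
proof -
  let ?g = "\<lambda>t::complex. \<Sum>k. 2 * indicator (cball 0 (exp (- real k))) t :: ennreal"
  let ?c = "ennreal (2 * \<bar>ln (max 1 R)\<bar>)"
  have le: "e2ennreal \<bar>log_sq t\<bar> * indicator (cball 0 R) t \<le> ?g t + ?c * indicator (cball 0 R) t" for t
  proof (cases "t \<in> cball 0 R")
    case tR: True
    show ?thesis
    proof (cases "t = 0")
      case True
      \<comment> \<open>At the origin the left side is \<infinity>; the bound survives because every
        disc contains 0 and the series diverges.\<close>
      have "?g t = \<infinity>"
      proof (rule ccontr)
        assume n: "\<not> ?thesis"
        have "of_nat m \<le> ?g t" for m
        proof -
          have "(of_nat m :: ennreal) \<le> 2 * of_nat m" by (simp add: mult_2)
          also have "\<dots> = (\<Sum>k<m. 2 * indicator (cball 0 (exp (- real k))) t :: ennreal)" by (simp add: True mult.commute)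
          also have "\<dots> \<le> ?g t" by (rule sum_le_suminf) auto
          finally show ?thesis .
        qed
        then show False using n ennreal_Ex_less_of_nat[of "?g t"] by (auto simp: less_top[symmetric] not_less[symmetric])
      qed
      then show ?thesis by simp
    next
      case t: False
      show ?thesis
      proof (cases "cmod t \<ge> 1")
        case True
        then have "1 \<le> R" "ln (cmod t) \<le> ln R" "0 \<le> ln (cmod t)"
          using tR t ln_le_cancel_iff[of "cmod t" R] by auto
        then have "\<bar>2 * ln (cmod t)\<bar> \<le> 2 * \<bar>ln (max 1 R)\<bar>" by (auto simp: max_def)
        then have "e2ennreal \<bar>log_sq t\<bar> \<le> ?c" using t by (simp add: log_sq_nz e2ennreal_ereal ennreal_leI)
        then show ?thesis using tR by (simp add: add_increasing)
      next
        case False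
        \<comment> \<open>The discs of index \<open>k < m\<close> all contain \<open>t\<close>,
          since k < m means k < - ln |t|, and there are m \<ge> - ln |t| of them. The factor 2 in
          \<open>?g\<close> is the one in log |t|^2 = 2 ln |t|.\<close>
        define m where "m = nat \<lceil>- ln (cmod t)\<rceil>"
        have lneg: "ln (cmod t) < 0" using False t by simp
        have m: "- ln (cmod t) \<le> real m" unfolding m_def by linarith
        have k: "t \<in> cball 0 (exp (- real k))" if "k < m" for k
        proof -
          have "real k \<le> - ln (cmod t)" using that unfolding m_def by linarith
          then have "ln (cmod t) \<le> - real k" by simp
          then have "cmod t \<le> exp (- real k)" using t by (metis exp_le_cancel_iff exp_ln zero_less_norm_iff)
          then show ?thesis by simp
        qed
        have "e2ennreal \<bar>log_sq t\<bar> = ennreal (2 * - ln (cmod t))" using t lneg by (simp add: log_sq_nz e2ennreal_ereal)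
        also have "\<dots> \<le> ennreal (2 * real m)" using m by (intro ennreal_leI) simp
        also have "\<dots> = 2 * of_nat m" by (simp add: ennreal_mult ennreal_of_nat_eq_real_of_nat)
        also have "\<dots> = (\<Sum>k<m. 2 * indicator (cball 0 (exp (- real k))) t :: ennreal)" using k by (simp add: mult.commute)
        also have "\<dots> \<le> ?g t" by (rule sum_le_suminf) auto
        finally show ?thesis using tR by (simp add: add_increasing2)
      qed
    qed
  qed simp
  have meas: "(\<lambda>t::complex. c * indicator (cball 0 r) t) \<in> borel_measurable lborel" for r and c :: ennreal
    by (intro borel_measurable_times_ennreal borel_measurable_const borel_measurable_indicator) simp
  have "(\<integral>\<^sup>+t. e2ennreal \<bar>log_sq t\<bar> * indicator (cball 0 R) t \<partial>lborel) \<le>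
      (\<integral>\<^sup>+t. ?g t + ?c * indicator (cball 0 R) (t::complex) \<partial>lborel)"
    using le by (intro nn_integral_mono) auto
  also have "\<dots> = (\<integral>\<^sup>+t. ?g t \<partial>lborel) + (\<integral>\<^sup>+t. ?c * indicator (cball 0 R) (t::complex) \<partial>lborel)"
    by (intro nn_integral_add borel_measurable_suminf_order meas)
  also have "(\<integral>\<^sup>+t. ?c * indicator (cball 0 R) (t::complex) \<partial>lborel) = ?c * emeasure lborel (cball 0 R :: complex set)"
    by (rule nn_integral_cmult_indicator) simp
  also have "(\<integral>\<^sup>+t. ?g t \<partial>lborel) = (\<Sum>k. \<integral>\<^sup>+t. 2 * indicator (cball 0 (exp (- real k))) t \<partial>(lborel :: complex measure))"
    by (rule nn_integral_suminf[OF meas])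
  \<comment> \<open>The area of the disc of index k is proportional to exp (-2k), so the layers form
    a convergent geometric series.\<close>
  also have "\<dots> = (\<Sum>k. ennreal (2 * (unit_ball_vol 2 * exp (- 2) ^ k)))"
  proof (rule suminf_cong)
    fix k
    have "(\<integral>\<^sup>+t. 2 * indicator (cball 0 (exp (- real k))) t \<partial>(lborel :: complex measure)) =
        2 * emeasure lborel (cball (0::complex) (exp (- real k)))"
      by (rule nn_integral_cmult_indicator) simp
    also have "\<dots> = 2 * ennreal (unit_ball_vol 2 * exp (- real k) ^ 2)"
      by (subst emeasure_cball) auto
    also have "exp (- real k) ^ 2 = exp (- 2) ^ k"
      by (simp flip: exp_of_nat_mult)
    also have "2 * ennreal (unit_ball_vol 2 * exp (- 2) ^ k) = ennreal (2 * (unit_ball_vol 2 * exp (- 2) ^ k))"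
      by (subst (2) ennreal_mult) (auto simp: unit_ball_vol_nonneg)
    finally show "(\<integral>\<^sup>+t. 2 * indicator (cball 0 (exp (- real k))) t \<partial>(lborel :: complex measure)) =
        ennreal (2 * (unit_ball_vol 2 * exp (- 2) ^ k))" .
  qed
  also have "\<dots> = ennreal (\<Sum>k. 2 * (unit_ball_vol 2 * exp (- 2) ^ k))"
    by (rule suminf_ennreal2) (auto intro!: summable_mult summable_geometric)
  also have "\<dots> + ?c * emeasure lborel (cball 0 R :: complex set) < \<infinity>"
    using emeasure_bounded_finite[OF bounded_cball[of "0::complex" R]] by (simp add: ennreal_mult_less_top)
  finally show ?thesis .
qed

lemma usc_borel_measurable:
  fixes u :: "'a::topological_space \<Rightarrow> ereal"
  assumes usc: "\<And>a. openin (top_of_set W) {z \<in> W. u z < a}"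
  shows "u \<in> borel_measurable (restrict_space borel W)"
proof (rule borel_measurableI_less)
  fix a
  obtain T where T: "open T" "{z \<in> W. u z < a} = W \<inter> T" using usc[of a] unfolding openin_open by blast
  then show "{z \<in> space (restrict_space borel W). u z < a} \<in> sets (restrict_space borel W)"
    by (auto simp: space_restrict_space sets_restrict_space)
qed

lemma usc_measurable_indicator:
  assumes usc: "\<And>a. openin (top_of_set W) {z \<in> W. u z < (a::ereal)}"
    and K: "K \<subseteq> W" "K \<in> sets borel"
  shows "(\<lambda>z. e2ennreal \<bar>u z\<bar> * indicator K z) \<in> borel_measurable borel"
proof -
  have "u \<in> borel_measurable (restrict_space borel K)"
    using usc_borel_measurable[OF usc] K(1) by (auto intro: measurable_restrict_mono)
  then have "(\<lambda>z. e2ennreal \<bar>u z\<bar>) \<in> borel_measurable (restrict_space borel K)" by measurable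
  then show ?thesis using K(2) by (subst (asm) borel_measurable_restrict_space_iff_ennreal) auto
qed

text \<open>Upper semicontinuity makes \<open>u\<close> Borel on \<open>W\<close>, hence measurable
  for the completed measure; for psh functions the integral condition is all that remains.\<close>

lemma L1_locI:
  assumes W: "copen n W" and u: "psh_on n W u"
    and int: "\<And>K. compact K \<Longrightarrow> K \<subseteq> W \<Longrightarrow> (\<integral>\<^sup>+z. e2ennreal \<bar>u z\<bar> * indicator K z \<partial>lebesgue_cspace n) < \<infinity>"
  shows "L1_loc n W u"
proof -
  have Wb: "W \<in> sets borel" using copen_borel[OF W] .
  have "(\<lambda>z. u z * indicator W z) \<in> borel_measurable borel"
    using usc_borel_measurable[OF psh_on_upper[OF u]] Wb
    by (subst (asm) borel_measurable_restrict_space_iff_ereal) auto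
  then have "(\<lambda>z. u z * indicator W z) \<in> borel_measurable (lebesgue_cspace n)"
    unfolding lebesgue_cspace_def by (intro measurable_completion) simp
  moreover have "W \<inter> space (lebesgue_cspace n) \<in> sets (lebesgue_cspace n)"
    unfolding lebesgue_cspace_def using Wb by simp
  ultimately have "u \<in> borel_measurable (restrict_space (lebesgue_cspace n) W)"
    by (subst borel_measurable_restrict_space_iff_ereal)
  then show ?thesis using int unfolding L1_loc_def by blast
qed

lemma usc_bounded_above_compact:
  fixes u :: "'a::topological_space \<Rightarrow> ereal"
  assumes usc: "\<And>a. openin (top_of_set W) {z \<in> W. u z < a}" and fin: "\<And>z. z \<in> W \<Longrightarrow> u z < \<infinity>"
    and K: "compact K" "K \<subseteq> W"
  obtains M :: real where "M \<ge> 0" "\<And>z. z \<in> K \<Longrightarrow> u z \<le> ereal M"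
proof -
  let ?C = "(\<lambda>k::nat. {z \<in> K. u z < ereal k}) ` UNIV"
  have op: "openin (top_of_set K) c" if c: "c \<in> ?C" for c
  proof -
    obtain k :: nat where k: "c = {z \<in> K. u z < ereal k}" using c by auto
    have "c = K \<inter> {z \<in> W. u z < ereal k}" using K(2) k by auto
    then show ?thesis using usc[of k] K(2) unfolding openin_open by auto
  qed
  have cov: "K \<subseteq> \<Union>?C"
  proof
    fix z assume z: "z \<in> K"
    then have "u z < \<infinity>" using fin K(2) by blast
    then obtain k :: nat where "u z < ereal k" using less_PInf_Ex_of_nat by auto
    then have "z \<in> {z \<in> K. u z < ereal k}" using z by simp
    then show "z \<in> \<Union>?C" by blast
  qed
  have "\<exists>D\<subseteq>?C. finite D \<and> K \<subseteq> \<Union>D"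
    by (rule K(1)[unfolded compact_eq_openin_cover, THEN spec, THEN mp, OF conjI[OF ballI[OF op] cov]])
  then obtain D where D: "D \<subseteq> ?C" "finite D" "K \<subseteq> \<Union>D" by (elim exE conjE)
  have "\<exists>I\<subseteq>UNIV. finite I \<and> D = (\<lambda>k::nat. {z \<in> K. u z < ereal k}) ` I"
    by (rule finite_subset_image[OF D(2,1)])
  then obtain I :: "nat set" where I: "finite I" "D = (\<lambda>k::nat. {z \<in> K. u z < ereal k}) ` I" by (elim exE conjE)
  \<comment> \<open>The sum of the indices dominates each of them and, unlike a maximum, makes sense
    when \<open>I\<close> is empty, as it can be for empty \<open>K\<close>.\<close>
  have "u z \<le> ereal (\<Sum>k\<in>I. real k)" if z: "z \<in> K" for z
  proof -
    obtain k where k: "k \<in> I" "u z < ereal k" using D(3) z unfolding I(2) by blast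
    have "real k \<le> (\<Sum>k\<in>I. real k)" using I(1) k(1) by (intro member_le_sum) auto
    then show ?thesis using k(2) by (meson ereal_less_eq(3) less_imp_le order_trans)
  qed
  then show thesis using that[of "\<Sum>k\<in>I. real k"] by (auto simp: sum_nonneg)
qed


lemma e2ennreal_abs_add_le: "e2ennreal \<bar>x + y\<bar> \<le> e2ennreal \<bar>x\<bar> + e2ennreal \<bar>y\<bar>"
proof (cases "\<bar>x\<bar> = \<infinity> \<or> \<bar>y\<bar> = \<infinity>")
  case False
  then obtain a b where ab: "x = ereal a" "y = ereal b" by (cases x; cases y) auto
  have "ennreal \<bar>a + b\<bar> \<le> ennreal (\<bar>a\<bar> + \<bar>b\<bar>)" by (intro ennreal_leI) simp
  also have "\<dots> = ennreal \<bar>a\<bar> + ennreal \<bar>b\<bar>" by simp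
  finally show ?thesis using ab by (simp add: e2ennreal_ereal del: ennreal_plus)
qed (auto simp: e2ennreal_infty)

lemma log_sq_mult: "a \<noteq> 0 \<Longrightarrow> log_sq (a * b) = log_sq a + log_sq b"
  by (cases "b = 0") (auto simp: log_sq_0 log_sq_nz norm_mult ln_mult distrib_left)

text \<open>A compact \<open>K\<close> lies in the product of its projection \<open>K'\<close> and a
  disc, and there the modulus of the function is at most |\<psi>| + M + |log |t|^2|, where M bounds
  the modulus of log |g|^2 on \<open>K'\<close>. Each summand lives on the base or on the fibre, so
  Tonelli leaves integrals known to be finite. The hypothesis on \<open>m\<close> is the estimate
  shared by 1, t and 1/t.\<close>

lemma L1_loc_cprod:
  assumes E: "copen n E" and \<psi>: "psh_on n E \<psi>" "L1_loc n E \<psi>" and T: "open T"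
    and g: "continuous_on E g" "\<And>w. w \<in> E \<Longrightarrow> g w \<noteq> 0"
    and m: "\<And>t. t \<in> T \<Longrightarrow> \<bar>log_sq (m t)\<bar> \<le> \<bar>log_sq t\<bar>"
    and psh: "psh_on (Suc n) (cprod n E T) (\<lambda>z. \<psi> (z(n := 0)) + log_sq (g (z(n := 0)) * m (z n)))"
  shows "L1_loc (Suc n) (cprod n E T) (\<lambda>z. \<psi> (z(n := 0)) + log_sq (g (z(n := 0)) * m (z n)))"
proof (rule L1_locI[OF copen_cprod[OF E T] psh])
  fix K assume K: "compact K" "K \<subseteq> cprod n E T"
  define K' where "K' = (\<lambda>z. z(n := 0)) ` K"
  have K': "compact K'" "K' \<subseteq> E" unfolding K'_def
    using compact_continuous_image[OF continuous_on_upd0 K(1)] K(2) by (auto simp: cprod_def)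
  have K'b: "K' \<in> sets borel" using K'(1) by (simp add: borel_closed compact_imp_closed)
  obtain R where R: "\<And>z. z \<in> K \<Longrightarrow> cmod (z n) \<le> R" using compact_coord_bound[OF K(1)] by metis
  have "continuous_on K' (\<lambda>w. 2 * ln (cmod (g w)))"
    using continuous_on_subset[OF g(1) K'(2)] g(2) K'(2) by (intro continuous_intros) auto
  then have "compact ((\<lambda>w. 2 * ln (cmod (g w))) ` K')" using K'(1) by (rule compact_continuous_image)
  then have "bounded ((\<lambda>w. 2 * ln (cmod (g w))) ` K')" by (rule compact_imp_bounded)
  then obtain M where "\<forall>x\<in>(\<lambda>w. 2 * ln (cmod (g w))) ` K'. norm x \<le> M" unfolding bounded_iff ..
  then have M: "\<And>w. w \<in> K' \<Longrightarrow> \<bar>2 * ln (cmod (g w))\<bar> \<le> M" unfolding real_norm_def by (rule bspec) (rule imageI)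
  \<comment> \<open>The base terms go into \<open>a\<close>, paired with the fibre indicator
    \<open>j\<close>; the logarithm of the fibre coordinate goes into \<open>b\<close>, paired with
    the base indicator \<open>i\<close>.\<close>
  define a where "a w = e2ennreal \<bar>\<psi> w\<bar> * indicator K' w + ennreal M * indicator K' w" for w
  define b where "b t = e2ennreal \<bar>log_sq t\<bar> * indicator (cball 0 R) t" for t
  define i where "i = (indicator K' :: _ \<Rightarrow> ennreal)"
  define j where "j = (indicator (cball 0 R) :: complex \<Rightarrow> ennreal)"
  have \<psi>m: "(\<lambda>w. e2ennreal \<bar>\<psi> w\<bar> * indicator K' w) \<in> borel_measurable borel"
    using psh_on_upper[OF \<psi>(1)] K'(2) K'b by (rule usc_measurable_indicator)
  have im: "i \<in> borel_measurable borel" unfolding i_def using K'b by simp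
  have am: "a \<in> borel_measurable borel" unfolding a_def using \<psi>m im[unfolded i_def] by simp
  have bm: "b \<in> borel_measurable borel" unfolding b_def
    by (rule usc_measurable_indicator[of UNIV]) (auto intro: open_log_sq_less)
  have jm: "j \<in> borel_measurable borel" unfolding j_def by (rule borel_measurable_indicator) simp
  let ?u = "\<lambda>z. \<psi> (z(n := 0)) + log_sq (g (z(n := 0)) * m (z n))"
  have le: "e2ennreal \<bar>?u z\<bar> * indicator K z \<le> a (z(n := 0)) * j (z n) + i (z(n := 0)) * b (z n)" for z
  proof (cases "z \<in> K")
    case True
    let ?w = "z(n := 0)"
    have w: "?w \<in> K'" "?w \<in> E" "z n \<in> T" "cmod (z n) \<le> R" using True K(2) R by (auto simp: K'_def cprod_def)
    have "e2ennreal \<bar>?u z\<bar> \<le> e2ennreal \<bar>\<psi> ?w\<bar> + (e2ennreal \<bar>log_sq (g ?w)\<bar> + e2ennreal \<bar>log_sq (m (z n))\<bar>)"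
      unfolding log_sq_mult[OF g(2)[OF w(2)]]
      by (rule order_trans[OF e2ennreal_abs_add_le add_left_mono[OF e2ennreal_abs_add_le]])
    also have "\<dots> \<le> e2ennreal \<bar>\<psi> ?w\<bar> + (ennreal M + e2ennreal \<bar>log_sq (z n)\<bar>)"
      using M[OF w(1)] g(2)[OF w(2)] m[OF w(3)]
      by (intro add_left_mono add_mono e2ennreal_mono) (auto simp: log_sq_nz e2ennreal_ereal ennreal_leI)
    also have "\<dots> = a ?w * j (z n) + i ?w * b (z n)"
      using w by (simp add: a_def b_def i_def j_def add.assoc)
    finally show ?thesis using True by simp
  qed simp
  have pm: "(\<lambda>z. p (z(n := 0)) * q (z n)) \<in> borel_measurable (lebesgue_cspace (Suc n))"
    if "p \<in> borel_measurable borel" "q \<in> borel_measurable borel" for p :: "_ \<Rightarrow> ennreal" and q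
  proof -
    have "(\<lambda>z. p (z(n := 0)) * q (z n)) \<in> borel_measurable borel"
      using measurable_compose[OF borel_measurable_continuous_onI[OF continuous_on_upd0[of UNIV n]] that(1)]
        measurable_compose[OF borel_measurable_continuous_onI[OF continuous_on_product_coordinates[of n]] that(2)]
      by simp
    then show ?thesis unfolding lebesgue_cspace_def by (intro measurable_completion) simp
  qed
  have "(\<integral>\<^sup>+z. e2ennreal \<bar>?u z\<bar> * indicator K z \<partial>lebesgue_cspace (Suc n)) \<le>
      (\<integral>\<^sup>+z. a (z(n := 0)) * j (z n) + i (z(n := 0)) * b (z n) \<partial>lebesgue_cspace (Suc n))"
    using le by (intro nn_integral_mono) auto
  also have "\<dots> = (\<integral>\<^sup>+z. a (z(n := 0)) * j (z n) \<partial>lebesgue_cspace (Suc n)) +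
      (\<integral>\<^sup>+z. i (z(n := 0)) * b (z n) \<partial>lebesgue_cspace (Suc n))"
    by (rule nn_integral_add[OF pm[OF am jm] pm[OF im bm]])
  also have "\<dots> = (\<integral>\<^sup>+w. a w \<partial>lebesgue_cspace n) * (\<integral>\<^sup>+t. j t \<partial>lborel) +
      (\<integral>\<^sup>+w. i w \<partial>lebesgue_cspace n) * (\<integral>\<^sup>+t. b t \<partial>lborel)"
    using am bm im jm by (simp only: nn_integral_lebesgue_cspace_product)
  also have "\<dots> < \<infinity>"
  proof -
    have i: "(\<integral>\<^sup>+w. i w \<partial>lebesgue_cspace n) < \<infinity>" unfolding i_def by (rule compact_measure_finite[OF K'(1)])
    have toL: "f \<in> borel_measurable (lebesgue_cspace n)" if "f \<in> borel_measurable borel" for f :: "_ \<Rightarrow> ennreal"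
      using that unfolding lebesgue_cspace_def by (intro measurable_completion) simp
    have "(\<integral>\<^sup>+w. a w \<partial>lebesgue_cspace n) = (\<integral>\<^sup>+w. e2ennreal \<bar>\<psi> w\<bar> * indicator K' w \<partial>lebesgue_cspace n)
        + ennreal M * (\<integral>\<^sup>+w. i w \<partial>lebesgue_cspace n)"
      unfolding a_def i_def using toL[OF \<psi>m] toL[OF im[unfolded i_def]]
      by (simp only: nn_integral_add nn_integral_cmult borel_measurable_times_ennreal borel_measurable_const)
    also have "\<dots> < \<infinity>"
      using \<psi>(2) K' i unfolding L1_loc_def by (simp add: ennreal_mult_less_top)
    finally have a: "(\<integral>\<^sup>+w. a w \<partial>lebesgue_cspace n) < \<infinity>" .
    have j: "(\<integral>\<^sup>+t. j t \<partial>lborel) < \<infinity>"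
      unfolding j_def using emeasure_bounded_finite[OF bounded_cball[of "0::complex" R]] by simp
    have b: "(\<integral>\<^sup>+t. b t \<partial>lborel) < \<infinity>"
      unfolding b_def by (rule log_locally_integrable)
    show ?thesis using a b i j by (simp add: ennreal_mult_less_top)
  qed
  finally show "(\<integral>\<^sup>+z. e2ennreal \<bar>?u z\<bar> * indicator K z \<partial>lebesgue_cspace (Suc n)) < \<infinity>" .
qed

text \<open>On a compact set semicontinuity bounds \<phi> above by some M, and \<psi> - C bounds it
  below, so |\<phi>| \<le> |\<psi>| + |C| + M. This is how a comparison function keeps a psh
  function from being identically -\<infinity>.\<close>

lemma L1_loc_lower_bound:
  assumes E: "copen n E" and \<phi>: "psh_on n E \<phi>" and \<psi>: "psh_on n E \<psi>" "L1_loc n E \<psi>"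
    and le: "\<And>z. z \<in> E \<Longrightarrow> \<psi> z \<le> \<phi> z + ereal C"
  shows "L1_loc n E \<phi>"
proof (rule L1_locI[OF E \<phi>])
  fix K assume K: "compact K" "K \<subseteq> E"
  have Kb: "K \<in> sets borel" using K(1) by (simp add: borel_closed compact_imp_closed)
  obtain M where M: "M \<ge> 0" "\<And>z. z \<in> K \<Longrightarrow> \<phi> z \<le> ereal M"
    using usc_bounded_above_compact[OF psh_on_upper[OF \<phi>] psh_on_less_top[OF \<phi>] K] by metis
  let ?c = "ennreal (\<bar>C\<bar> + M)"
  have *: "e2ennreal \<bar>\<phi> z\<bar> * indicator K z \<le> e2ennreal \<bar>\<psi> z\<bar> * indicator K z + ?c * indicator K z" for z
  proof (cases "z \<in> K")
    case True
    then have z: "\<phi> z \<le> ereal M" "\<psi> z \<le> \<phi> z + ereal C" using M le K by auto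
    have "\<bar>\<phi> z\<bar> \<le> \<bar>\<psi> z\<bar> + ereal (\<bar>C\<bar> + M)" using z M(1) by (cases "\<phi> z"; cases "\<psi> z") auto
    also have "\<dots> = \<bar>\<bar>\<psi> z\<bar> + ereal (\<bar>C\<bar> + M)\<bar>" using M(1) by (cases "\<psi> z") auto
    finally have "e2ennreal \<bar>\<phi> z\<bar> \<le> e2ennreal \<bar>\<bar>\<psi> z\<bar> + ereal (\<bar>C\<bar> + M)\<bar>" by (rule e2ennreal_mono)
    also have "\<dots> \<le> e2ennreal \<bar>\<psi> z\<bar> + ?c"
      using e2ennreal_abs_add_le[of "\<bar>\<psi> z\<bar>" "ereal (\<bar>C\<bar> + M)"] M(1) by (simp add: e2ennreal_ereal del: ennreal_plus)
    finally show ?thesis using True by simp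
  qed simp
  have toL: "f \<in> borel_measurable (lebesgue_cspace n)" if "f \<in> borel_measurable borel" for f :: "_ \<Rightarrow> ennreal"
    using that unfolding lebesgue_cspace_def by (intro measurable_completion) simp
  have m: "(\<lambda>z. e2ennreal \<bar>\<psi> z\<bar> * indicator K z) \<in> borel_measurable (lebesgue_cspace n)"
    using psh_on_upper[OF \<psi>(1)] K(2) Kb by (intro toL usc_measurable_indicator)
  have i: "(indicator K :: _ \<Rightarrow> ennreal) \<in> borel_measurable (lebesgue_cspace n)" using Kb by (intro toL) simp
  have "(\<integral>\<^sup>+z. e2ennreal \<bar>\<phi> z\<bar> * indicator K z \<partial>lebesgue_cspace n) \<le>
     (\<integral>\<^sup>+z. e2ennreal \<bar>\<psi> z\<bar> * indicator K z + ?c * indicator K z \<partial>lebesgue_cspace n)"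
    using * by (intro nn_integral_mono) auto
  also have "\<dots> = (\<integral>\<^sup>+z. e2ennreal \<bar>\<psi> z\<bar> * indicator K z \<partial>lebesgue_cspace n) + ?c * (\<integral>\<^sup>+z. indicator K z \<partial>lebesgue_cspace n)"
    using m i by (simp only: nn_integral_add nn_integral_cmult borel_measurable_times_ennreal borel_measurable_const)
  also have "\<dots> < \<infinity>"
    using \<psi>(2) K compact_measure_finite[OF K(1), of n] unfolding L1_loc_def by (simp add: ennreal_mult_less_top)
  finally show "(\<integral>\<^sup>+z. e2ennreal \<bar>\<phi> z\<bar> * indicator K z \<partial>lebesgue_cspace n) < \<infinity>" .
qed

text \<open>\<open>psh_on_add_log_sq\<close> asks for continuity and for holomorphy on complex
  lines. Both are checked on the two factors separately, so joint complex differentiability of the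
  product does not come up.\<close>

lemma psh_on_cprod_log:
  assumes E: "copen n E" and \<psi>: "psh_on n E \<psi>" and T: "open T"
    and g: "holo_on n E g" and m: "m holomorphic_on T"
  shows "psh_on (Suc n) (cprod n E T) (\<lambda>z. \<psi> (z(n := 0)) + log_sq (g (z(n := 0)) * m (z n)))"
proof (rule psh_on_add_log_sq[OF copen_cprod[OF E T] psh_on_cprod_pullback[OF \<psi>]])
  have "continuous_on (cprod n E T) (\<lambda>z. g (z(n := 0)))"
    by (rule continuous_on_compose2[OF holo_on_continuous[OF copen_subset[OF E] g] continuous_on_upd0])
       (auto simp: cprod_def)
  moreover have "continuous_on (cprod n E T) (\<lambda>z. m (z n))"
    by (rule continuous_on_compose2[OF holomorphic_on_imp_continuous_on[OF m]
        continuous_on_subset[OF continuous_on_product_coordinates]]) (auto simp: cprod_def)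
  ultimately show "continuous_on (cprod n E T) (\<lambda>z. g (z(n := 0)) * m (z n))"
    by (rule continuous_on_mult)
next
  fix z v B assume v: "v \<in> cspace (Suc n)" and B: "\<And>s. s \<in> B \<Longrightarrow> (\<lambda>i. z i + s * v i) \<in> cprod n E T"
  have upd: "(\<lambda>i. z i + s * v i)(n := 0) = (\<lambda>i. (z(n := 0)) i + s * (v(n := 0)) i)" for s by auto
  have "(\<lambda>s. g (\<lambda>i. (z(n := 0)) i + s * (v(n := 0)) i)) holomorphic_on B"
    by (rule holo_on_line[OF g cspace_upd0[OF v]]) (use B upd in \<open>auto simp: cprod_def\<close>)
  moreover have "(\<lambda>s. m (z n + s * v n)) holomorphic_on B"
  proof -
    have "(\<lambda>s. z n + s * v n) holomorphic_on B" by (intro holomorphic_intros)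
    moreover have "(\<lambda>s. z n + s * v n) ` B \<subseteq> T" using B by (auto simp: cprod_def)
    ultimately show ?thesis using holomorphic_on_compose_gen[OF _ m, of _ B] by (simp add: o_def)
  qed
  ultimately show "(\<lambda>s. g ((\<lambda>i. z i + s * v i)(n := 0)) * m (z n + s * v n)) holomorphic_on B"
    unfolding upd by (rule holomorphic_on_mult)
qed

lemma psh_on_subset:
  assumes u: "psh_on n W u" and sub: "W' \<subseteq> W"
  shows "psh_on n W' u"
  unfolding psh_on_def
proof (intro conjI allI ballI)
  fix a
  have "{z \<in> W'. u z < a} = W' \<inter> {z \<in> W. u z < a}" using sub by auto
  then show "openin (top_of_set W') {z \<in> W'. u z < a}"
    using psh_on_upper[OF u, of a] sub unfolding openin_open by auto
qed (use u sub in \<open>auto simp: psh_on_def\<close>)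

lemma L1_loc_subset: "L1_loc n W u \<Longrightarrow> W' \<subseteq> W \<Longrightarrow> L1_loc n W' u"
  unfolding L1_loc_def by (meson measurable_restrict_mono order_trans)

lemma holo_on_subset: "holo_on n W f \<Longrightarrow> W' \<subseteq> W \<Longrightarrow> holo_on n W' f"
  unfolding holo_on_def by blast

section \<open>Charts, trivializations and the tautological line\<close>

lemma chart_facts:
  assumes "complex_manifold X" "(D, c) \<in> charts X"
  shows "inj_on c D" "copen (cdim X) (c ` D)" "c ` D \<subseteq> cspace (cdim X)" "D \<subseteq> points X"
proof -
  show "inj_on c D" and *: "copen (cdim X) (c ` D)" and "D \<subseteq> points X"
    using assms unfolding complex_manifold_def by blast+
  show "c ` D \<subseteq> cspace (cdim X)" using copen_subset[OF *] .
qed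

lemma copen_Int: "copen n W \<Longrightarrow> copen n W' \<Longrightarrow> copen n (W \<inter> W')"
  unfolding copen_def by (rule openin_Int)

text \<open>\<open>mtop\<close> is generated by the sets open in some chart, so the proof is an
  induction on the generation of \<open>U\<close>. The content is in the generators: a set open in
  another chart is the preimage of an open set under the continuous coordinate change.\<close>

lemma copen_chart_image:
  assumes X: "complex_manifold X" and c: "(D, c) \<in> charts X" and U: "openin (mtop X) U"
  shows "copen (cdim X) (c ` (U \<inter> D))"
proof -
  let ?n = "cdim X"
  note inj = chart_facts(1)[OF X c]
  have "generate_topology_on {U. \<exists>(D, c)\<in>charts X. U \<subseteq> D \<and> copen ?n (c ` U)} U"
    using U unfolding mtop_def by (rule openin_topology_generated_by)
  then show ?thesis
  proof induction
    case Empty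
    then show ?case by (simp add: copen_def)
  next
    case (Int a b)
    have "c ` (a \<inter> b \<inter> D) = c ` (a \<inter> D) \<inter> c ` (b \<inter> D)"
      using inj by (auto simp: inj_on_def)
    then show ?case using copen_Int[OF Int.IH] by simp
  next
    case (UN K)
    have "c ` (\<Union>K \<inter> D) = (\<Union>k\<in>K. c ` (k \<inter> D))" by auto
    then show ?case using UN unfolding copen_def by (auto intro: openin_Union)
  next
    case (Basis s)
    then obtain D0 c0 where c0: "(D0, c0) \<in> charts X" and s: "s \<subseteq> D0" "copen ?n (c0 ` s)" by blast
    let ?S = "c ` (D \<inter> D0)" and ?f = "\<lambda>z. c0 (inv_into D c z)"
    have S: "copen ?n ?S" and h: "\<And>i. i < ?n \<Longrightarrow> holo_on ?n ?S (\<lambda>z. ?f z i)"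
      using X c c0 unfolding complex_manifold_def by blast+
    have inv: "inv_into D c (c x) = x" if "x \<in> D" for x using inv_into_f_f[OF inj that] .
    \<comment> \<open>Holomorphy is given for the components below \<open>?n\<close>; the others
      vanish because chart values lie in \<open>cspace\<close>.\<close>
    have "continuous_on ?S (\<lambda>z. ?f z i)" for i
    proof (cases "i < ?n")
      case True
      then show ?thesis using holo_on_continuous[OF copen_subset[OF S] h] by blast
    next
      case False
      have "?f z i = 0" if "z \<in> ?S" for z
        using that inv chart_facts(3)[OF X c0] False by (auto simp: cspace_def)
      then show ?thesis by (simp cong: continuous_on_cong)
    qed
    then have cont: "continuous_on ?S ?f" by (rule continuous_on_coordinatewise_then_product)
    obtain T where T: "open T" "c0 ` s = cspace ?n \<inter> T" using s(2) copen_iff by blast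
    have "c ` (s \<inter> D) = ?S \<inter> ?f -` T"
    proof (intro set_eqI iffI)
      fix z assume "z \<in> c ` (s \<inter> D)"
      then obtain x where x: "x \<in> s" "x \<in> D" "z = c x" by blast
      have "c0 x \<in> T" using T(2) x(1) by blast
      then show "z \<in> ?S \<inter> ?f -` T" using x s(1) inv by auto
    next
      fix z assume "z \<in> ?S \<inter> ?f -` T"
      then obtain x where x: "x \<in> D" "x \<in> D0" "z = c x" "c0 x \<in> T" using inv by auto
      then have "c0 x \<in> c0 ` s" using T(2) chart_facts(3)[OF X c0] by blast
      then have "x \<in> s" using chart_facts(1)[OF X c0] x(2) s(1) by (auto simp: inj_on_def)
      then show "z \<in> c ` (s \<inter> D)" using x by blast
    qed
    moreover have "openin (top_of_set ?S) (?S \<inter> ?f -` T)"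
      by (rule continuous_openin_preimage_gen[OF cont T(1)])
    ultimately show ?case using S unfolding copen_def by (metis openin_trans)
  qed
qed

section \<open>Generators of lines and fibre coordinates of line bundles\<close>

lemma cline_self: "\<xi> \<in> cline \<xi>"
  unfolding cline_def by (rule image_eqI[of _ _ 1]) auto

lemma cline_scale:
  assumes "c \<noteq> 0"
  shows "cline (\<lambda>i. c * \<xi> i) = cline \<xi>"
proof
  show "cline (\<lambda>i. c * \<xi> i) \<subseteq> cline \<xi>"
    unfolding cline_def by (auto simp: mult.assoc[symmetric])
  show "cline \<xi> \<subseteq> cline (\<lambda>i. c * \<xi> i)"
  proof
    fix \<zeta> assume "\<zeta> \<in> cline \<xi>"
    then obtain k where "\<zeta> = (\<lambda>i. k * \<xi> i)" unfolding cline_def by blast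
    then have "\<zeta> = (\<lambda>i. (k / c) * (c * \<xi> i))" using assms by simp
    then show "\<zeta> \<in> cline (\<lambda>i. c * \<xi> i)" unfolding cline_def by blast
  qed
qed

lemma normalized_cline:
  assumes "\<xi> p \<noteq> 0"
  shows "normalized (cline \<xi>) p = (\<lambda>i. \<xi> i / \<xi> p)"
  unfolding normalized_def
proof (rule the_equality)
  show "(\<lambda>i. \<xi> i / \<xi> p) \<in> cline \<xi> \<and> \<xi> p / \<xi> p = 1"
    using assms unfolding cline_def by (auto intro: image_eqI[of _ _ "1 / \<xi> p"])
  fix v assume "v \<in> cline \<xi> \<and> v p = 1"
  then show "v = (\<lambda>i. \<xi> i / \<xi> p)" using assms unfolding cline_def by (auto simp: field_simps)
qed

lemma normalized_in:
  assumes "\<zeta> \<in> cline \<xi>" "\<zeta> p \<noteq> 0"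
  shows "normalized (cline \<xi>) p \<in> cline \<xi>" "normalized (cline \<xi>) p p = 1"
    "cline (normalized (cline \<xi>) p) = cline \<xi>"
proof -
  have p: "\<xi> p \<noteq> 0" using assms unfolding cline_def by auto
  show "normalized (cline \<xi>) p p = 1" unfolding normalized_cline[of \<xi> p, OF p] using p by simp
  show *: "cline (normalized (cline \<xi>) p) = cline \<xi>"
    unfolding normalized_cline[of \<xi> p, OF p] using cline_scale[of "1 / \<xi> p" \<xi>] p by simp
  show "normalized (cline \<xi>) p \<in> cline \<xi>" using cline_self[of "normalized (cline \<xi>) p"] unfolding * .
qed

lemma triv_facts:
  assumes L: "holomorphic_line_bundle X L" and t: "(V, \<tau>) \<in> lb_trivs L"
  shows triv_open: "openin (mtop X) V" and triv_sub: "V \<subseteq> points X"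
    and triv_zero: "\<And>x. x \<in> V \<Longrightarrow> \<tau> (lb_zero L x) = 0"
    and triv_scale: "\<And>x e a. x \<in> V \<Longrightarrow> e \<in> fibre L x \<Longrightarrow> \<tau> (lb_scale L a e) = a * \<tau> e"
    and triv_inj: "\<And>x e e'. x \<in> V \<Longrightarrow> e \<in> fibre L x \<Longrightarrow> e' \<in> fibre L x \<Longrightarrow> \<tau> e = \<tau> e' \<Longrightarrow> e = e'"
    and frame_fibre: "\<And>x. x \<in> V \<Longrightarrow> frame L \<tau> x \<in> fibre L x"
    and triv_frame: "\<And>x. x \<in> V \<Longrightarrow> \<tau> (frame L \<tau> x) = 1"
proof -
  have 1: "openin (mtop X) V \<and> (\<forall>x\<in>V. bij_betw \<tau> (fibre L x) UNIV \<and> \<tau> (lb_zero L x) = 0 \<and>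
           (\<forall>e\<in>fibre L x. (\<forall>a. \<tau> (lb_scale L a e) = a * \<tau> e)))"
    using L t unfolding holomorphic_line_bundle_def by fast
  show "openin (mtop X) V" using 1 by blast
  have "(\<Union>(U, \<theta>)\<in>lb_trivs L. U) = points X"
    using L unfolding holomorphic_line_bundle_def by (elim conjE)
  then show "V \<subseteq> points X" using t by auto
  have "\<And>x. x \<in> V \<Longrightarrow> bij_betw \<tau> (fibre L x) UNIV" using 1 by blast
  moreover show "\<And>x. x \<in> V \<Longrightarrow> \<tau> (lb_zero L x) = 0"
     "\<And>x e a. x \<in> V \<Longrightarrow> e \<in> fibre L x \<Longrightarrow> \<tau> (lb_scale L a e) = a * \<tau> e" using 1 by blast+
  ultimately show "\<And>x e e'. x \<in> V \<Longrightarrow> e \<in> fibre L x \<Longrightarrow> e' \<in> fibre L x \<Longrightarrow> \<tau> e = \<tau> e' \<Longrightarrow> e = e'"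
    by (meson bij_betw_def inj_onD)
  show "\<And>x. x \<in> V \<Longrightarrow> frame L \<tau> x \<in> fibre L x" "\<And>x. x \<in> V \<Longrightarrow> \<tau> (frame L \<tau> x) = 1"
    using 1 inv_into_into[of 1 \<tau> "fibre L _"] f_inv_into_f[of 1 \<tau> "fibre L _"]
    unfolding frame_def bij_betw_def by auto
qed

lemma zero_fibre: "holomorphic_line_bundle X L \<Longrightarrow> x \<in> points X \<Longrightarrow> lb_zero L x \<in> fibre L x"
  and scale_fibre: "holomorphic_line_bundle X L \<Longrightarrow> x \<in> points X \<Longrightarrow> e \<in> fibre L x \<Longrightarrow> lb_scale L a e \<in> fibre L x"
  unfolding holomorphic_line_bundle_def by auto

text \<open>\<open>holomorphic_line_bundle\<close> does not list the vector space axioms of a fibre;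
  they are read off through an injective fibre coordinate.\<close>

lemma scale_zero:
  assumes "holomorphic_line_bundle X L" "x \<in> points X"
  shows "lb_scale L a (lb_zero L x) = lb_zero L x"
proof -
  obtain V \<tau> where t: "(V, \<tau>) \<in> lb_trivs L" "x \<in> V" using triv_at[OF assms] .
  note z = zero_fibre[OF assms]
  show ?thesis
    by (rule triv_inj[OF assms(1) t scale_fibre[OF assms z] z])
       (simp add: triv_scale[OF assms(1) t z] triv_zero[OF assms(1) t])
qed

lemma triv_transition:
  assumes "holomorphic_line_bundle X L" "(U, \<theta>) \<in> lb_trivs L" "(U', \<theta>') \<in> lb_trivs L"
  obtains g where "holo_fun X (U \<inter> U') g" "\<And>x. x \<in> U \<inter> U' \<Longrightarrow> g x \<noteq> 0"
    "\<And>x e. x \<in> U \<inter> U' \<Longrightarrow> e \<in> fibre L x \<Longrightarrow> \<theta>' e = g x * \<theta> e"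
proof -
  have "\<forall>(U, \<theta>)\<in>lb_trivs L. \<forall>(U', \<theta>')\<in>lb_trivs L. \<exists>g. holo_fun X (U \<inter> U') g \<and>
        (\<forall>x\<in>U \<inter> U'. g x \<noteq> 0 \<and> (\<forall>e\<in>fibre L x. \<theta>' e = g x * \<theta> e))"
    using assms(1) unfolding holomorphic_line_bundle_def by (elim conjE)
  from bspec[OF bspec[OF this assms(2), unfolded prod.case] assms(3), unfolded prod.case]
  obtain g where g: "holo_fun X (U \<inter> U') g" "\<forall>x\<in>U \<inter> U'. g x \<noteq> 0 \<and> (\<forall>e\<in>fibre L x. \<theta>' e = g x * \<theta> e)"
    by (elim exE conjE)
  show thesis by (rule that[OF g(1)]) (use g(2) in simp_all)
qed

text \<open>\<alpha> and \<beta> are coordinates with respect to the frame dual to the two local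
  frames. The value 0 outside the fibre, as in \<open>dual_sum\<close>, makes equality of
  functionals an equality of functions.\<close>

definition dual_vec ::
  "('p, 'a) line_bundle \<Rightarrow> ('p, 'b) line_bundle \<Rightarrow> ('a \<Rightarrow> complex) \<Rightarrow> ('b \<Rightarrow> complex) \<Rightarrow> 'p \<Rightarrow>
    complex \<Rightarrow> complex \<Rightarrow> 'a \<times> 'b \<Rightarrow> complex" where
  "dual_vec A L \<theta> \<tau> x \<alpha> \<beta> = (\<lambda>(a, b). if a \<in> fibre A x \<and> b \<in> fibre L x then \<alpha> * \<theta> a + \<beta> * \<tau> b else 0)"

lemma dual_vec_scale: "dual_vec A L \<theta> \<tau> x (k * \<alpha>) (k * \<beta>) = (\<lambda>p. k * dual_vec A L \<theta> \<tau> x \<alpha> \<beta> p)"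
  by (auto simp: dual_vec_def fun_eq_iff algebra_simps)

locale bundle_pair =
  fixes X :: "'p cmanifold" and A :: "('p, 'a) line_bundle" and L :: "('p, 'b) line_bundle"
  assumes X: "complex_manifold X" and A: "holomorphic_line_bundle X A" and L: "holomorphic_line_bundle X L"
begin

lemma dual_vec_A:
  assumes "(U, \<theta>) \<in> lb_trivs A" "(V, \<tau>) \<in> lb_trivs L" "x \<in> U" "x \<in> V" "a \<in> fibre A x"
  shows "dual_vec A L \<theta> \<tau> x \<alpha> \<beta> (a, lb_zero L x) = \<alpha> * \<theta> a"
  using assms zero_fibre[OF L] triv_sub[OF L assms(2)] triv_zero[OF L assms(2)] by (auto simp: dual_vec_def)

lemma dual_vec_L:
  assumes "(U, \<theta>) \<in> lb_trivs A" "(V, \<tau>) \<in> lb_trivs L" "x \<in> U" "x \<in> V" "b \<in> fibre L x"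
  shows "dual_vec A L \<theta> \<tau> x \<alpha> \<beta> (lb_zero A x, b) = \<beta> * \<tau> b"
  using assms zero_fibre[OF A] triv_sub[OF A assms(1)] triv_zero[OF A assms(1)] by (auto simp: dual_vec_def)

lemma pb_points_coords:
  assumes t: "(U, \<theta>) \<in> lb_trivs A" "(V, \<tau>) \<in> lb_trivs L" "x \<in> U" "x \<in> V"
  shows "(x, l) \<in> pb_points X A L \<longleftrightarrow>
    (\<exists>\<alpha> \<beta>. (\<alpha> \<noteq> 0 \<or> \<beta> \<noteq> 0) \<and> l = cline (dual_vec A L \<theta> \<tau> x \<alpha> \<beta>))"
proof -
  have x: "x \<in> points X" using triv_sub[OF A t(1)] t(3) by blast
  note D = dual_sum_coords[OF A L x t(1,3) t(2,4), folded dual_vec_def]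
  have nz: "dual_vec A L \<theta> \<tau> x \<alpha> \<beta> \<noteq> (\<lambda>_. 0) \<longleftrightarrow> \<alpha> \<noteq> 0 \<or> \<beta> \<noteq> 0" for \<alpha> \<beta>
  proof
    assume "\<alpha> \<noteq> 0 \<or> \<beta> \<noteq> 0"
    moreover have "dual_vec A L \<theta> \<tau> x \<alpha> \<beta> (frame_A A L \<theta> x) = \<alpha>" "dual_vec A L \<theta> \<tau> x \<alpha> \<beta> (frame_L A L \<tau> x) = \<beta>"
      using dual_vec_A[OF t frame_fibre[OF A t(1,3)]] dual_vec_L[OF t frame_fibre[OF L t(2,4)]]
        triv_frame[OF A t(1,3)] triv_frame[OF L t(2,4)]
      by (auto simp: frame_A_def frame_L_def)
    ultimately show "dual_vec A L \<theta> \<tau> x \<alpha> \<beta> \<noteq> (\<lambda>_. 0)" by metis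
  qed (auto simp: dual_vec_def fun_eq_iff split: if_splits)
  show ?thesis unfolding pb_points_def using x D nz by (auto 4 4)
qed

text \<open>A section \<open>p\<close> of the direct sum evaluates functionals and so induces a
  section of O(1). On its affine piece this is the frame: it is 1 on the normalized generator, and a
  functional on a line is determined by that value. A general \<open>p\<close> serves both affine
  pieces.\<close>

lemma frame_O1:
  assumes "(x, l) \<in> pb_affine X A L S p"
  shows "frame (O1 X A L) (\<lambda>((x, l), u). u (normalized l (p x))) (x, l) =
    ((x, l), \<lambda>\<xi>. if \<xi> \<in> l then \<xi> (p x) else 0)"
proof -
  obtain \<xi>1 where l: "l = cline \<xi>1" and pt: "(x, l) \<in> pb_points X A L"
    using assms unfolding pb_affine_def pb_points_def by auto
  obtain \<zeta> where "\<zeta> \<in> l" "\<zeta> (p x) \<noteq> 0" using assms unfolding pb_affine_def by auto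
  then have n: "normalized l (p x) \<in> l" "normalized l (p x) (p x) = 1" "cline (normalized l (p x)) = l"
    using normalized_in[of \<zeta> \<xi>1 "p x"] unfolding l by auto
  let ?u = "\<lambda>\<xi>. if \<xi> \<in> l then \<xi> (p x) else 0"
  let ?\<Theta> = "\<lambda>((x, l), u). u (normalized l (p x)) :: complex"
  have add: "(\<lambda>q. \<xi> q + \<xi>' q) \<in> l" if m: "\<xi> \<in> l" "\<xi>' \<in> l" for \<xi> \<xi>'
  proof -
    obtain k k' where "\<xi> = (\<lambda>i. k * \<xi>1 i)" "\<xi>' = (\<lambda>i. k' * \<xi>1 i)" using m unfolding l cline_def by blast
    then have "(\<lambda>p. \<xi> p + \<xi>' p) = (\<lambda>i. (k + k') * \<xi>1 i)" by (simp add: distrib_right)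
    then show ?thesis unfolding l cline_def by blast
  qed
  have sc: "(\<lambda>q. a * \<xi> q) \<in> l" if m: "\<xi> \<in> l" for \<xi> a
  proof -
    obtain k where "\<xi> = (\<lambda>i. k * \<xi>1 i)" using m unfolding l cline_def by blast
    then have "(\<lambda>p. a * \<xi> p) = (\<lambda>i. (a * k) * \<xi>1 i)" by (simp add: mult.assoc)
    then show ?thesis unfolding l cline_def by blast
  qed
  have mem: "((x, l), ?u) \<in> fibre (O1 X A L) (x, l)"
    using pt add sc unfolding fibre_def O1_def by simp
  have val: "?\<Theta> ((x, l), ?u) = 1" using n by simp
  have inj: "w = ((x, l), ?u)" if w: "w \<in> fibre (O1 X A L) (x, l)" "?\<Theta> w = 1" for w
  proof -
    obtain u where u: "w = ((x, l), u)" "\<And>\<xi>. \<xi> \<notin> l \<Longrightarrow> u \<xi> = 0" "\<And>\<xi> a. \<xi> \<in> l \<Longrightarrow> u (\<lambda>p. a * \<xi> p) = a * u \<xi>"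
      using w(1) unfolding fibre_def O1_def by auto
    have u1: "u (normalized l (p x)) = 1" using w(2) u(1) by simp
    have "u \<xi> = ?u \<xi>" for \<xi>
    proof (cases "\<xi> \<in> l")
      case True
      then obtain k where k: "\<xi> = (\<lambda>i. k * normalized l (p x) i)" using n(3) unfolding cline_def by blast
      have "u \<xi> = k" unfolding k u(3)[OF n(1)] u1 by simp
      moreover have "\<xi> (p x) = k" unfolding k n(2) by simp
      ultimately show ?thesis using True by simp
    qed (use u(2) in simp)
    then show ?thesis using u(1) by auto
  qed
  have im: "1 \<in> ?\<Theta> ` fibre (O1 X A L) (x, l)" using mem val by (metis (no_types, lifting) image_eqI)
  show ?thesis unfolding frame_def
    by (rule inj[OF inv_into_into[OF im] f_inv_into_f[OF im]])
qed

end

section \<open>The quotient metric\<close>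

text \<open>A vector e of L acts on the tautological line by \<open>\<xi> \<mapsto> \<xi> (0, e)\<close>, and the length of a functional is
  the length of the vector inducing it.  Along the divisor \<open>P(A)\<close> this action is 0, so that a nonzero
  functional gets the infimum over the empty set, which is \<open>\<infinity>\<close>.\<close>

definition quotient_metric ::
  "('p, 'a) line_bundle \<Rightarrow> ('p, 'b) line_bundle \<Rightarrow> ('b \<Rightarrow> ennreal) \<Rightarrow>
    ('p, 'a, 'b) pb_point \<times> (('a \<times> 'b \<Rightarrow> complex) \<Rightarrow> complex) \<Rightarrow> ennreal" where
  "quotient_metric A L h = (\<lambda>((x, l), u). INF e\<in>{e \<in> fibre L x. \<forall>\<xi>\<in>l. u \<xi> = \<xi> (lb_zero A x, e)}. h e)"

lemma elog_scale:
  assumes "r > 0"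
  shows "- elog (ennreal r * m) = - elog m + ereal (- ln r)"
proof (cases m)
  case (real k)
  then show ?thesis using assms
    by (cases "k = 0") (auto simp: elog_def ennreal_mult[symmetric] ln_mult)
next
  case top
  then have "ennreal r * m = \<infinity>" using assms by (simp add: ennreal_mult_top)
  then show ?thesis using top by (simp add: elog_def)
qed

context bundle_pair
begin

text \<open>Evaluation at \<open>p\<close> is induced by the vectors e with \<beta> * \<tau> e = w.
  For \<beta> \<noteq> 0 the only one is w / \<beta> times the frame, and homogeneity turns its
  length into the term log |\<beta> / w|^2.\<close>

lemma quotient_metric_frame:
  assumes t: "(U, \<theta>) \<in> lb_trivs A" "(V, \<tau>) \<in> lb_trivs L" "x \<in> U" "x \<in> V"
    and p: "dual_vec A L \<theta> \<tau> x \<alpha> \<beta> p = w" and w: "w \<noteq> 0"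
    and h: "\<And>e a. e \<in> lb_total L \<Longrightarrow> h (lb_scale L a e) = ennreal ((cmod a)\<^sup>2) * h e"
    and fin: "weight L h \<tau> x < \<infinity>"
  defines "l \<equiv> cline (dual_vec A L \<theta> \<tau> x \<alpha> \<beta>)"
  shows "- elog (quotient_metric A L h ((x, l), \<lambda>\<xi>. if \<xi> \<in> l then \<xi> p else 0)) =
    weight L h \<tau> x + log_sq (\<beta> / w)"
proof -
  let ?\<xi> = "dual_vec A L \<theta> \<tau> x \<alpha> \<beta>"
  have x: "x \<in> points X" using triv_sub[OF A t(1)] t(3) by blast
  have iff: "(\<forall>\<xi>\<in>l. (if \<xi> \<in> l then \<xi> p else 0) = \<xi> (lb_zero A x, e)) \<longleftrightarrow> w = \<beta> * \<tau> e" if e: "e \<in> fibre L x" for e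
  proof
    assume "\<forall>\<xi>\<in>l. (if \<xi> \<in> l then \<xi> p else 0) = \<xi> (lb_zero A x, e)"
    then have "?\<xi> p = ?\<xi> (lb_zero A x, e)" using cline_self[of ?\<xi>] unfolding l_def by auto
    then show "w = \<beta> * \<tau> e" using p dual_vec_L[OF t e] by simp
  next
    assume "w = \<beta> * \<tau> e"
    then have "?\<xi> p = ?\<xi> (lb_zero A x, e)" using p dual_vec_L[OF t e] by simp
    then show "\<forall>\<xi>\<in>l. (if \<xi> \<in> l then \<xi> p else 0) = \<xi> (lb_zero A x, e)" unfolding l_def cline_def by auto
  qed
  have Q: "quotient_metric A L h ((x, l), \<lambda>\<xi>. if \<xi> \<in> l then \<xi> p else 0) = (INF e\<in>{e \<in> fibre L x. w = \<beta> * \<tau> e}. h e)"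
    unfolding quotient_metric_def using iff by (auto intro!: arg_cong[where f=Inf])
  show ?thesis
  proof (cases "\<beta> = 0")
    case True
    then have "{e \<in> fibre L x. w = \<beta> * \<tau> e} = {}" using w by auto
    \<comment> \<open>Over P(A) both sides are -\<infinity>; on the right this uses that the weight
      of L is below \<infinity>, as \<infinity> + (-\<infinity>) is \<infinity> in
      \<open>ereal\<close>.\<close>
    then show ?thesis unfolding Q using fin True by (cases "weight L h \<tau> x") (auto simp: elog_def log_sq_0)
  next
    case False
    let ?f = "frame L \<tau> x" and ?k = "w / \<beta>"
    note f = frame_fibre[OF L t(2,4)]
    have "{e \<in> fibre L x. w = \<beta> * \<tau> e} = {lb_scale L ?k ?f}"
    proof (intro set_eqI iffI)
      fix e assume "e \<in> {e \<in> fibre L x. w = \<beta> * \<tau> e}"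
      then have e: "e \<in> fibre L x" "w = \<beta> * \<tau> e" by auto
      have "e = lb_scale L ?k ?f"
        using triv_scale[OF L t(2,4) f] triv_frame[OF L t(2,4)] e False
        by (intro triv_inj[OF L t(2,4) e(1) scale_fibre[OF L x f]]) simp
      then show "e \<in> {lb_scale L ?k ?f}" by simp
    next
      fix e assume "e \<in> {lb_scale L ?k ?f}"
      then show "e \<in> {e \<in> fibre L x. w = \<beta> * \<tau> e}"
        using triv_scale[OF L t(2,4) f] triv_frame[OF L t(2,4)] scale_fibre[OF L x f] False by simp
    qed
    then have "quotient_metric A L h ((x, l), \<lambda>\<xi>. if \<xi> \<in> l then \<xi> p else 0) = h (lb_scale L ?k ?f)" unfolding Q by simp
    also have "\<dots> = ennreal ((cmod ?k)\<^sup>2) * h ?f" using f by (intro h) (simp add: fibre_def)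
    finally have "- elog (quotient_metric A L h ((x, l), \<lambda>\<xi>. if \<xi> \<in> l then \<xi> p else 0)) =
       weight L h \<tau> x + ereal (- ln ((cmod ?k)\<^sup>2))"
      using elog_scale[of "(cmod ?k)\<^sup>2" "h ?f"] w False by (simp add: weight_def)
    also have "ereal (- ln ((cmod ?k)\<^sup>2)) = log_sq (\<beta> / w)"
      using w False by (simp add: log_sq_nz ln_realpow norm_divide ln_div)
    finally show ?thesis .
  qed
qed

end

lemma L1_loc_cong:
  assumes u: "L1_loc n W u" and eq: "\<And>z. z \<in> W \<Longrightarrow> u z = u' z"
  shows "L1_loc n W u'"
proof -
  have "u' \<in> borel_measurable (restrict_space (lebesgue_cspace n) W)"
    using u eq unfolding L1_loc_def
    by (subst measurable_cong[of _ u' u]) (auto simp: space_restrict_space)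
  moreover have "(\<integral>\<^sup>+z. e2ennreal \<bar>u' z\<bar> * indicator K z \<partial>lebesgue_cspace n) =
     (\<integral>\<^sup>+z. e2ennreal \<bar>u z\<bar> * indicator K z \<partial>lebesgue_cspace n)" if "K \<subseteq> W" for K
    using that eq by (intro nn_integral_cong) (auto simp: indicator_def)
  ultimately show ?thesis using u unfolding L1_loc_def by simp
qed

section \<open>Charts fibred over charts of the base, and weights in them\<close>

lemma chart_upd:
  assumes "c x \<in> cspace n"
  shows "((c x)(n := t))(n := 0) = c x"
proof -
  have "c x n = 0" using assms by (simp add: cspace_def)
  then show ?thesis by (metis fun_upd_triv fun_upd_upd)
qed

text \<open>Treats both kinds of bundle chart at once. \<open>P x t\<close> is the point over
  \<open>x\<close> with fibre coordinate \<open>t\<close>; the domain \<open>Q\<close> of a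
  trivialization is, in these parameters, a condition on \<open>x\<close> and one on
  \<open>t\<close>, hence its chart image is a product.\<close>

lemma fibred_chart:
  assumes inj: "inj_on c D" and cD: "c ` D \<subseteq> cspace n" and S: "S \<subseteq> D"
    and Dom: "Dom = {P x t | x t. x \<in> S}" and ch: "\<And>x t. x \<in> S \<Longrightarrow> ch (P x t) = (c x)(n := t)"
  shows fibred_chart_inv: "\<And>x t. x \<in> S \<Longrightarrow> inv_into Dom ch ((c x)(n := t)) = P x t"
    and fibred_chart_image: "\<And>Q S' T. (\<And>x t. x \<in> S \<Longrightarrow> P x t \<in> Q \<longleftrightarrow> x \<in> S' \<and> t \<in> T) \<Longrightarrow>
       ch ` (Q \<inter> Dom) = cprod n (c ` (S \<inter> S')) T"
proof -
  have cs: "c x \<in> cspace n" if "x \<in> S" for x using that cD S by blast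
  have inj': "x = x' \<and> t = t'" if xx: "x \<in> S" "x' \<in> S" and eq: "(c x)(n := t) = (c x')(n := t')" for x x' t t'
  proof -
    have "c x = c x'" using arg_cong[OF eq, of "\<lambda>z. z(n := 0)"] chart_upd[where c = c and n = n] cs xx by metis
    then have "x = x'" using inj S xx by (meson inj_onD subsetD)
    moreover have "t = t'" using fun_cong[OF eq, of n] by simp
    ultimately show ?thesis by blast
  qed
  have inj_ch: "inj_on ch Dom"
  proof (rule inj_onI)
    fix q q' assume "q \<in> Dom" "q' \<in> Dom" and eq: "ch q = ch q'"
    then obtain x t x' t' where q: "q = P x t" "x \<in> S" "q' = P x' t'" "x' \<in> S" unfolding Dom by blast
    then have "(c x)(n := t) = (c x')(n := t')" using eq ch by simp
    then show "q = q'" using inj' q by blast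
  qed
  show "inv_into Dom ch ((c x)(n := t)) = P x t" if "x \<in> S" for x t
    by (rule inv_into_f_eq[OF inj_ch]) (use that ch Dom in auto)
  show "ch ` (Q \<inter> Dom) = cprod n (c ` (S \<inter> S')) T"
    if Q: "\<And>x t. x \<in> S \<Longrightarrow> P x t \<in> Q \<longleftrightarrow> x \<in> S' \<and> t \<in> T" for Q S' T
  proof (intro set_eqI iffI)
    fix z assume "z \<in> ch ` (Q \<inter> Dom)"
    then obtain x t where x: "x \<in> S" "P x t \<in> Q" "z = ch (P x t)" unfolding Dom by blast
    have z: "z = (c x)(n := t)" using x ch by simp
    have "z \<in> cspace (Suc n)" using cs[OF x(1)] unfolding z by (auto simp: cspace_def)
    moreover have "z(n := 0) = c x" unfolding z using chart_upd[where c = c] cs[OF x(1)] by blast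
    ultimately show "z \<in> cprod n (c ` (S \<inter> S')) T" using x(1,2) Q[of x t] z unfolding cprod_def by auto
  next
    fix z assume z: "z \<in> cprod n (c ` (S \<inter> S')) T"
    then obtain x where x: "x \<in> S" "x \<in> S'" "z(n := 0) = c x" unfolding cprod_def by auto
    have "z = (z(n := 0))(n := z n)" by simp
    then have "z = ch (P x (z n))" using x ch by metis
    moreover have "P x (z n) \<in> Q \<inter> Dom" using x Q z unfolding Dom cprod_def by auto
    ultimately show "z \<in> ch ` (Q \<inter> Dom)" by blast
  qed
qed

lemma psh_metric_psh_on: "psh_metric X L h \<Longrightarrow> (D, c) \<in> charts X \<Longrightarrow> (V, \<tau>) \<in> lb_trivs L \<Longrightarrow>
    psh_on (cdim X) (c ` (V \<inter> D)) (\<lambda>z. weight L h \<tau> (inv_into D c z))"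
  unfolding psh_metric_def psh_fun_def by fast

lemma psh_metric_L1: "psh_metric X L h \<Longrightarrow> (D, c) \<in> charts X \<Longrightarrow> (V, \<tau>) \<in> lb_trivs L \<Longrightarrow>
    L1_loc (cdim X) (c ` (V \<inter> D)) (\<lambda>z. weight L h \<tau> (inv_into D c z))"
  unfolding psh_metric_def singular_metric_def L1_loc_fun_def by fast

lemma psh_metric_homogeneous: "psh_metric X L h \<Longrightarrow> e \<in> lb_total L \<Longrightarrow>
    h (lb_scale L a e) = ennreal ((cmod a)\<^sup>2) * h e"
  unfolding psh_metric_def singular_metric_def by blast

lemma chart_at:
  assumes "complex_manifold X" "x \<in> points X"
  obtains D c where "(D, c) \<in> charts X" "x \<in> D"
proof -
  have "(\<Union>(D, c)\<in>charts X. D) = points X"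
    using assms(1) unfolding complex_manifold_def by (elim conjE)
  then show thesis using assms(2) that by auto
qed

context bundle_pair
begin

lemma weight_less_top:
  assumes h: "psh_metric X L h" and t: "(V, \<tau>) \<in> lb_trivs L" "x \<in> V"
  shows "weight L h \<tau> x < \<infinity>"
proof -
  obtain D c where c: "(D, c) \<in> charts X" "x \<in> D" using chart_at[OF X] triv_sub[OF L t(1)] t(2) by blast
  have "weight L h \<tau> (inv_into D c (c x)) < \<infinity>"
    by (rule psh_on_less_top[OF psh_metric_psh_on[OF h c(1) t(1)]]) (use c t in blast)
  then show ?thesis using inv_into_f_f[OF chart_facts(1)[OF X c(1)] c(2)] by simp
qed

text \<open>Here P parametrizes the domain of a chart \<open>ch\<close> of the bundle lying over the chart c of X.  In every
  chart and trivialization of \<open>O(1)\<close> the weight of the quotient metric has the form assumed for u, with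
  m one of 1, t and 1/t, and g a transition function of A or L.\<close>

lemma fibred_weight:
  assumes h: "psh_metric X L h" and c: "(D, c) \<in> charts X" and t: "(V, \<tau>) \<in> lb_trivs L"
    and S: "S \<subseteq> D" and Dom: "Dom = {P x t | x t. x \<in> S}"
    and ch: "\<And>x t. x \<in> S \<Longrightarrow> ch (P x t) = (c x)(cdim X := t)"
    and Q: "\<And>x t. x \<in> S \<Longrightarrow> P x t \<in> Q \<longleftrightarrow> x \<in> S' \<and> t \<in> T"
    and open_S: "copen (cdim X) (c ` (S \<inter> S'))" and V: "S \<inter> S' \<subseteq> V"
    and g: "holo_on (cdim X) (c ` (S \<inter> S')) (\<lambda>z. g (inv_into D c z))" "\<And>x. x \<in> S \<inter> S' \<Longrightarrow> g x \<noteq> 0"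
    and T: "open T" "m holomorphic_on T" "\<And>t. t \<in> T \<Longrightarrow> \<bar>log_sq (m t)\<bar> \<le> \<bar>log_sq t\<bar>"
    and u: "\<And>x t. x \<in> S \<inter> S' \<Longrightarrow> t \<in> T \<Longrightarrow> u (P x t) = weight L h \<tau> x + log_sq (g x * m t)"
  shows "psh_on (Suc (cdim X)) (ch ` (Q \<inter> Dom)) (\<lambda>z. u (inv_into Dom ch z)) \<and>
    L1_loc (Suc (cdim X)) (ch ` (Q \<inter> Dom)) (\<lambda>z. u (inv_into Dom ch z))"
proof -
  let ?n = "cdim X" and ?E = "c ` (S \<inter> S')"
  let ?\<psi> = "\<lambda>z. weight L h \<tau> (inv_into D c z)" and ?g = "\<lambda>z. g (inv_into D c z)"
  note cf = chart_facts[OF X c]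
  note inv = fibred_chart_inv[OF cf(1,3) S Dom ch]
  have im: "ch ` (Q \<inter> Dom) = cprod ?n ?E T" by (rule fibred_chart_image[OF cf(1,3) S Dom ch Q])
  have sub: "?E \<subseteq> c ` (V \<inter> D)" using V S by blast
  have \<psi>: "psh_on ?n ?E ?\<psi>" "L1_loc ?n ?E ?\<psi>"
    using psh_on_subset[OF psh_metric_psh_on[OF h c t] sub] L1_loc_subset[OF psh_metric_L1[OF h c t] sub] by auto
  let ?u = "\<lambda>z. ?\<psi> (z(?n := 0)) + log_sq (?g (z(?n := 0)) * m (z ?n))"
  have p: "psh_on (Suc ?n) (cprod ?n ?E T) ?u"
    by (rule psh_on_cprod_log[OF open_S \<psi>(1) T(1) g(1) T(2)])
  have gnz: "?g w \<noteq> 0" if "w \<in> ?E" for w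
    using that g(2) S inv_into_f_f[OF cf(1)] by auto
  have l: "L1_loc (Suc ?n) (cprod ?n ?E T) ?u"
    by (rule L1_loc_cprod[OF open_S \<psi> T(1) holo_on_continuous[OF copen_subset[OF open_S] g(1)] gnz T(3) p])
  have eq: "?u z = u (inv_into Dom ch z)" if z: "z \<in> cprod ?n ?E T" for z
  proof -
    obtain x where x: "x \<in> S \<inter> S'" "z(?n := 0) = c x" and zT: "z ?n \<in> T" using z unfolding cprod_def by auto
    have "z = (z(?n := 0))(?n := z ?n)" by simp
    then have "z = (c x)(?n := z ?n)" using x(2) by simp
    then have "inv_into Dom ch z = P x (z ?n)" using inv[of x "z ?n"] x(1) by simp
    moreover have "inv_into D c (c x) = x" using inv_into_f_f[OF cf(1)] x(1) S by blast
    ultimately show ?thesis using u[OF x(1) zT] x(2) by simp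
  qed
  show ?thesis unfolding im
    using psh_on_cong[OF copen_cprod[OF open_S T(1)] p eq] L1_loc_cong[OF l eq] by blast
qed

lemma pb_affine_cline:
  "(x, cline \<xi>) \<in> pb_affine X A L S p \<longleftrightarrow> (x, cline \<xi>) \<in> pb_points X A L \<and> x \<in> S \<and> \<xi> (p x) \<noteq> 0"
proof -
  have "(\<exists>\<zeta>\<in>cline \<xi>. \<zeta> (p x) \<noteq> 0) \<longleftrightarrow> \<xi> (p x) \<noteq> 0"
    using cline_self[of \<xi>] unfolding cline_def by auto
  then show ?thesis unfolding pb_affine_def by simp
qed

lemma dual_vec_frame:
  assumes t: "(U, \<theta>) \<in> lb_trivs A" "(V, \<tau>) \<in> lb_trivs L" "x \<in> U" "x \<in> V"
  shows "(U', \<theta>') \<in> lb_trivs A \<Longrightarrow> x \<in> U' \<Longrightarrow>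
      dual_vec A L \<theta> \<tau> x \<alpha> \<beta> (frame_A A L \<theta>' x) = \<alpha> * \<theta> (frame A \<theta>' x)"
    and "(V', \<tau>') \<in> lb_trivs L \<Longrightarrow> x \<in> V' \<Longrightarrow>
      dual_vec A L \<theta> \<tau> x \<alpha> \<beta> (frame_L A L \<tau>' x) = \<beta> * \<tau> (frame L \<tau>' x)"
  using dual_vec_A[OF t] dual_vec_L[OF t] frame_fibre[OF A] frame_fibre[OF L]
  by (auto simp: frame_A_def frame_L_def)

lemma dual_vec_own_frame:
  assumes t: "(U, \<theta>) \<in> lb_trivs A" "(V, \<tau>) \<in> lb_trivs L" "x \<in> U" "x \<in> V"
  shows "dual_vec A L \<theta> \<tau> x \<alpha> \<beta> (frame_A A L \<theta> x) = \<alpha>"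
    and "dual_vec A L \<theta> \<tau> x \<alpha> \<beta> (frame_L A L \<tau> x) = \<beta>"
  using dual_vec_frame[OF t] t triv_frame[OF A t(1,3)] triv_frame[OF L t(2,4)] by auto

text \<open>Dividing a generator by its nonzero coordinate \<beta> leaves the representative with
  coordinates (s, 1); s is the fibre coordinate of the chart.\<close>

lemma pb_affine_L_param:
  assumes t: "(U, \<theta>) \<in> lb_trivs A" "(V, \<tau>) \<in> lb_trivs L"
  shows "pb_affine X A L (D \<inter> U \<inter> V) (frame_L A L \<tau>) =
    {(x, cline (dual_vec A L \<theta> \<tau> x s 1)) | x s. x \<in> D \<inter> U \<inter> V}"
proof (intro set_eqI iffI)
  fix q assume q: "q \<in> pb_affine X A L (D \<inter> U \<inter> V) (frame_L A L \<tau>)"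
  obtain x l where xl: "q = (x, l)" by (cases q)
  then have x: "x \<in> D" "x \<in> U" "x \<in> V" using q by (auto simp: pb_affine_def)
  have "(x, l) \<in> pb_points X A L" using q unfolding xl pb_affine_def by simp
  then obtain \<alpha> \<beta> where l: "l = cline (dual_vec A L \<theta> \<tau> x \<alpha> \<beta>)" using pb_points_coords[OF t x(2,3)] by blast
  have \<beta>: "\<beta> \<noteq> 0" using q dual_vec_own_frame[OF t x(2,3)] unfolding xl l pb_affine_cline by simp
  have "l = cline (dual_vec A L \<theta> \<tau> x (\<alpha> / \<beta>) 1)"
    using cline_scale[OF \<beta>, of "dual_vec A L \<theta> \<tau> x (\<alpha> / \<beta>) 1"] dual_vec_scale[of A L \<theta> \<tau> x \<beta> "\<alpha> / \<beta>" 1] \<beta> l by simp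
  then show "q \<in> {(x, cline (dual_vec A L \<theta> \<tau> x s 1)) | x s. x \<in> D \<inter> U \<inter> V}" using x xl by blast
next
  fix q assume "q \<in> {(x, cline (dual_vec A L \<theta> \<tau> x s 1)) | x s. x \<in> D \<inter> U \<inter> V}"
  then obtain x s where q: "q = (x, cline (dual_vec A L \<theta> \<tau> x s 1))" "x \<in> D \<inter> U \<inter> V" by blast
  then show "q \<in> pb_affine X A L (D \<inter> U \<inter> V) (frame_L A L \<tau>)"
    using dual_vec_own_frame[OF t, of x] pb_points_coords[OF t, of x] unfolding q(1) pb_affine_cline
    by (metis Int_iff one_neq_zero)
qed

lemma pb_affine_A_param:
  assumes t: "(U, \<theta>) \<in> lb_trivs A" "(V, \<tau>) \<in> lb_trivs L"
  shows "pb_affine X A L (D \<inter> U \<inter> V) (frame_A A L \<theta>) =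
    {(x, cline (dual_vec A L \<theta> \<tau> x 1 s)) | x s. x \<in> D \<inter> U \<inter> V}"
proof (intro set_eqI iffI)
  fix q assume q: "q \<in> pb_affine X A L (D \<inter> U \<inter> V) (frame_A A L \<theta>)"
  obtain x l where xl: "q = (x, l)" by (cases q)
  then have x: "x \<in> D" "x \<in> U" "x \<in> V" using q by (auto simp: pb_affine_def)
  have "(x, l) \<in> pb_points X A L" using q unfolding xl pb_affine_def by simp
  then obtain \<alpha> \<beta> where l: "l = cline (dual_vec A L \<theta> \<tau> x \<alpha> \<beta>)" using pb_points_coords[OF t x(2,3)] by blast
  have \<alpha>: "\<alpha> \<noteq> 0" using q dual_vec_own_frame[OF t x(2,3)] unfolding xl l pb_affine_cline by simp
  have "l = cline (dual_vec A L \<theta> \<tau> x 1 (\<beta> / \<alpha>))"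
    using cline_scale[OF \<alpha>, of "dual_vec A L \<theta> \<tau> x 1 (\<beta> / \<alpha>)"] dual_vec_scale[of A L \<theta> \<tau> x \<alpha> 1 "\<beta> / \<alpha>"] \<alpha> l by simp
  then show "q \<in> {(x, cline (dual_vec A L \<theta> \<tau> x 1 s)) | x s. x \<in> D \<inter> U \<inter> V}" using x xl by blast
next
  fix q assume "q \<in> {(x, cline (dual_vec A L \<theta> \<tau> x 1 s)) | x s. x \<in> D \<inter> U \<inter> V}"
  then obtain x s where q: "q = (x, cline (dual_vec A L \<theta> \<tau> x 1 s))" "x \<in> D \<inter> U \<inter> V" by blast
  then show "q \<in> pb_affine X A L (D \<inter> U \<inter> V) (frame_A A L \<theta>)"
    using dual_vec_own_frame[OF t, of x] pb_points_coords[OF t, of x] unfolding q(1) pb_affine_cline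
    by (metis Int_iff one_neq_zero)
qed

lemma weight_quotient_metric:
  assumes t: "(U, \<theta>) \<in> lb_trivs A" "(V, \<tau>) \<in> lb_trivs L" "x \<in> U" "x \<in> V"
    and h: "psh_metric X L h"
    and q: "(x, cline (dual_vec A L \<theta> \<tau> x \<alpha> \<beta>)) \<in> pb_affine X A L S p"
  shows "weight (O1 X A L) (quotient_metric A L h) (\<lambda>((x, l), u). u (normalized l (p x)))
      (x, cline (dual_vec A L \<theta> \<tau> x \<alpha> \<beta>)) =
    weight L h \<tau> x + log_sq (\<beta> / dual_vec A L \<theta> \<tau> x \<alpha> \<beta> (p x))"
  unfolding weight_def[of "O1 X A L"] frame_O1[OF q]
  by (rule quotient_metric_frame[OF t refl _ psh_metric_homogeneous[OF h] weight_less_top[OF h t(2,4)]])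
     (use q in \<open>auto simp: pb_affine_cline\<close>)

lemma chart_fun_cases:
  assumes "(D', ch) \<in> charts (proj_bundle X A L)"
  obtains D c U \<theta> V \<tau> where "(D, c) \<in> charts X" "(U, \<theta>) \<in> lb_trivs A" "(V, \<tau>) \<in> lb_trivs L"
      "D' = pb_affine X A L (D \<inter> U \<inter> V) (frame_L A L \<tau>)"
      "ch = (\<lambda>(x, l). (c x)(cdim X := normalized l (frame_L A L \<tau> x) (frame_A A L \<theta> x)))"
    | D c U \<theta> V \<tau> where "(D, c) \<in> charts X" "(U, \<theta>) \<in> lb_trivs A" "(V, \<tau>) \<in> lb_trivs L"
      "D' = pb_affine X A L (D \<inter> U \<inter> V) (frame_A A L \<theta>)"
      "ch = (\<lambda>(x, l). (c x)(cdim X := normalized l (frame_A A L \<theta> x) (frame_L A L \<tau> x)))"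
  using assms unfolding proj_bundle_def by auto

lemma triv_O1_cases:
  assumes "(Q, \<Theta>) \<in> lb_trivs (O1 X A L)"
  obtains U \<theta> V \<tau> where "(U, \<theta>) \<in> lb_trivs A" "(V, \<tau>) \<in> lb_trivs L"
      "Q = pb_affine X A L (U \<inter> V) (frame_L A L \<tau>)" "\<Theta> = (\<lambda>((x, l), u). u (normalized l (frame_L A L \<tau> x)))"
    | U \<theta> V \<tau> where "(U, \<theta>) \<in> lb_trivs A" "(V, \<tau>) \<in> lb_trivs L"
      "Q = pb_affine X A L (U \<inter> V) (frame_A A L \<theta>)" "\<Theta> = (\<lambda>((x, l), u). u (normalized l (frame_A A L \<theta> x)))"
  using assms unfolding O1_def by auto

lemma chart_set_open:
  assumes c: "(D, c) \<in> charts X" and t: "(U, \<theta>) \<in> lb_trivs A" "(V, \<tau>) \<in> lb_trivs L"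
    "(U', \<theta>') \<in> lb_trivs A" "(V', \<tau>') \<in> lb_trivs L"
  shows "copen (cdim X) (c ` (D \<inter> U \<inter> V \<inter> (U' \<inter> V')))"
proof -
  have "openin (mtop X) (U \<inter> V \<inter> (U' \<inter> V'))"
    using t by (intro openin_Int triv_open[OF A] triv_open[OF L])
  from copen_chart_image[OF X c this] show ?thesis
    by (simp add: Int_ac)
qed

text \<open>Frames transform inversely to fibre coordinates. The values of \<theta> on the other
  frame enter the weight of the quotient metric as a denominator, so that \<open>g\<close> itself
  appears there.\<close>

lemma transition_frame:
  assumes B: "holomorphic_line_bundle X B" and t: "(U, \<theta>) \<in> lb_trivs B" "(U', \<theta>') \<in> lb_trivs B"
    and c: "(D, c) \<in> charts X" and S: "S \<subseteq> U \<inter> U' \<inter> D"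
  obtains g where "holo_on (cdim X) (c ` S) (\<lambda>z. g (inv_into D c z))" "\<And>x. x \<in> U \<inter> U' \<Longrightarrow> g x \<noteq> 0"
    "\<And>x. x \<in> U \<inter> U' \<Longrightarrow> \<theta> (frame B \<theta>' x) = inverse (g x)"
proof -
  obtain g where g: "holo_fun X (U \<inter> U') g" "\<And>x. x \<in> U \<inter> U' \<Longrightarrow> g x \<noteq> 0"
    "\<And>x e. x \<in> U \<inter> U' \<Longrightarrow> e \<in> fibre B x \<Longrightarrow> \<theta>' e = g x * \<theta> e" using triv_transition[OF B t] by blast
  have "holo_on (cdim X) (c ` (U \<inter> U' \<inter> D)) (\<lambda>z. g (inv_into D c z))"
    using g(1) c unfolding holo_fun_def by fast
  then have 1: "holo_on (cdim X) (c ` S) (\<lambda>z. g (inv_into D c z))"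
    by (rule holo_on_subset) (use S in blast)
  have "\<theta> (frame B \<theta>' x) = inverse (g x)" if "x \<in> U \<inter> U'" for x
  proof -
    have "1 = g x * \<theta> (frame B \<theta>' x)"
      using g(3)[OF that frame_fibre[OF B t(2)]] triv_frame[OF B t(2)] that by auto
    then show ?thesis using g(2)[OF that] by (metis inverse_unique)
  qed
  then show thesis using that 1 g(2) by blast
qed

text \<open>Let \<xi> be the generator chosen by the chart and p the frame chosen by the
  trivialization; the logarithm is taken of \<beta> / \<xi> (p x). In an L-chart \<xi> has
  coordinates (s, 1), and the quotient is g for an L-trivialization and g / s for an
  A-trivialization. In an A-chart they are (1, s), and the quotient is g for an L-trivialization and
  g * s for an A-trivialization. The condition s \<noteq> 0 is imposed exactly in the mixed
  pairings; s = 0 in the last pairing is P(A), where the weight is -\<infinity>.\<close>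

lemma quotient_metric_psh_L1:
  assumes h: "psh_metric X L h" and T: "(Q, \<Theta>) \<in> lb_trivs (O1 X A L)"
    and C: "(Dom, ch) \<in> charts (proj_bundle X A L)"
  defines "u \<equiv> weight (O1 X A L) (quotient_metric A L h) \<Theta>"
  shows "psh_on (Suc (cdim X)) (ch ` (Q \<inter> Dom)) (\<lambda>z. u (inv_into Dom ch z)) \<and>
    L1_loc (Suc (cdim X)) (ch ` (Q \<inter> Dom)) (\<lambda>z. u (inv_into Dom ch z))"
proof -
  have log1: "\<bar>log_sq 1\<bar> \<le> x" if "x \<ge> 0" for x :: ereal using that by (simp add: log_sq_nz zero_ereal_def[symmetric])
  have loginv: "\<bar>log_sq (inverse t)\<bar> \<le> \<bar>log_sq t\<bar>" if "t \<noteq> 0" for t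
    using that by (simp add: log_sq_nz norm_inverse ln_inverse)
  show ?thesis
  proof (rule chart_fun_cases[OF C])
    fix D c U \<theta> V \<tau>
    assume c: "(D, c) \<in> charts X" and t: "(U, \<theta>) \<in> lb_trivs A" "(V, \<tau>) \<in> lb_trivs L"
      and Dom: "Dom = pb_affine X A L (D \<inter> U \<inter> V) (frame_L A L \<tau>)"
      and ch: "ch = (\<lambda>(x, l). (c x)(cdim X := normalized l (frame_L A L \<tau> x) (frame_A A L \<theta> x)))"
    let ?P = "\<lambda>x s. (x, cline (dual_vec A L \<theta> \<tau> x s 1))" and ?S = "D \<inter> U \<inter> V"
    have P: "?P x s \<in> pb_points X A L" if "x \<in> ?S" for x s
      using pb_points_coords[OF t, of x] that by (metis Int_iff one_neq_zero)
    have chP: "ch (?P x s) = (c x)(cdim X := s)" if "x \<in> ?S" for x s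
      using dual_vec_own_frame[OF t, of x s 1] that unfolding ch by (simp add: normalized_cline)
    note W = fibred_weight[OF h c t(2) _ Dom[unfolded pb_affine_L_param[OF t]] chP]
    show ?thesis
    proof (rule triv_O1_cases[OF T])
      fix U' \<theta>' V' \<tau>'
      assume t': "(U', \<theta>') \<in> lb_trivs A" "(V', \<tau>') \<in> lb_trivs L"
        and Q: "Q = pb_affine X A L (U' \<inter> V') (frame_L A L \<tau>')"
        and \<Theta>: "\<Theta> = (\<lambda>((x, l), u). u (normalized l (frame_L A L \<tau>' x)))"
      let ?S' = "U' \<inter> V'"
      obtain g where g: "holo_on (cdim X) (c ` (?S \<inter> ?S')) (\<lambda>z. g (inv_into D c z))"
        "\<And>x. x \<in> V \<inter> V' \<Longrightarrow> g x \<noteq> 0" "\<And>x. x \<in> V \<inter> V' \<Longrightarrow> \<tau> (frame L \<tau>' x) = inverse (g x)"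
        using transition_frame[OF L t(2) t'(2) c, of "?S \<inter> ?S'"] by blast
      have val: "dual_vec A L \<theta> \<tau> x s 1 (frame_L A L \<tau>' x) = inverse (g x)" if "x \<in> ?S \<inter> ?S'" for x s
        using dual_vec_frame(2)[OF t _ _ t'(2)] g(3) that by auto
      have mem: "?P x s \<in> Q \<longleftrightarrow> x \<in> ?S' \<and> s \<in> UNIV" if "x \<in> ?S" for x s
        using P[OF that] that val g(2) unfolding Q pb_affine_cline by auto
      show ?thesis
      proof (rule W[OF _ _ mem chart_set_open[OF c t t'] _ g(1)])
        show "u (?P x s) = weight L h \<tau> x + log_sq (g x * 1)" if "x \<in> ?S \<inter> ?S'" for x s
        proof -
          have "?P x s \<in> pb_affine X A L (U' \<inter> V') (frame_L A L \<tau>')" using mem that unfolding Q by blast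
          from weight_quotient_metric[OF t _ _ h this] show ?thesis
            using that val unfolding u_def \<Theta> by (auto simp: divide_inverse)
        qed
      qed (use g(2) log1 in auto)
    next
      fix U' \<theta>' V' \<tau>'
      assume t': "(U', \<theta>') \<in> lb_trivs A" "(V', \<tau>') \<in> lb_trivs L"
        and Q: "Q = pb_affine X A L (U' \<inter> V') (frame_A A L \<theta>')"
        and \<Theta>: "\<Theta> = (\<lambda>((x, l), u). u (normalized l (frame_A A L \<theta>' x)))"
      let ?S' = "U' \<inter> V'"
      obtain g where g: "holo_on (cdim X) (c ` (?S \<inter> ?S')) (\<lambda>z. g (inv_into D c z))"
        "\<And>x. x \<in> U \<inter> U' \<Longrightarrow> g x \<noteq> 0" "\<And>x. x \<in> U \<inter> U' \<Longrightarrow> \<theta> (frame A \<theta>' x) = inverse (g x)"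
        using transition_frame[OF A t(1) t'(1) c, of "?S \<inter> ?S'"] by blast
      have val: "dual_vec A L \<theta> \<tau> x s 1 (frame_A A L \<theta>' x) = s * inverse (g x)" if "x \<in> ?S \<inter> ?S'" for x s
        using dual_vec_frame(1)[OF t _ _ t'(1)] g(3) that by auto
      have mem: "?P x s \<in> Q \<longleftrightarrow> x \<in> ?S' \<and> s \<in> - {0}" if "x \<in> ?S" for x s
        using P[OF that] that val g(2) unfolding Q pb_affine_cline by auto
      show ?thesis
      proof (rule W[OF _ _ mem chart_set_open[OF c t t'] _ g(1)])
        show "u (?P x s) = weight L h \<tau> x + log_sq (g x * inverse s)" if "x \<in> ?S \<inter> ?S'" "s \<in> - {0}" for x s
        proof -
          have "?P x s \<in> pb_affine X A L (U' \<inter> V') (frame_A A L \<theta>')" using mem that unfolding Q by blast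
          from weight_quotient_metric[OF t _ _ h this] show ?thesis
            using that val unfolding u_def \<Theta> by (auto simp: divide_inverse mult.commute)
        qed
        show "inverse holomorphic_on - {0::complex}" by (intro holomorphic_intros) auto
      qed (use g(2) loginv in auto)
    qed
  next
    fix D c U \<theta> V \<tau>
    assume c: "(D, c) \<in> charts X" and t: "(U, \<theta>) \<in> lb_trivs A" "(V, \<tau>) \<in> lb_trivs L"
      and Dom: "Dom = pb_affine X A L (D \<inter> U \<inter> V) (frame_A A L \<theta>)"
      and ch: "ch = (\<lambda>(x, l). (c x)(cdim X := normalized l (frame_A A L \<theta> x) (frame_L A L \<tau> x)))"
    let ?P = "\<lambda>x s. (x, cline (dual_vec A L \<theta> \<tau> x 1 s))" and ?S = "D \<inter> U \<inter> V"
    have P: "?P x s \<in> pb_points X A L" if "x \<in> ?S" for x s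
      using pb_points_coords[OF t, of x] that by (metis Int_iff one_neq_zero)
    have chP: "ch (?P x s) = (c x)(cdim X := s)" if "x \<in> ?S" for x s
      using dual_vec_own_frame[OF t, of x 1 s] that unfolding ch by (simp add: normalized_cline)
    note W = fibred_weight[OF h c t(2) _ Dom[unfolded pb_affine_A_param[OF t]] chP]
    show ?thesis
    proof (rule triv_O1_cases[OF T])
      fix U' \<theta>' V' \<tau>'
      assume t': "(U', \<theta>') \<in> lb_trivs A" "(V', \<tau>') \<in> lb_trivs L"
        and Q: "Q = pb_affine X A L (U' \<inter> V') (frame_L A L \<tau>')"
        and \<Theta>: "\<Theta> = (\<lambda>((x, l), u). u (normalized l (frame_L A L \<tau>' x)))"
      let ?S' = "U' \<inter> V'"
      obtain g where g: "holo_on (cdim X) (c ` (?S \<inter> ?S')) (\<lambda>z. g (inv_into D c z))"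
        "\<And>x. x \<in> V \<inter> V' \<Longrightarrow> g x \<noteq> 0" "\<And>x. x \<in> V \<inter> V' \<Longrightarrow> \<tau> (frame L \<tau>' x) = inverse (g x)"
        using transition_frame[OF L t(2) t'(2) c, of "?S \<inter> ?S'"] by blast
      have val: "dual_vec A L \<theta> \<tau> x 1 s (frame_L A L \<tau>' x) = s * inverse (g x)" if "x \<in> ?S \<inter> ?S'" for x s
        using dual_vec_frame(2)[OF t _ _ t'(2)] g(3) that by auto
      have mem: "?P x s \<in> Q \<longleftrightarrow> x \<in> ?S' \<and> s \<in> - {0}" if "x \<in> ?S" for x s
        using P[OF that] that val g(2) unfolding Q pb_affine_cline by auto
      show ?thesis
      proof (rule W[OF _ _ mem chart_set_open[OF c t t'] _ g(1)])
        \<comment> \<open>The coordinate \<beta> = s cancels against the factor \<open>s\<close> in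
          the value on the frame, so \<open>m\<close> is constant although the chart is centred on
          P(A).\<close>
        show "u (?P x s) = weight L h \<tau> x + log_sq (g x * 1)" if "x \<in> ?S \<inter> ?S'" "s \<in> - {0}" for x s
        proof -
          have "?P x s \<in> pb_affine X A L (U' \<inter> V') (frame_L A L \<tau>')" using mem that unfolding Q by blast
          from weight_quotient_metric[OF t _ _ h this] show ?thesis
            using that val unfolding u_def \<Theta> by (auto simp: divide_inverse mult.assoc[symmetric])
        qed
      qed (use g(2) log1 in auto)
    next
      fix U' \<theta>' V' \<tau>'
      assume t': "(U', \<theta>') \<in> lb_trivs A" "(V', \<tau>') \<in> lb_trivs L"
        and Q: "Q = pb_affine X A L (U' \<inter> V') (frame_A A L \<theta>')"
        and \<Theta>: "\<Theta> = (\<lambda>((x, l), u). u (normalized l (frame_A A L \<theta>' x)))"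
      let ?S' = "U' \<inter> V'"
      obtain g where g: "holo_on (cdim X) (c ` (?S \<inter> ?S')) (\<lambda>z. g (inv_into D c z))"
        "\<And>x. x \<in> U \<inter> U' \<Longrightarrow> g x \<noteq> 0" "\<And>x. x \<in> U \<inter> U' \<Longrightarrow> \<theta> (frame A \<theta>' x) = inverse (g x)"
        using transition_frame[OF A t(1) t'(1) c, of "?S \<inter> ?S'"] by blast
      have val: "dual_vec A L \<theta> \<tau> x 1 s (frame_A A L \<theta>' x) = inverse (g x)" if "x \<in> ?S \<inter> ?S'" for x s
        using dual_vec_frame(1)[OF t _ _ t'(1)] g(3) that by auto
      have mem: "?P x s \<in> Q \<longleftrightarrow> x \<in> ?S' \<and> s \<in> UNIV" if "x \<in> ?S" for x s
        using P[OF that] that val g(2) unfolding Q pb_affine_cline by auto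
      show ?thesis
      proof (rule W[OF _ _ mem chart_set_open[OF c t t'] _ g(1)])
        show "u (?P x s) = weight L h \<tau> x + log_sq (g x * s)" if "x \<in> ?S \<inter> ?S'" for x s
        proof -
          have "?P x s \<in> pb_affine X A L (U' \<inter> V') (frame_A A L \<theta>')" using mem that unfolding Q by blast
          from weight_quotient_metric[OF t _ _ h this] show ?thesis
            using that val unfolding u_def \<Theta> by (auto simp: divide_inverse mult.commute)
        qed
      qed (use g(2) in auto)
    qed
  qed
qed

end

section \<open>Homogeneity of the quotient metric\<close>

context bundle_pair
begin

lemma cdim_proj_bundle: "cdim (proj_bundle X A L) = Suc (cdim X)"
  by (simp add: proj_bundle_def)

text \<open>If e induces u, then a times e induces a times u. This compares the two infima in one
  direction; the other comes from the same inequality for the inverse of a.\<close>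

lemma quotient_metric_scale_le:
  assumes h: "psh_metric X L h" and x: "x \<in> points X" and a: "a \<noteq> 0"
    and l: "\<And>\<xi>. \<xi> \<in> l \<Longrightarrow> \<xi> \<in> dual_sum A L x"
  shows "quotient_metric A L h ((x, l), \<lambda>\<xi>. a * u \<xi>) \<le> ennreal ((cmod a)\<^sup>2) * quotient_metric A L h ((x, l), u)"
proof -
  let ?S = "\<lambda>u. {e \<in> fibre L x. \<forall>\<xi>\<in>l. u \<xi> = \<xi> (lb_zero A x, e)}" and ?c = "ennreal ((cmod a)\<^sup>2)"
  have c: "?c > 0" "?c \<noteq> top" using a by auto
  \<comment> \<open>Dividing by the constant leaves a bare infimum on the right, which may be over
    the empty set, so that \<open>INF_greatest\<close> applies.\<close>
  have "quotient_metric A L h ((x, l), \<lambda>\<xi>. a * u \<xi>) / ?c \<le> h e" if e: "e \<in> ?S u" for e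
  proof (rule divide_le_posI_ennreal[OF c(1)])
    have "\<xi> (lb_zero A x, lb_scale L a e) = a * \<xi> (lb_zero A x, e)" if "\<xi> \<in> l" for \<xi>
    proof -
      have "\<xi> (lb_scale A a (lb_zero A x), lb_scale L a e) = a * \<xi> (lb_zero A x, e)"
        using l[OF that] zero_fibre[OF A x] e unfolding dual_sum_def by blast
      then show ?thesis using scale_zero[OF A x] by simp
    qed
    then have "lb_scale L a e \<in> ?S (\<lambda>\<xi>. a * u \<xi>)" using e scale_fibre[OF L x] by auto
    then have "quotient_metric A L h ((x, l), \<lambda>\<xi>. a * u \<xi>) \<le> h (lb_scale L a e)"
      unfolding quotient_metric_def by (auto intro: INF_lower)
    also have "\<dots> = ?c * h e" using e by (intro psh_metric_homogeneous[OF h]) (simp add: fibre_def)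
    finally show "quotient_metric A L h ((x, l), \<lambda>\<xi>. a * u \<xi>) \<le> ?c * h e" .
  qed
  then have "quotient_metric A L h ((x, l), \<lambda>\<xi>. a * u \<xi>) / ?c \<le> quotient_metric A L h ((x, l), u)"
    unfolding quotient_metric_def[of A L h] prod.case by (intro INF_greatest) auto
  then have "quotient_metric A L h ((x, l), \<lambda>\<xi>. a * u \<xi>) / ?c * ?c \<le> quotient_metric A L h ((x, l), u) * ?c"
    by (rule mult_right_mono) simp
  moreover have "y / ?c * ?c = y" for y
    using mult_divide_eq_ennreal[of ?c y] c by (metis ennreal_times_divide less_irrefl mult.commute)
  ultimately show ?thesis by (metis mult.commute)
qed

lemma quotient_metric_homogeneous:
  assumes h: "psh_metric X L h" and w: "w \<in> lb_total (O1 X A L)"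
  shows "quotient_metric A L h (lb_scale (O1 X A L) a w) = ennreal ((cmod a)\<^sup>2) * quotient_metric A L h w"
proof -
  obtain x l u where w': "w = ((x, l), u)" "(x, l) \<in> pb_points X A L" using w unfolding O1_def by auto
  have x: "x \<in> points X" using w'(2) unfolding pb_points_def by auto
  obtain U \<theta> where t: "(U, \<theta>) \<in> lb_trivs A" "x \<in> U" using triv_at[OF A x] .
  obtain V \<tau> where s: "(V, \<tau>) \<in> lb_trivs L" "x \<in> V" using triv_at[OF L x] .
  have l: "\<xi> \<in> dual_sum A L x" if \<xi>: "\<xi> \<in> l" for \<xi>
  proof -
    obtain \<alpha> \<beta> where "l = cline (dual_vec A L \<theta> \<tau> x \<alpha> \<beta>)"
      using w'(2) pb_points_coords[OF t(1) s(1) t(2) s(2)] by blast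
    then obtain k where "\<xi> = dual_vec A L \<theta> \<tau> x (k * \<alpha>) (k * \<beta>)"
      using \<xi> unfolding cline_def dual_vec_scale by blast
    then show ?thesis unfolding dual_sum_coords[OF A L x t s, folded dual_vec_def] by blast
  qed
  have sc: "lb_scale (O1 X A L) a w = ((x, l), \<lambda>\<xi>. a * u \<xi>)" unfolding w'(1) O1_def by simp
  show ?thesis
  proof (cases "a = 0")
    case True
    \<comment> \<open>The zero functional is induced by the zero vector, of length 0; on the other
      side 0 * \<infinity> = 0 in \<open>ennreal\<close> covers functionals of infinite
      length.\<close>
    have z: "lb_zero L x \<in> fibre L x" using zero_fibre[OF L x] .
    have "\<xi> (lb_zero A x, lb_zero L x) = 0" if "\<xi> \<in> l" for \<xi>
    proof -
      have "\<xi> (lb_scale A 0 (lb_zero A x), lb_scale L 0 (lb_zero L x)) = 0 * \<xi> (lb_zero A x, lb_zero L x)"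
        using l[OF that] z zero_fibre[OF A x] unfolding dual_sum_def by blast
      then show ?thesis using scale_zero[OF A x] scale_zero[OF L x] by simp
    qed
    then have "lb_zero L x \<in> {e \<in> fibre L x. \<forall>\<xi>\<in>l. 0 = \<xi> (lb_zero A x, e)}" using z by simp
    then have "quotient_metric A L h ((x, l), \<lambda>\<xi>. 0) \<le> h (lb_zero L x)"
      unfolding quotient_metric_def by (auto intro: INF_lower)
    also have "h (lb_zero L x) = 0"
      using psh_metric_homogeneous[OF h, of "lb_zero L x" 0] z scale_zero[OF L x] by (simp add: fibre_def)
    finally show ?thesis unfolding sc using True by simp
  next
    case False
    have "quotient_metric A L h w = quotient_metric A L h ((x, l), \<lambda>\<xi>. inverse a * (a * u \<xi>))"
    proof -
      have "(\<lambda>\<xi>. inverse a * (a * u \<xi>)) = u" using False by (simp add: mult.assoc[symmetric])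
      then show ?thesis unfolding w'(1) by simp
    qed
    also have "\<dots> \<le> ennreal ((cmod (inverse a))\<^sup>2) * quotient_metric A L h ((x, l), \<lambda>\<xi>. a * u \<xi>)"
      by (rule quotient_metric_scale_le[OF h x _ l]) (use False in auto)
    finally have "ennreal ((cmod a)\<^sup>2) * quotient_metric A L h w \<le>
       ennreal ((cmod a)\<^sup>2) * (ennreal ((cmod (inverse a))\<^sup>2) * quotient_metric A L h ((x, l), \<lambda>\<xi>. a * u \<xi>))"
      by (rule mult_left_mono) simp
    also have "\<dots> = quotient_metric A L h ((x, l), \<lambda>\<xi>. a * u \<xi>)"
      using False by (simp add: mult.assoc[symmetric] ennreal_mult[symmetric] power_mult_distrib[symmetric] norm_mult[symmetric] del: norm_mult)
    finally show ?thesis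
      unfolding sc
    proof (rule antisym[rotated])
      show "quotient_metric A L h ((x, l), \<lambda>\<xi>. a * u \<xi>) \<le> ennreal ((cmod a)\<^sup>2) * quotient_metric A L h w"
        unfolding w'(1) by (rule quotient_metric_scale_le[OF h x False l])
    qed
  qed
qed

lemma psh_metric_quotient:
  assumes h: "psh_metric X L h"
  shows "psh_metric (proj_bundle X A L) (O1 X A L) (quotient_metric A L h)"
  unfolding psh_metric_def singular_metric_def psh_fun_def L1_loc_fun_def cdim_proj_bundle
  using quotient_metric_homogeneous[OF h] quotient_metric_psh_L1[OF h] by auto

end

section \<open>The restriction to the divisor\<close>

context bundle_pair
begin

definition triv_L :: "('b \<Rightarrow> complex) \<Rightarrow> ('p, 'a, 'b) pb_point \<times> (('a \<times> 'b \<Rightarrow> complex) \<Rightarrow> complex) \<Rightarrow> complex" where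
  "triv_L \<tau> = (\<lambda>((x, l), u). u (normalized l (frame_L A L \<tau> x)))"

lemma triv_L_in:
  assumes "(U, \<theta>) \<in> lb_trivs A" "(V, \<tau>) \<in> lb_trivs L"
  shows "(pb_affine X A L (U \<inter> V) (frame_L A L \<tau>), triv_L \<tau>) \<in> lb_trivs (O1 X A L)"
  using assms unfolding O1_def triv_L_def by fastforce

lemma to_P_L_dual_vec:
  assumes t: "(U, \<theta>) \<in> lb_trivs A" "(V, \<tau>) \<in> lb_trivs L" "x \<in> U" "x \<in> V"
  shows "to_P_L A L x = (x, cline (dual_vec A L \<theta> \<tau> x 0 1))"
proof -
  have x: "x \<in> points X" using triv_sub[OF A t(1)] t(3) by blast
  have "dual_vec A L \<theta> \<tau> x 0 1 = (\<lambda>(a, b). if a \<in> fibre A x \<and> b \<in> fibre L x then \<tau> b else 0)"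
    by (auto simp: dual_vec_def fun_eq_iff)
  then show ?thesis using to_P_L_eq(1)[OF A L x t(1,3,2,4)] by simp
qed

lemma to_P_L_affine:
  assumes t: "(U, \<theta>) \<in> lb_trivs A" "(V, \<tau>) \<in> lb_trivs L" "x \<in> U" "x \<in> V"
  shows "to_P_L A L x \<in> pb_affine X A L (U \<inter> V) (frame_L A L \<tau>)"
  using pb_affine_L_param[OF t(1,2), of UNIV] t(3,4) unfolding to_P_L_dual_vec[OF t] by auto

definition restricted :: "(('p, 'a, 'b) pb_point \<times> (('a \<times> 'b \<Rightarrow> complex) \<Rightarrow> complex) \<Rightarrow> ennreal) \<Rightarrow> 'b \<Rightarrow> ennreal" where
  "restricted h = metric_restrict (O1 X A L) (P_L X A L) h \<circ> to_O1 A L"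

text \<open>Removes \<open>metric_restrict\<close>: its default value off P(L) is never met, as
  \<open>to_O1\<close> lands over P(L).\<close>

lemma restricted_eq:
  assumes "x \<in> points X" "e \<in> fibre L x"
  shows "restricted h e = h (to_O1 A L e)"
proof -
  have "lb_proj (O1 X A L) (to_O1 A L e) = to_P_L A L x"
    using assms(2) by (simp add: O1_def to_O1_def Let_def fibre_def)
  moreover have "to_P_L A L x \<in> P_L X A L" using to_P_L_bij[OF A L] assms(1) by (meson bij_betwE)
  ultimately show ?thesis unfolding restricted_def metric_restrict_def by simp
qed

text \<open>\<open>to_O1\<close> sends the frame of L to evaluation at that frame, which is the
  frame of O(1), so the weights agree without a correction term.\<close>

lemma weight_restricted:
  assumes t: "(U, \<theta>) \<in> lb_trivs A" "(V, \<tau>) \<in> lb_trivs L" "x \<in> U" "x \<in> V"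
  shows "weight L (restricted h) \<tau> x = weight (O1 X A L) h (triv_L \<tau>) (to_P_L A L x)"
proof -
  have x: "x \<in> points X" using triv_sub[OF A t(1)] t(3) by blast
  note f = frame_fibre[OF L t(2,4)]
  have "frame (O1 X A L) (triv_L \<tau>) (to_P_L A L x) = to_O1 A L (frame L \<tau> x)"
    using frame_O1[OF to_P_L_affine[OF t, unfolded to_P_L_dual_vec[OF t]]] f
    unfolding to_P_L_dual_vec[OF t] triv_L_def to_O1_def by (simp add: to_P_L_dual_vec[OF t] Let_def fibre_def frame_L_def cong del: if_weak_cong)
  then show ?thesis unfolding weight_def restricted_eq[OF x f] by simp
qed

text \<open>\<open>to_O1\<close> commutes with scaling, because the functionals are linear and
  scaling fixes the zero vector of A.\<close>

lemma restricted_homogeneous: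
  assumes h: "psh_metric (proj_bundle X A L) (O1 X A L) h" and e: "e \<in> lb_total L"
  shows "restricted h (lb_scale L a e) = ennreal ((cmod a)\<^sup>2) * restricted h e"
proof -
  let ?x = "lb_proj L e"
  have ef: "e \<in> fibre L ?x" using e by (simp add: fibre_def)
  have "lb_proj L ` lb_total L \<subseteq> points X" using L unfolding holomorphic_line_bundle_def by (elim conjE)
  then have x: "?x \<in> points X" using e by blast
  note sf = scale_fibre[OF L x ef, of a]
  have px: "lb_proj L (lb_scale L a e) = ?x" using sf by (simp add: fibre_def)
  have "\<xi> (lb_zero A ?x, lb_scale L a e) = a * \<xi> (lb_zero A ?x, e)" if "\<xi> \<in> snd (to_P_L A L ?x)" for \<xi>
  proof -
    have "\<xi> \<in> dual_sum A L ?x" using that unfolding to_P_L_def by simp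
    then have "\<xi> (lb_scale A a (lb_zero A ?x), lb_scale L a e) = a * \<xi> (lb_zero A ?x, e)"
      using zero_fibre[OF A x] ef unfolding dual_sum_def by blast
    then show ?thesis using scale_zero[OF A x] by simp
  qed
  then have "to_O1 A L (lb_scale L a e) = lb_scale (O1 X A L) a (to_O1 A L e)"
    unfolding to_O1_def px Let_def by (auto simp: O1_def)
  moreover have "to_O1 A L e \<in> lb_total (O1 X A L)"
    using to_O1_bij[OF A L x] ef unfolding bij_betw_def fibre_def by blast
  ultimately show ?thesis
    using psh_metric_homogeneous[OF h] restricted_eq[OF x ef] restricted_eq[OF x sf] by simp
qed

text \<open>P(L) is the slice s = 0 of the charts normalized by \<beta> = 1. Such a chart also needs
  a trivialization of A, which exists only near each point.\<close>

lemma restricted_psh_on: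
  assumes h: "psh_metric (proj_bundle X A L) (O1 X A L) h" and c: "(D, c) \<in> charts X" and t: "(V, \<tau>) \<in> lb_trivs L"
  shows "psh_on (cdim X) (c ` (V \<inter> D)) (\<lambda>z. weight L (restricted h) \<tau> (inv_into D c z))"
proof (rule psh_on_local)
  let ?n = "cdim X"
  note cf = chart_facts[OF X c]
  fix z assume "z \<in> c ` (V \<inter> D)"
  then obtain x where x: "x \<in> V" "x \<in> D" "z = c x" by blast
  obtain U \<theta> where s: "(U, \<theta>) \<in> lb_trivs A" "x \<in> U" using triv_at[OF A] triv_sub[OF L t] x(1) by blast
  let ?S = "D \<inter> U \<inter> V"
  let ?Dom = "pb_affine X A L ?S (frame_L A L \<tau>)" and ?Q = "pb_affine X A L (U \<inter> V) (frame_L A L \<tau>)"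
  let ?ch = "\<lambda>(x, l). (c x)(?n := normalized l (frame_L A L \<tau> x) (frame_A A L \<theta> x))"
  let ?P = "\<lambda>x s. (x, cline (dual_vec A L \<theta> \<tau> x s 1))"
  let ?\<phi> = "weight (O1 X A L) h (triv_L \<tau>)"
  have chart: "(?Dom, ?ch) \<in> charts (proj_bundle X A L)"
    using c s(1) t unfolding proj_bundle_def by fastforce
  have p: "psh_on (Suc ?n) (?ch ` (?Q \<inter> ?Dom)) (\<lambda>z. ?\<phi> (inv_into ?Dom ?ch z))"
    using psh_metric_psh_on[OF h chart triv_L_in[OF s(1) t]] unfolding cdim_proj_bundle .
  have chP: "?ch (?P x s) = (c x)(?n := s)" if "x \<in> ?S" for x s
    using dual_vec_own_frame[OF s(1) t, of x s 1] that by (simp add: normalized_cline)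
  have mem: "?P x s \<in> ?Q \<longleftrightarrow> x \<in> U \<inter> V \<and> s \<in> UNIV" if "x \<in> ?S" for x s
    using pb_affine_L_param[OF s(1) t, of UNIV] that by auto
  have SD: "?S \<subseteq> D" by blast
  note Dom = pb_affine_L_param[OF s(1) t, of D]
  have S: "?S \<inter> (U \<inter> V) = ?S" by blast
  have im: "?ch ` (?Q \<inter> ?Dom) = cprod ?n (c ` ?S) UNIV"
    using fibred_chart_image[OF cf(1,3) SD Dom, where ch = ?ch, OF chP mem] unfolding S by blast
  have open_S: "copen ?n (c ` ?S)"
    using chart_set_open[OF c s(1) t s(1) t] unfolding S .
  have "psh_on ?n (c ` ?S) (\<lambda>z. ?\<phi> (inv_into ?Dom ?ch z))"
    by (rule psh_on_cprod_slice[OF p[unfolded im] copen_subset[OF open_S]]) simp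
  then have "psh_on ?n (c ` ?S) (\<lambda>z. weight L (restricted h) \<tau> (inv_into D c z))"
  proof (rule psh_on_cong[OF open_S])
    fix w assume "w \<in> c ` ?S"
    then obtain y where y: "y \<in> ?S" "w = c y" by blast
    have "w ?n = 0" using y cf(3) by (auto simp: cspace_def)
    \<comment> \<open>The coordinate at index \<open>?n\<close> of a base point is 0, so
      \<open>w\<close> already is the chart value of the point of P(L) over
      \<open>y\<close>.\<close>
    then have "w = (c y)(?n := 0)" using y(2) by (metis fun_upd_triv)
    then have "inv_into ?Dom ?ch w = ?P y 0"
      using fibred_chart_inv[OF cf(1,3) SD Dom, where ch = ?ch, OF chP y(1)] by simp
    also have "\<dots> = to_P_L A L y" using to_P_L_dual_vec[OF s(1) t] y(1) by simp
    finally have "?\<phi> (inv_into ?Dom ?ch w) = weight L (restricted h) \<tau> y"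
      using weight_restricted[OF s(1) t] y(1) by simp
    moreover have "inv_into D c w = y" using inv_into_f_f[OF cf(1)] y by simp
    ultimately show "?\<phi> (inv_into ?Dom ?ch w) = weight L (restricted h) \<tau> (inv_into D c w)" by simp
  qed
  moreover have "openin (top_of_set (c ` (V \<inter> D))) (c ` ?S)"
    by (rule openin_subset_trans[OF open_S[unfolded copen_def] _
        copen_subset[OF copen_chart_image[OF X c triv_open[OF L t]]]]) blast
  ultimately show "\<exists>W'. z \<in> W' \<and> W' \<subseteq> c ` (V \<inter> D) \<and> openin (top_of_set (c ` (V \<inter> D))) W' \<and>
      psh_on ?n W' (\<lambda>z. weight L (restricted h) \<tau> (inv_into D c z))"
    using x s(2) by (intro exI[of _ "c ` ?S"]) blast
qed

lemma restricted_upper_bound: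
  assumes h: "minimal_singular_metric (proj_bundle X A L) (O1 X A L) h" and h': "psh_metric X L h'"
  shows "\<exists>C::real. \<forall>(V, \<tau>)\<in>lb_trivs L. \<forall>x\<in>V. weight L h' \<tau> x \<le> weight L (restricted h) \<tau> x + ereal C"
proof -
  obtain C :: real where C: "\<forall>(Q, \<Theta>)\<in>lb_trivs (O1 X A L). \<forall>q\<in>Q.
      weight (O1 X A L) (quotient_metric A L h') \<Theta> q \<le> weight (O1 X A L) h \<Theta> q + ereal C"
    using h psh_metric_quotient[OF h'] unfolding minimal_singular_metric_def by blast
  have "weight L h' \<tau> x \<le> weight L (restricted h) \<tau> x + ereal C" if t: "(V, \<tau>) \<in> lb_trivs L" "x \<in> V" for V \<tau> x
  proof -
    obtain U \<theta> where s: "(U, \<theta>) \<in> lb_trivs A" "x \<in> U" using triv_at[OF A] triv_sub[OF L t(1)] t(2) by blast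
    note ts = s(1) t(1) s(2) t(2)
    note q = to_P_L_affine[OF ts]
    \<comment> \<open>On P(L) the generator has \<beta> = 1 and takes the value 1 on the frame, so
      the logarithmic term is 0 and \<open>C\<close> carries over for all \<open>V\<close>, \<tau>
      and \<open>x\<close> alike.\<close>
    have "weight (O1 X A L) (quotient_metric A L h') (triv_L \<tau>) (to_P_L A L x) =
       weight L h' \<tau> x + log_sq (1 / 1)"
      using weight_quotient_metric[OF ts h' q[unfolded to_P_L_dual_vec[OF ts]]] dual_vec_own_frame[OF ts]
      unfolding to_P_L_dual_vec[OF ts] triv_L_def by simp
    moreover have "weight (O1 X A L) (quotient_metric A L h') (triv_L \<tau>) (to_P_L A L x) \<le>
        weight (O1 X A L) h (triv_L \<tau>) (to_P_L A L x) + ereal C"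
      using bspec[OF bspec[OF C triv_L_in[OF s(1) t(1)], unfolded prod.case] q] .
    ultimately show ?thesis
      unfolding weight_restricted[OF ts] by (simp add: log_sq_nz zero_ereal_def[symmetric])
  qed
  then show ?thesis by blast
qed

lemma restricted_minimal:
  assumes h: "minimal_singular_metric (proj_bundle X A L) (O1 X A L) h" and L': "pseudo_effective X L"
  shows "minimal_singular_metric X L (restricted h)"
proof -
  have ph: "psh_metric (proj_bundle X A L) (O1 X A L) h" using h unfolding minimal_singular_metric_def by blast
  obtain h0 where h0: "psh_metric X L h0" using L' unfolding pseudo_effective_def by blast
  obtain C :: real where C: "\<forall>(V, \<tau>)\<in>lb_trivs L. \<forall>x\<in>V. weight L h0 \<tau> x \<le> weight L (restricted h) \<tau> x + ereal C"
    using restricted_upper_bound[OF h h0] by (elim exE)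
  have L1: "L1_loc (cdim X) (c ` (V \<inter> D)) (\<lambda>z. weight L (restricted h) \<tau> (inv_into D c z))"
    if c: "(D, c) \<in> charts X" and t: "(V, \<tau>) \<in> lb_trivs L" for D c V \<tau>
  proof (rule L1_loc_lower_bound[OF copen_chart_image[OF X c triv_open[OF L t]] restricted_psh_on[OF ph c t]
      psh_metric_psh_on[OF h0 c t] psh_metric_L1[OF h0 c t]])
    fix z assume "z \<in> c ` (V \<inter> D)"
    then have "inv_into D c z \<in> V" using inv_into_f_f[OF chart_facts(1)[OF X c]] by auto
    then show "weight L h0 \<tau> (inv_into D c z) \<le> weight L (restricted h) \<tau> (inv_into D c z) + ereal C"
      using bspec[OF C t] by simp
  qed
  have "psh_metric X L (restricted h)"
    unfolding psh_metric_def singular_metric_def psh_fun_def L1_loc_fun_def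
    using restricted_homogeneous[OF ph] restricted_psh_on[OF ph] L1 by auto
  then show ?thesis
    unfolding minimal_singular_metric_def using restricted_upper_bound[OF h] by blast
qed

end

theorem theorem1p3:
  fixes X :: "'p cmanifold"
    and A :: "('p, 'a) line_bundle"
    and L :: "('p, 'b) line_bundle"
    and h :: "('p, 'a, 'b) pb_point \<times> (('a \<times> 'b \<Rightarrow> complex) \<Rightarrow> complex) \<Rightarrow> ennreal"
  assumes "smooth_projective_variety X"
    and "holomorphic_line_bundle X A"
    and "holomorphic_line_bundle X L"
    and "semi_ample X A"
    and "pseudo_effective X L"
    and "minimal_singular_metric (proj_bundle X A L) (O1 X A L) h"
  shows "minimal_singular_metric X L
           (metric_restrict (O1 X A L) (P_L X A L) h \<circ> to_O1 A L)"
proof -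
  interpret bundle_pair X A L
    using assms(1-3) by unfold_locales (auto simp: smooth_projective_variety_def)
  show ?thesis using restricted_minimal[OF assms(6,5)] unfolding restricted_def .
qed

end
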